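(* Let $d,T\in\mathbb N$ with $dT\ge3$, $k\in\mathbb N$, $s>k$, $\gamma>0$, and let $\mu\in\mathcal P([0,1]^{dT})$ have density $f\in\mathcal B^s_{\infty,\infty}([0,1]^{dT})$ with $f\ge1/\gamma$ over $[0,1]^{dT}$. Let $J_n\ge j_0$ be deterministic integers with $2^{J_n}\simeq n^{1/(2s+dT)}$, and let $\hat\mu_n$ be the wavelet density estimator built from $n$ i.i.d. samples of $\mu$ with threshold $J_n$ (defined in the context). Then there is a constant $C$ independent of $n$ such that for all $n\in\mathbb N$ $$\mathbb E\big[\mathcal{AW}_1(\mu,\hat\mu_n)\big]\le C\,n^{-\frac{k}{2k+dT}\cdot\frac{k}{k+1}}.$$
   Context: Notation: $a_n\simeq b_n$ means $C^{-1}b_n\le a_n\le Cb_n$ for some $C>0$ independent of $n$. Paths are $x=(x_1,\dots,x_T)\in\mathbb R^{dT}$ with $x_t\in\mathbb R^d$; measures on $[0,1]^{dT}$ are viewed as measures on $\mathbb R^{dT}$. Adapted Wasserstein distance: $$\mathcal{AW}_1(\mu,\nu)=\inf_{\pi\in\mathrm{Cpl}_{\mathrm{bc}}(\mu,\nu)}\int|x-y|_1\,d\pi,$$ where $|\cdot|_1$ is the $\ell^1$-norm. $\mathrm{Cpl}_{\mathrm{bc}}(\mu,\nu)$ is the set of bicausal couplings: couplings $\pi$ of $\mu,\nu$, with canonical processes $X,Y$, such that the law of $(X_1,Y_1)$ couples the first marginals and, for $t=1,\dots,T-1$ and $\pi$-a.e. $(x,y)$, the conditional law of $(X_{t+1},Y_{t+1})$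 given $(X_{1:t},Y_{1:t})=(x_{1:t},y_{1:t})$ is a coupling of the conditional law under $\mu$ of the next coordinate given $x_{1:t}$ and that under $\nu$ given $y_{1:t}$. Wavelets: fix an integer $N\ge2$ and an integer $j_0\ge\log_2N$ as in the construction of Cohen, Daubechies and Vial of the boundary-corrected $N$-th Daubechies wavelet system on $[0,1]$. That construction gives an orthonormal basis of $L^2([0,1])$ consisting of scaling functions $\zeta_{0j_0m}$, $0\le m\le2^{j_0}-1$, and wavelets $\xi_{0jm}$, $j\ge j_0$, $0\le m\le2^j-1$. It consists of interior Daubechies functions together with edge functions, rescaled dyadically, and the scaling functions at level $j_0$ span all polynomials of degree at most $N-1$ on $[0,1]$. The tensor-product system on $[0,1]^{dT}$ is $\Psi=\Phi\cup\bigcup_{j\ge j_0}\Psi_j$. Here $\Phi$ consists of the functions $\prod_{i=1}^{dT}\zeta_{0j_0m_i}(x_i)$ with $m\in\{0,\dots,2^{j_0}-1\}^{dT}$. $\Psi_j$ consists of the functions $\prod_{i:\ell_i=0}\zeta_{0jm_i}(x_i)\prod_{i:\ell_i=1}\xi_{0jm_i}(x_i)$ with $m\in\{0,\dots,2^j-1\}^{dT}$, $\ell\in\{0,1\}^{dT}\setminus\{0\}$, where $\zeta_{0jm}$ are the scaling functions at level $j$. (In these products $x_i$ denotes the $i$-th scalar coordinate.) $\Psi$ is an orthonormal basis of $L^2([0,1]^{dT})$, and $\Phi$ spans all polynomials of degree at most $N-1$. Besov space: for $s>0$ and $f\in L^\infty([0,1]^{dT})$ with expansion $f=\sum_{\zeta\in\Phi}\beta_\zeta\zeta+\sum_{j\ge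 j_0}\sum_{\xi\in\Psi_j}\beta_\xi\xi$ converging in $L^\infty$, $\beta_\xi=\int\xi f\,dx$ for $\xi\in\Psi$, set $$\|f\|_{\mathcal B^s_{\infty,\infty}}=\sup_{\zeta\in\Phi}|\beta_\zeta|+\sup_{j\ge j_0}2^{j(s+\frac{dT}2)}\sup_{\xi\in\Psi_j}|\beta_\xi|.$$ $\mathcal B^s_{\infty,\infty}([0,1]^{dT})$ is the set of such $f$ with finite norm. Estimator: let $X^{(1)},\dots,X^{(n)}$ be i.i.d. samples of $\mu$ and $\mu^n=\frac1n\sum_{i=1}^n\delta_{X^{(i)}}$. For deterministic $J_n\ge j_0$ let $$\tilde f_n=\sum_{\zeta\in\Phi}\hat\beta^n_\zeta\,\zeta+\sum_{j=j_0}^{J_n}\sum_{\xi\in\Psi_j}\hat\beta^n_\xi\,\xi,\qquad\hat\beta^n_\zeta=\int\zeta\,d\mu^n,\quad\hat\beta^n_\xi=\int\xi\,d\mu^n$$ on $[0,1]^{dT}$, extended by $0$ outside. Let $\varphi$ be the standard Gaussian density on $\mathbb R^{dT}$. Set $\hat f_n=\tilde f_n$ if $\tilde f_n$ is non-negative, and $\hat f_n(x)=\varphi(x-X^{(1)})$ otherwise. Finally $\hat\mu_n(dx)=\hat f_n(x)\,dx$. *)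

theory Defs
  imports "HOL-Probability.Probability" "HOL-Computational_Algebra.Polynomial"
begin

section \<open>Path space\<close>

text \<open>A path in \<open>(\<real>\<^sup>d)\<^sup>T\<close> is a function on the time set \<open>{1..T}\<close> with values in \<open>real ^ 'd\<close>
  (so \<open>d = CARD('d)\<close>); outside \<open>{1..T}\<close> it is \<open>undefined\<close>, as in \<^const>\<open>PiM\<close>.
  Scalar coordinates are indexed by pairs (time, component).\<close>

type_synonym 'd path = "nat \<Rightarrow> real ^ 'd"

definition path_space :: "nat \<Rightarrow> ('d::finite) path measure" where
  "path_space T = PiM {1..T} (\<lambda>_. borel)"

definition path_lebesgue :: "nat \<Rightarrow> ('d::finite) path measure" where
  "path_lebesgue T = PiM {1..T} (\<lambda>_. lborel)"

definition coords :: "nat \<Rightarrow> (nat \<times> 'd::finite) set" where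
  "coords T = {1..T} \<times> UNIV"

abbreviation coord :: "('d::finite) path \<Rightarrow> nat \<times> 'd \<Rightarrow> real" where
  "coord x p \<equiv> x (fst p) $ snd p"

definition unit_cube :: "nat \<Rightarrow> ('d::finite) path set" where
  "unit_cube T = {x \<in> space (path_space T). \<forall>p\<in>coords T. coord x p \<in> {0..1}}"

definition cube_lebesgue :: "nat \<Rightarrow> ('d::finite) path measure" where
  "cube_lebesgue T = restrict_space (path_lebesgue T) (unit_cube T)"

definition l1_dist :: "nat \<Rightarrow> ('d::finite) path \<Rightarrow> 'd path \<Rightarrow> real" where
  "l1_dist T x y = (\<Sum>p\<in>coords T. \<bar>coord x p - coord y p\<bar>)"


section \<open>Adapted Wasserstein distance\<close>

definition couplings :: "'a measure \<Rightarrow> 'b measure \<Rightarrow> ('a \<times> 'b) measure set" where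
  "couplings M N =
     {\<pi>. sets \<pi> = sets (M \<Otimes>\<^sub>M N) \<and> distr \<pi> M fst = M \<and> distr \<pi> N snd = N}"

text \<open>\<open>\<kappa>\<close> is a regular conditional law under \<open>P\<close> of \<open>V\<close> (values in \<open>B\<close>) given \<open>U\<close> (values in \<open>A\<close>).\<close>

definition conditional_law ::
  "'w measure \<Rightarrow> 'a measure \<Rightarrow> 'b measure \<Rightarrow> ('w \<Rightarrow> 'a) \<Rightarrow> ('w \<Rightarrow> 'b) \<Rightarrow> ('a \<Rightarrow> 'b measure) \<Rightarrow> bool"
  where
  "conditional_law P A B U V \<kappa> \<longleftrightarrow>
     \<kappa> \<in> A \<rightarrow>\<^sub>M prob_algebra B \<and>
     (\<forall>S\<in>sets A. \<forall>R\<in>sets B.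
        emeasure P {\<omega> \<in> space P. U \<omega> \<in> S \<and> V \<omega> \<in> R} =
        (\<integral>\<^sup>+\<omega>. indicator S (U \<omega>) * emeasure (\<kappa> (U \<omega>)) R \<partial>P))"

definition past_space :: "nat \<Rightarrow> ('d::finite) path measure" where
  "past_space t = PiM {1..t} (\<lambda>_. borel)"

abbreviation past :: "nat \<Rightarrow> ('d::finite) path \<Rightarrow> 'd path" where
  "past t x \<equiv> restrict x {1..t}"

text \<open>Regular conditional laws are unique up to null sets and exist here, since all spaces are
  standard Borel; hence the existential choice of versions below is immaterial.\<close>

definition bicausal_couplings ::
  "nat \<Rightarrow> ('d::finite) path measure \<Rightarrow> 'd path measure \<Rightarrow> ('d path \<times> 'd path) measure set"
  where
  "bicausal_couplings T \<mu> \<nu> =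
     {\<pi> \<in> couplings \<mu> \<nu>.
        distr \<pi> (borel \<Otimes>\<^sub>M borel) (\<lambda>(x, y). (x 1, y 1))
          \<in> couplings (distr \<mu> borel (\<lambda>x. x 1)) (distr \<nu> borel (\<lambda>y. y 1)) \<and>
        (\<forall>t\<in>{1..<T}. \<exists>\<kappa> \<kappa>\<^sub>\<mu> \<kappa>\<^sub>\<nu>.
           conditional_law \<pi> (past_space t \<Otimes>\<^sub>M past_space t) (borel \<Otimes>\<^sub>M borel)
             (\<lambda>(x, y). (past t x, past t y)) (\<lambda>(x, y). (x (t + 1), y (t + 1))) \<kappa> \<and>
           conditional_law \<mu> (past_space t) borel (past t) (\<lambda>x. x (t + 1)) \<kappa>\<^sub>\<mu> \<and>
           conditional_law \<nu> (past_space t) borel (past t) (\<lambda>y. y (t + 1)) \<kappa>\<^sub>\<nu> \<and>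
           (AE (x, y) in \<pi>. \<kappa> (past t x, past t y) \<in> couplings (\<kappa>\<^sub>\<mu> (past t x)) (\<kappa>\<^sub>\<nu> (past t y))))}"

definition AW1 :: "nat \<Rightarrow> ('d::finite) path measure \<Rightarrow> 'd path measure \<Rightarrow> ennreal" where
  "AW1 T \<mu> \<nu> = (INF \<pi>\<in>bicausal_couplings T \<mu> \<nu>. \<integral>\<^sup>+(x, y). ennreal (l1_dist T x y) \<partial>\<pi>)"


section \<open>Boundary-corrected Daubechies wavelets on the unit interval\<close>

definition orthonormal_family :: "'a measure \<Rightarrow> 'i set \<Rightarrow> ('i \<Rightarrow> 'a \<Rightarrow> real) \<Rightarrow> bool" where
  "orthonormal_family M I e \<longleftrightarrow>
     (\<forall>i\<in>I. e i \<in> borel_measurable M \<and> integrable M (\<lambda>x. (e i x)\<^sup>2)) \<and>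
     (\<forall>i\<in>I. \<forall>k\<in>I. (\<integral>x. e i x * e k x \<partial>M) = (if i = k then 1 else 0))"

definition orthonormal_basis_L2 :: "'a measure \<Rightarrow> 'i set \<Rightarrow> ('i \<Rightarrow> 'a \<Rightarrow> real) \<Rightarrow> bool" where
  "orthonormal_basis_L2 M I e \<longleftrightarrow>
     orthonormal_family M I e \<and>
     (\<forall>g\<in>borel_measurable M. integrable M (\<lambda>x. (g x)\<^sup>2) \<longrightarrow>
        (\<forall>i\<in>I. (\<integral>x. e i x * g x \<partial>M) = 0) \<longrightarrow> (AE x in M. g x = 0))"

abbreviation half_line :: "real measure" where
  "half_line \<equiv> restrict_space lborel {0..}"

text \<open>The \<open>N\<close>-th Daubechies scaling function \<open>\<phi>\<close> and wavelet \<open>\<psi>\<close>, with filter \<open>h\<close> of length \<open>2 N\<close>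
  and \<open>N\<close> vanishing moments, centred so that both are supported in \<open>[1 - N, N]\<close>.
  The conditions on \<open>h\<close> leave open which spectral factor is taken
  (extremal phase, least asymmetric, ...).\<close>

definition daubechies ::
  "nat \<Rightarrow> (int \<Rightarrow> real) \<Rightarrow> (real \<Rightarrow> real) \<Rightarrow> (real \<Rightarrow> real) \<Rightarrow> bool" where
  "daubechies N h \<phi> \<psi> \<longleftrightarrow>
     (\<forall>n. n \<notin> {1 - int N..int N} \<longrightarrow> h n = 0) \<and>
     (\<Sum>n\<in>{1 - int N..int N}. h n) = sqrt 2 \<and>
     (\<forall>k. (\<Sum>n\<in>{1 - int N..int N}. h n * h (n + 2 * k)) = (if k = 0 then 1 else 0)) \<and>
     (\<forall>p<N. (\<Sum>n\<in>{1 - int N..int N}. (- 1) powi n * of_int n ^ p * h n) = 0) \<and>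
     continuous_on UNIV \<phi> \<and>
     (\<forall>x. x \<notin> {1 - real N..real N} \<longrightarrow> \<phi> x = 0) \<and>
     (\<integral>x. \<phi> x \<partial>lborel) = 1 \<and>
     (\<forall>x. \<phi> x = sqrt 2 * (\<Sum>n\<in>{1 - int N..int N}. h n * \<phi> (2 * x - of_int n))) \<and>
     (\<forall>x. \<psi> x = sqrt 2 * (\<Sum>n\<in>{1 - int N..int N}. (- 1) powi n * h (1 - n) * \<phi> (2 * x - of_int n)))"

text \<open>Edge functions at the left end point, on the half line \<open>[0, \<infinity>)\<close> and at scale 1.
  Cohen, Daubechies and Vial orthonormalise the functions \<open>raw_edge N \<phi> k\<close>, \<open>k < N\<close>; together with
  the translates \<open>\<phi> (x - m)\<close>, \<open>m \<ge> N\<close>, these reproduce the polynomials of degree less than \<open>N\<close>.\<close>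

definition raw_edge :: "nat \<Rightarrow> (real \<Rightarrow> real) \<Rightarrow> nat \<Rightarrow> real \<Rightarrow> real" where
  "raw_edge N \<phi> k x = (\<Sum>n\<in>{k..2 * N - 2}. real (n choose k) * \<phi> (x + real n - real N + 1))"

definition edge_scaling :: "nat \<Rightarrow> (real \<Rightarrow> real) \<Rightarrow> (nat \<Rightarrow> real \<Rightarrow> real) \<Rightarrow> bool" where
  "edge_scaling N \<phi> e \<longleftrightarrow>
     orthonormal_family half_line {..<N} e \<and>
     (\<forall>k<N. \<exists>a. \<forall>x\<ge>0. e k x = (\<Sum>l<N. a l * raw_edge N \<phi> l x))"

text \<open>The edge wavelets span the part of the orthogonal complement of the half-line scaling space in
  the next finer one that is not spanned by the interior wavelets \<open>\<psi> (x - m)\<close>, \<open>m \<ge> N\<close>.\<close>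

definition edge_wavelets ::
  "nat \<Rightarrow> (real \<Rightarrow> real) \<Rightarrow> (real \<Rightarrow> real) \<Rightarrow> (nat \<Rightarrow> real \<Rightarrow> real) \<Rightarrow> (nat \<Rightarrow> real \<Rightarrow> real) \<Rightarrow> bool"
  where
  "edge_wavelets N \<phi> \<psi> e w \<longleftrightarrow>
     orthonormal_family half_line {..<N} w \<and>
     (\<forall>k<N. \<exists>a b. \<forall>x\<ge>0. w k x =
        (\<Sum>l<N. a l * (sqrt 2 * e l (2 * x))) +
        (\<Sum>m\<in>{N..3 * N - 2}. b m * (sqrt 2 * \<phi> (2 * x - real m)))) \<and>
     (\<forall>k<N. \<forall>l<N. (\<integral>x. w k x * e l x \<partial>half_line) = 0) \<and>
     (\<forall>k<N. \<forall>m\<ge>N. (\<integral>x. w k x * \<phi> (x - real m) \<partial>half_line) = 0 \<and>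
                    (\<integral>x. w k x * \<psi> (x - real m) \<partial>half_line) = 0)"

text \<open>Dyadic rescaling: \<open>N\<close> left edge functions, \<open>2^j - 2 N\<close> interior functions and \<open>N\<close> right edge
  functions, the latter given on the half line and reflected by \<open>x \<mapsto> 1 - x\<close>.\<close>

definition interval_system ::
  "nat \<Rightarrow> (real \<Rightarrow> real) \<Rightarrow> (nat \<Rightarrow> real \<Rightarrow> real) \<Rightarrow> (nat \<Rightarrow> real \<Rightarrow> real) \<Rightarrow> nat \<Rightarrow> nat \<Rightarrow> real \<Rightarrow> real"
  where
  "interval_system N g eL eR j m x = 2 powr (real j / 2) *
     (if m < N then eL m (2 ^ j * x)
      else if m < 2 ^ j - N then g (2 ^ j * x - real m)
      else eR (2 ^ j - 1 - m) (2 ^ j * (1 - x)))"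

definition onb_index :: "nat \<Rightarrow> (nat + nat \<times> nat) set" where
  "onb_index j = Inl ` {..<2 ^ j} \<union> Inr ` (SIGMA i:{j..}. {..<2 ^ i})"

text \<open>\<open>cdv_system N j0 \<zeta> \<xi>\<close>: the functions \<open>\<zeta> j m\<close> and \<open>\<xi> j m\<close> (\<open>j \<ge> j0\<close>, \<open>m < 2 ^ j\<close>) are the scaling
  functions and wavelets of a boundary-corrected \<open>N\<close>-th Daubechies system on \<open>[0, 1]\<close>.
  The right edge functions are the left edge functions of the reflected pair
  \<open>\<phi> (1 - x)\<close>, \<open>\<psi> (1 - x)\<close> (a Daubechies pair for the reversed filter, up to the sign of
  the wavelet).
  The \<open>N + N\<close> edge functions only fit in \<open>[0, 1]\<close> if \<open>2 N \<le> 2 ^ j\<close>, so their form is prescribed for these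
  levels. The assumption \<open>j0 \<ge> log 2 N\<close> admits at most one coarser level, where
  only the remaining properties (multiresolution, orthonormality, polynomials) are required.\<close>

definition cdv_system ::
  "nat \<Rightarrow> nat \<Rightarrow> (nat \<Rightarrow> nat \<Rightarrow> real \<Rightarrow> real) \<Rightarrow> (nat \<Rightarrow> nat \<Rightarrow> real \<Rightarrow> real) \<Rightarrow> bool" where
  "cdv_system N j0 \<zeta> \<xi> \<longleftrightarrow>
     (\<exists>h \<phi> \<psi> eL eR wL wR.
        daubechies N h \<phi> \<psi> \<and>
        edge_scaling N \<phi> eL \<and> edge_wavelets N \<phi> \<psi> eL wL \<and>
        edge_scaling N (\<lambda>x. \<phi> (1 - x)) eR \<and>
        edge_wavelets N (\<lambda>x. \<phi> (1 - x)) (\<lambda>x. \<psi> (1 - x)) eR wR \<and>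
        (\<forall>j\<ge>j0. 2 * N \<le> 2 ^ j \<longrightarrow> (\<forall>m<2 ^ j. \<forall>x\<in>{0..1}.
           \<zeta> j m x = interval_system N \<phi> eL eR j m x \<and>
           \<xi> j m x = interval_system N \<psi> wL wR j m x))) \<and>
     (\<forall>j\<ge>j0. \<forall>m<2 ^ j.
        (\<exists>c. \<forall>x\<in>{0..1}. \<zeta> j m x = (\<Sum>l<2 ^ (j + 1). c l * \<zeta> (j + 1) l x)) \<and>
        (\<exists>c. \<forall>x\<in>{0..1}. \<xi> j m x = (\<Sum>l<2 ^ (j + 1). c l * \<zeta> (j + 1) l x))) \<and>
     (\<forall>j\<ge>j0. orthonormal_basis_L2 (restrict_space lborel {0..1}) (onb_index j)
                (case_sum (\<zeta> j) (\<lambda>(i, m). \<xi> i m))) \<and>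
     (\<forall>p::real poly. degree p \<le> N - 1 \<longrightarrow>
        (\<exists>c. \<forall>x\<in>{0..1}. poly p x = (\<Sum>m<2 ^ j0. c m * \<zeta> j0 m x)))"


section \<open>Tensor-product system and Besov spaces\<close>

definition tensor_wavelet ::
  "nat \<Rightarrow> (nat \<Rightarrow> nat \<Rightarrow> real \<Rightarrow> real) \<Rightarrow> (nat \<Rightarrow> nat \<Rightarrow> real \<Rightarrow> real) \<Rightarrow> nat \<Rightarrow>
   (nat \<times> 'd::finite \<Rightarrow> nat) \<times> (nat \<times> 'd \<Rightarrow> nat) \<Rightarrow> 'd path \<Rightarrow> real" where
  "tensor_wavelet T \<zeta> \<xi> j = (\<lambda>(l, m) x. indicator (unit_cube T) x *
     (\<Prod>p\<in>coords T. if l p = 0 then \<zeta> j (m p) (coord x p) else \<xi> j (m p) (coord x p)))"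

definition Phi_index ::
  "nat \<Rightarrow> nat \<Rightarrow> ((nat \<times> 'd::finite \<Rightarrow> nat) \<times> (nat \<times> 'd \<Rightarrow> nat)) set" where
  "Phi_index T j0 = {\<lambda>p\<in>coords T. 0} \<times> (coords T \<rightarrow>\<^sub>E {..<2 ^ j0})"

definition Psi_index ::
  "nat \<Rightarrow> nat \<Rightarrow> ((nat \<times> 'd::finite \<Rightarrow> nat) \<times> (nat \<times> 'd \<Rightarrow> nat)) set" where
  "Psi_index T j = ((coords T \<rightarrow>\<^sub>E {0, 1}) - {\<lambda>p\<in>coords T. 0}) \<times> (coords T \<rightarrow>\<^sub>E {..<2 ^ j})"

text \<open>Wavelet series truncated at level \<open>J\<close>; the functional \<open>L\<close> assigns to each basis function its
  coefficient.\<close>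

definition wavelet_sum ::
  "nat \<Rightarrow> nat \<Rightarrow> (nat \<Rightarrow> nat \<Rightarrow> real \<Rightarrow> real) \<Rightarrow> (nat \<Rightarrow> nat \<Rightarrow> real \<Rightarrow> real) \<Rightarrow>
   ((('d::finite) path \<Rightarrow> real) \<Rightarrow> real) \<Rightarrow> nat \<Rightarrow> 'd path \<Rightarrow> real" where
  "wavelet_sum T j0 \<zeta> \<xi> L J x =
     (\<Sum>i\<in>Phi_index T j0. L (tensor_wavelet T \<zeta> \<xi> j0 i) * tensor_wavelet T \<zeta> \<xi> j0 i x) +
     (\<Sum>j=j0..J. \<Sum>i\<in>Psi_index T j. L (tensor_wavelet T \<zeta> \<xi> j i) * tensor_wavelet T \<zeta> \<xi> j i x)"

definition coeff_of :: "nat \<Rightarrow> (('d::finite) path \<Rightarrow> real) \<Rightarrow> ('d path \<Rightarrow> real) \<Rightarrow> real" where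
  "coeff_of T f g = (\<integral>x. g x * f x \<partial>cube_lebesgue T)"

definition besov_norm ::
  "nat \<Rightarrow> nat \<Rightarrow> (nat \<Rightarrow> nat \<Rightarrow> real \<Rightarrow> real) \<Rightarrow> (nat \<Rightarrow> nat \<Rightarrow> real \<Rightarrow> real) \<Rightarrow> real \<Rightarrow>
   (('d::finite) path \<Rightarrow> real) \<Rightarrow> ennreal" where
  "besov_norm T j0 \<zeta> \<xi> s f =
     (SUP i\<in>Phi_index T j0. ennreal \<bar>coeff_of T f (tensor_wavelet T \<zeta> \<xi> j0 i)\<bar>) +
     (SUP j\<in>{j0..}. ennreal (2 powr (real j * (s + real (CARD('d) * T) / 2))) *
        (SUP i\<in>Psi_index T j. ennreal \<bar>coeff_of T f (tensor_wavelet T \<zeta> \<xi> j i)\<bar>))"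

definition besov_space ::
  "nat \<Rightarrow> nat \<Rightarrow> (nat \<Rightarrow> nat \<Rightarrow> real \<Rightarrow> real) \<Rightarrow> (nat \<Rightarrow> nat \<Rightarrow> real \<Rightarrow> real) \<Rightarrow> real \<Rightarrow>
   (('d::finite) path \<Rightarrow> real) set" where
  "besov_space T j0 \<zeta> \<xi> s =
     {f \<in> borel_measurable (cube_lebesgue T).
        esssup (cube_lebesgue T) (\<lambda>x. ereal \<bar>f x\<bar>) < \<infinity> \<and>
        (\<lambda>J. esssup (cube_lebesgue T)
           (\<lambda>x. ereal \<bar>f x - wavelet_sum T j0 \<zeta> \<xi> (coeff_of T f) J x\<bar>)) \<longlonglongrightarrow> 0 \<and>
        besov_norm T j0 \<zeta> \<xi> s f < \<infinity>}"


section \<open>The wavelet density estimator\<close>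

text \<open>In this section \<open>X i\<close> is the observed value of the \<open>i\<close>-th sample, \<open>1 \<le> i \<le> n\<close>.\<close>

definition empirical_measure :: "nat \<Rightarrow> nat \<Rightarrow> (nat \<Rightarrow> ('d::finite) path) \<Rightarrow> 'd path measure" where
  "empirical_measure T n X = distr (uniform_count_measure {1..n}) (path_space T) X"

definition pre_estimator ::
  "nat \<Rightarrow> nat \<Rightarrow> (nat \<Rightarrow> nat \<Rightarrow> real \<Rightarrow> real) \<Rightarrow> (nat \<Rightarrow> nat \<Rightarrow> real \<Rightarrow> real) \<Rightarrow> nat \<Rightarrow> nat \<Rightarrow>
   (nat \<Rightarrow> ('d::finite) path) \<Rightarrow> 'd path \<Rightarrow> real" where
  "pre_estimator T j0 \<zeta> \<xi> J n X =
     wavelet_sum T j0 \<zeta> \<xi> (\<lambda>g. \<integral>x. g x \<partial>empirical_measure T n X) J"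

definition gaussian_density :: "nat \<Rightarrow> ('d::finite) path \<Rightarrow> real" where
  "gaussian_density T x = (\<Prod>p\<in>coords T. std_normal_density (coord x p))"

definition density_estimator ::
  "nat \<Rightarrow> nat \<Rightarrow> (nat \<Rightarrow> nat \<Rightarrow> real \<Rightarrow> real) \<Rightarrow> (nat \<Rightarrow> nat \<Rightarrow> real \<Rightarrow> real) \<Rightarrow> nat \<Rightarrow> nat \<Rightarrow>
   (nat \<Rightarrow> ('d::finite) path) \<Rightarrow> 'd path \<Rightarrow> real" where
  "density_estimator T j0 \<zeta> \<xi> J n X =
     (if \<forall>x\<in>space (path_space T). 0 \<le> pre_estimator T j0 \<zeta> \<xi> J n X x
      then pre_estimator T j0 \<zeta> \<xi> J n X
      else (\<lambda>x. gaussian_density T (\<lambda>t. x t - X 1 t)))"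

definition measure_estimator ::
  "nat \<Rightarrow> nat \<Rightarrow> (nat \<Rightarrow> nat \<Rightarrow> real \<Rightarrow> real) \<Rightarrow> (nat \<Rightarrow> nat \<Rightarrow> real \<Rightarrow> real) \<Rightarrow> nat \<Rightarrow> nat \<Rightarrow>
   (nat \<Rightarrow> ('d::finite) path) \<Rightarrow> 'd path measure" where
  "measure_estimator T j0 \<zeta> \<xi> J n X =
     density (path_lebesgue T) (\<lambda>x. ennreal (density_estimator T j0 \<zeta> \<xi> J n X x))"

definition iid_samples :: "'w measure \<Rightarrow> 'a measure \<Rightarrow> nat \<Rightarrow> (nat \<Rightarrow> 'w \<Rightarrow> 'a) \<Rightarrow> bool" where
  "iid_samples P \<mu> n X \<longleftrightarrow>
     prob_space P \<and> prob_space.indep_vars P (\<lambda>_. \<mu>) X {1..n} \<and> (\<forall>i\<in>{1..n}. distr P \<mu> (X i) = \<mu>)"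

text \<open>Expectation of a non-negative quantity. It agrees with \<^const>\<open>nn_integral\<close> for measurable \<open>F\<close>;
  for non-measurable \<open>F\<close>, \<^const>\<open>nn_integral\<close> would be a lower integral and upper bounds on it would be
  too weak.\<close>

definition expect :: "'w measure \<Rightarrow> ('w \<Rightarrow> ennreal) \<Rightarrow> ennreal" where
  "expect P F = (INF Z\<in>{Z \<in> borel_measurable P. \<forall>\<omega>\<in>space P. F \<omega> \<le> Z \<omega>}. \<integral>\<^sup>+\<omega>. Z \<omega> \<partial>P)"

lemma expect_eq_nn_integral:
  assumes "F \<in> borel_measurable P"
  shows "expect P F = (\<integral>\<^sup>+\<omega>. F \<omega> \<partial>P)"
  unfolding expect_def
  by (rule antisym) (use assms in \<open>auto intro!: INF_lower INF_greatest nn_integral_mono\<close>)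

lemma nn_integral_le_expect: "(\<integral>\<^sup>+\<omega>. F \<omega> \<partial>P) \<le> expect P F"
  unfolding expect_def by (auto intro!: INF_greatest nn_integral_mono)

end

theory Submission
  imports Defs
begin

text \<open>
  Write \<open>D = d T\<close> and let \<open>\<theta>\<close> be the exponent in the claim. If two path densities satisfy \<open>f \<le> K g\<close> and
  \<open>g \<le> K f\<close>, then so do their marginals, hence the conditional densities are comparable up to the factor
  \<open>K\<^sup>2\<close>. Couple the next coordinates maximally as long as the two pasts agree, and independently
  afterwards: this is bicausal, and the paths separate with probability at most \<open>1 - 1 / K\<^sup>2\<close> in each step.
  Thus, on the cube, the adapted distance is at most a constant times \<open>K - 1\<close>, and, since \<open>f\<close> is bounded
  below, it is dominated by the distance of the densities in the supremum norm.

  Since \<open>\<theta> < s / (2 s + D)\<close>, the logarithmic loss of the supremum norm is harmless: an exponential Chebyshev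
  bound shows that, outside an event of probability \<open>O(n\<^sup>-\<^sup>\<theta>)\<close>, all empirical coefficients up to
  level \<open>J\<close> deviate from their means by at most \<open>n\<^sup>-\<^sup>\<theta> 2\<^sup>-\<^sup>J\<^sup>D\<^sup>/\<^sup>2\<close>, so that the series estimator is
  \<open>O(n\<^sup>-\<^sup>\<theta>)\<close>-close to its mean, which in turn is \<open>O(2\<^sup>-\<^sup>J\<^sup>s)\<close>-close to \<open>f\<close>. It is then non-negative, and it has
  mass one because the scaling functions reproduce constants. On the exceptional event any bicausal
  coupling has cost at most \<open>4 D\<close>.
\<close>

text \<open>Ratios rather than differences of densities are compared because only ratios survive
  both integrating coordinates out and dividing by a marginal, at any depth of conditioning; the
  lower bound 1 / \<gamma> turns an additive error into a ratio. The map x -> x / (2 x + D) is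
  increasing and k / (k + 1) < 1, so \<theta> stays strictly below the exponent of the bias. With r
  = 2^(JD/2) and deviation threshold n^(-\<theta>) / r, one has r^2 = O(n^(D/(2s+D))), so n times
  the squared threshold is at least of order n^\<alpha> with \<alpha> = 2 (s / (2 s + D) - \<theta>)
  > 0. This stretched exponential beats the polynomial number of coefficients. Two obstacles shape
  the rest: the assumptions on f hold only almost everywhere, whereas the estimator tests its sign
  at every point; and the adapted distance is not shown to be measurable in the sample, so the
  expectation is bounded through an explicit measurable majorant.\<close>

section \<open>Maximal couplings\<close>

text \<open>The Boolean coordinate selects the diagonal part, of density \<open>m\<close>, or the remainder; on the diagonal
  part the auxiliary probability density \<open>u\<close> integrates out the unused coordinate. If \<open>m\<close> has mass one, the
  remainder vanishes since \<open>0 / 0 = 0\<close> in \<^typ>\<open>ennreal\<close>. Taking \<open>m = 0\<close> gives the product coupling.\<close>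

definition overlap_coupling ::
  "'a measure \<Rightarrow> ('a \<Rightarrow> ennreal) \<Rightarrow> ('a \<Rightarrow> ennreal) \<Rightarrow> ('a \<Rightarrow> ennreal) \<Rightarrow> ('a \<Rightarrow> ennreal) \<Rightarrow> ('a \<times> 'a) measure"
  where
  "overlap_coupling M u m p q =
     distr (density (M \<Otimes>\<^sub>M M \<Otimes>\<^sub>M count_space (UNIV :: bool set))
       (\<lambda>(a, b, z). if z then m a * u b else (p a - m a) * (q b - m b) / (1 - (\<integral>\<^sup>+a. m a \<partial>M))))
       (M \<Otimes>\<^sub>M M) (\<lambda>(a, b, z). (a, if z then a else b))"

lemma measurable_diag_bool:
  "(\<lambda>(a, b, z). (a, if z then a else b)) \<in> M \<Otimes>\<^sub>M M \<Otimes>\<^sub>M count_space (UNIV :: bool set) \<rightarrow>\<^sub>M M \<Otimes>\<^sub>M M"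
  by measurable

lemma sets_overlap_coupling: "sets (overlap_coupling M u m p q) = sets (M \<Otimes>\<^sub>M M)"
  by (simp add: overlap_coupling_def)

text \<open>\<open>couplings\<close> forms each projection law with the marginal itself as target,
  hence the target \<open>density M p\<close>. Testing against all non-negative measurable functions
  lets the explicit integral formula below identify the law.\<close>

lemma distr_eq_densityI:
  assumes \<phi>: "\<phi> \<in> Q \<rightarrow>\<^sub>M M" and p: "p \<in> borel_measurable M"
    and eq: "\<And>g. g \<in> borel_measurable M \<Longrightarrow> (\<integral>\<^sup>+w. g (\<phi> w) \<partial>Q) = (\<integral>\<^sup>+a. p a * g a \<partial>M)"
  shows "distr Q (density M p) \<phi> = density M p"
proof (rule measure_eqI)
  fix A assume "A \<in> sets (distr Q (density M p) \<phi>)"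
  then have A: "A \<in> sets M" by simp
  have "emeasure (distr Q (density M p) \<phi>) A = (\<integral>\<^sup>+w. indicator A w \<partial>distr Q (density M p) \<phi>)"
    using A by simp
  also have "\<dots> = (\<integral>\<^sup>+w. indicator A (\<phi> w) \<partial>Q)"
    using \<phi> A by (intro nn_integral_distr) (auto cong: measurable_cong_sets)
  also have "\<dots> = emeasure (density M p) A"
    using p A by (simp add: eq emeasure_density)
  finally show "emeasure (distr Q (density M p) \<phi>) A = emeasure (density M p) A" .
qed simp

locale overlap = sigma_finite_measure M for M :: "'a measure" +
  fixes u m p q :: "'a \<Rightarrow> ennreal"
  assumes meas [measurable]: "u \<in> borel_measurable M" "m \<in> borel_measurable M"
      "p \<in> borel_measurable M" "q \<in> borel_measurable M"
    and u1: "(\<integral>\<^sup>+a. u a \<partial>M) = 1" and p1: "(\<integral>\<^sup>+a. p a \<partial>M) = 1" and q1: "(\<integral>\<^sup>+a. q a \<partial>M) = 1"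
    and mp: "\<And>a. m a \<le> p a" and mq: "\<And>a. m a \<le> q a"
begin

definition "mass = (\<integral>\<^sup>+a. m a \<partial>M)"

lemma mass_le_1: "mass \<le> 1"
  unfolding mass_def p1[symmetric] by (intro nn_integral_mono mp)

lemma mass_finite: "mass \<noteq> \<infinity>"
  using mass_le_1 by (auto simp: top_unique)

lemma integral_p_minus_m: "(\<integral>\<^sup>+a. p a - m a \<partial>M) = 1 - mass"
  using mass_finite by (subst nn_integral_diff) (auto simp: mass_def p1 mp)

lemma swap: "overlap M u m q p"
  by unfold_locales (auto simp: u1 p1 q1 mp mq)

lemmas integral_q_minus_m = overlap.integral_p_minus_m[OF swap]

text \<open>Summing over the Boolean splits the integral; on the diagonal part the second coordinate
  enters only through \<open>u\<close>, which integrates to one. Marginals, separation probability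
  and measurability in parameters are all read off this formula.\<close>

lemma nn_integral_overlap_coupling:
  assumes [measurable]: "h \<in> borel_measurable (M \<Otimes>\<^sub>M M)"
  shows "(\<integral>\<^sup>+w. h w \<partial>overlap_coupling M u m p q) =
    (\<integral>\<^sup>+a. m a * h (a, a) \<partial>M) +
    (\<integral>\<^sup>+a. (\<integral>\<^sup>+b. (p a - m a) * (q b - m b) / (1 - mass) * h (a, b) \<partial>M) \<partial>M)"
proof -
  interpret C: sigma_finite_measure "count_space (UNIV :: bool set)"
    by (rule sigma_finite_measure_count_space)
  interpret MC: pair_sigma_finite M "count_space (UNIV :: bool set)" ..
  let ?B = "M \<Otimes>\<^sub>M M \<Otimes>\<^sub>M count_space (UNIV :: bool set)"
  let ?H = "\<lambda>(a, b, z). if z then m a * u b else (p a - m a) * (q b - m b) / (1 - mass)"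
  let ?G = "\<lambda>(a, b, z). ?H (a, b, z) * h (a, if z then a else b)"
  have [measurable]: "?H \<in> borel_measurable ?B" by measurable
  have [measurable]: "?G \<in> borel_measurable ?B" by measurable
  have "(\<integral>\<^sup>+w. h w \<partial>overlap_coupling M u m p q) = (\<integral>\<^sup>+w. ?G w \<partial>?B)"
    unfolding overlap_coupling_def mass_def[symmetric]
    by (simp add: nn_integral_distr nn_integral_density measurable_diag_bool)
       (auto intro!: nn_integral_cong)
  also have "\<dots> = (\<integral>\<^sup>+a. (\<integral>\<^sup>+w. ?G (a, w) \<partial>(M \<Otimes>\<^sub>M count_space (UNIV :: bool set))) \<partial>M)"
    by (subst MC.P.nn_integral_fst[symmetric]) auto
  also have "\<dots> = (\<integral>\<^sup>+a. (\<integral>\<^sup>+b. (\<integral>\<^sup>+z. ?G (a, b, z) \<partial>count_space (UNIV :: bool set)) \<partial>M) \<partial>M)"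
    by (intro nn_integral_cong, subst C.nn_integral_fst[symmetric]) auto
  also have "\<dots> = (\<integral>\<^sup>+a. (\<integral>\<^sup>+b. m a * h (a, a) * u b + (p a - m a) * (q b - m b) / (1 - mass) * h (a, b) \<partial>M) \<partial>M)"
    by (intro nn_integral_cong) (simp add: nn_integral_count_space_finite UNIV_bool ac_simps)
  also have "\<dots> = (\<integral>\<^sup>+a. m a * h (a, a) + (\<integral>\<^sup>+b. (p a - m a) * (q b - m b) / (1 - mass) * h (a, b) \<partial>M) \<partial>M)"
    by (intro nn_integral_cong, subst nn_integral_add) (auto simp: nn_integral_cmult u1)
  also have "\<dots> = (\<integral>\<^sup>+a. m a * h (a, a) \<partial>M) +
    (\<integral>\<^sup>+a. (\<integral>\<^sup>+b. (p a - m a) * (q b - m b) / (1 - mass) * h (a, b) \<partial>M) \<partial>M)"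
    by (subst nn_integral_add) auto
  finally show ?thesis .
qed

lemma gap_less_top: "1 - mass < \<top>"
  by (rule le_less_trans[OF diff_le_self_ennreal ennreal_one_less_top])

lemma gap_div_self_le: "(1 - mass) / (1 - mass) \<le> 1"
  using gap_less_top by (cases "1 - mass = 0") (auto simp: ennreal_divide_self)

text \<open>Only almost everywhere: if \<open>mass\<close> is one, the quotient is 0 / 0 = 0, and
  \<open>p - m\<close>, having integral zero, may still be positive on a null set.\<close>

lemma overlap_weight: "AE a in M. m a + (p a - m a) * ((1 - mass) / (1 - mass)) = p a"
proof (cases "1 - mass = 0")
  case True
  then have "AE a in M. p a - m a = 0"
    using integral_p_minus_m by (intro iffD1[OF nn_integral_0_iff_AE]) auto
  then show ?thesis
    by eventually_elim (metis True add.right_neutral diff_add_cancel_ennreal mp add.commute mult_zero_left)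
next
  case False
  then have "(1 - mass) / (1 - mass) = 1"
    using gap_less_top by (intro ennreal_divide_self) auto
  then show ?thesis by (simp add: add.commute diff_add_cancel_ennreal mp)
qed

text \<open>Integrating out b replaces the factor \<open>q b - m b\<close> by
  \<open>1 - mass\<close>, which cancels the normalisation up to the null set of
  \<open>overlap_weight\<close>.\<close>

lemma nn_integral_overlap_fst:
  assumes [measurable]: "g \<in> borel_measurable M"
  shows "(\<integral>\<^sup>+w. g (fst w) \<partial>overlap_coupling M u m p q) = (\<integral>\<^sup>+a. p a * g a \<partial>M)"
proof -
  have "(\<integral>\<^sup>+w. g (fst w) \<partial>overlap_coupling M u m p q) =
    (\<integral>\<^sup>+a. m a * g a \<partial>M) +
    (\<integral>\<^sup>+a. (\<integral>\<^sup>+b. (p a - m a) * (q b - m b) / (1 - mass) * g a \<partial>M) \<partial>M)"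
    by (subst nn_integral_overlap_coupling) auto
  also have "(\<integral>\<^sup>+a. (\<integral>\<^sup>+b. (p a - m a) * (q b - m b) / (1 - mass) * g a \<partial>M) \<partial>M)
     = (\<integral>\<^sup>+a. (\<integral>\<^sup>+b. ((p a - m a) * g a / (1 - mass)) * (q b - m b) \<partial>M) \<partial>M)"
    by (simp add: divide_ennreal_def ac_simps)
  also have "\<dots> = (\<integral>\<^sup>+a. (p a - m a) * g a / (1 - mass) * (1 - mass) \<partial>M)"
    by (subst nn_integral_cmult) (auto simp: integral_q_minus_m)
  also have "(\<integral>\<^sup>+a. m a * g a \<partial>M) + \<dots> =
     (\<integral>\<^sup>+a. m a * g a + (p a - m a) * g a / (1 - mass) * (1 - mass) \<partial>M)"
    by (subst nn_integral_add) auto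
  also have "\<dots> = (\<integral>\<^sup>+a. (m a + (p a - m a) * ((1 - mass) / (1 - mass))) * g a \<partial>M)"
    by (intro nn_integral_cong) (simp add: divide_ennreal_def distrib_left ac_simps)
  also have "\<dots> = (\<integral>\<^sup>+a. p a * g a \<partial>M)"
    using overlap_weight by (intro nn_integral_cong_AE) auto
  finally show ?thesis .
qed

lemma nn_integral_overlap_snd:
  assumes [measurable]: "g \<in> borel_measurable M"
  shows "(\<integral>\<^sup>+w. g (snd w) \<partial>overlap_coupling M u m p q) = (\<integral>\<^sup>+a. q a * g a \<partial>M)"
proof -
  interpret MM: pair_sigma_finite M M ..
  have "(\<integral>\<^sup>+w. g (snd w) \<partial>overlap_coupling M u m p q) =
    (\<integral>\<^sup>+a. m a * g a \<partial>M) +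
    (\<integral>\<^sup>+a. (\<integral>\<^sup>+b. (p a - m a) * (q b - m b) / (1 - mass) * g b \<partial>M) \<partial>M)"
    by (subst nn_integral_overlap_coupling) auto
  also have "(\<integral>\<^sup>+a. (\<integral>\<^sup>+b. (p a - m a) * (q b - m b) / (1 - mass) * g b \<partial>M) \<partial>M)
     = (\<integral>\<^sup>+b. (\<integral>\<^sup>+a. (p a - m a) * (q b - m b) / (1 - mass) * g b \<partial>M) \<partial>M)"
    by (rule MM.Fubini') measurable
  \<comment> \<open>After Fubini the formula is that of the coupling with \<open>p\<close> and
    \<open>q\<close> exchanged, so the first-marginal computation applies.\<close>
  also have "(\<integral>\<^sup>+a. m a * g a \<partial>M) + \<dots> = (\<integral>\<^sup>+w. g (fst w) \<partial>overlap_coupling M u m q p)"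
    by (subst overlap.nn_integral_overlap_coupling[OF swap]) (auto simp: mult.commute)
  also have "\<dots> = (\<integral>\<^sup>+a. q a * g a \<partial>M)"
    by (rule overlap.nn_integral_overlap_fst[OF swap]) simp
  finally show ?thesis .
qed

lemma prob_space_overlap_coupling: "prob_space (overlap_coupling M u m p q)"
proof (rule prob_spaceI)
  show "emeasure (overlap_coupling M u m p q) (space (overlap_coupling M u m p q)) = 1"
    using nn_integral_overlap_fst[of "\<lambda>_. 1"] p1 by simp
qed

lemma overlap_coupling_in_couplings:
  "overlap_coupling M u m p q \<in> couplings (density M p) (density M q)"
proof -
  note [measurable_cong] = sets_overlap_coupling
  have "distr (overlap_coupling M u m p q) (density M p) fst = density M p"
    by (rule distr_eq_densityI) (auto simp: nn_integral_overlap_fst)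
  moreover have "distr (overlap_coupling M u m p q) (density M q) snd = density M q"
    by (rule distr_eq_densityI) (auto simp: nn_integral_overlap_snd)
  moreover have "sets (density M p \<Otimes>\<^sub>M density M q) = sets (M \<Otimes>\<^sub>M M)"
    by (intro sets_pair_measure_cong) auto
  ultimately show ?thesis
    by (simp add: couplings_def sets_overlap_coupling)
qed

text \<open>The diagonal part contributes nothing and the remainder has total mass at most
  \<open>1 - mass\<close>. Only an inequality is claimed, since the remainder may also charge the
  diagonal. Measurability of the diagonal depends on the space and is therefore assumed.\<close>

lemma overlap_coupling_off_diagonal:
  assumes [measurable]: "{w \<in> space (M \<Otimes>\<^sub>M M). fst w \<noteq> snd w} \<in> sets (M \<Otimes>\<^sub>M M)"
  shows "emeasure (overlap_coupling M u m p q) {w \<in> space (M \<Otimes>\<^sub>M M). fst w \<noteq> snd w} \<le> 1 - mass"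
proof -
  let ?N = "{w \<in> space (M \<Otimes>\<^sub>M M). fst w \<noteq> snd w}"
  have "emeasure (overlap_coupling M u m p q) ?N = (\<integral>\<^sup>+w. indicator ?N w \<partial>overlap_coupling M u m p q)"
    by (simp add: sets_overlap_coupling)
  also have "\<dots> = (\<integral>\<^sup>+a. m a * indicator ?N (a, a) \<partial>M) +
    (\<integral>\<^sup>+a. (\<integral>\<^sup>+b. (p a - m a) * (q b - m b) / (1 - mass) * indicator ?N (a, b) \<partial>M) \<partial>M)"
    by (rule nn_integral_overlap_coupling) simp
  also have "\<dots> \<le> 0 + (\<integral>\<^sup>+a. (\<integral>\<^sup>+b. ((p a - m a) / (1 - mass)) * (q b - m b)  \<partial>M) \<partial>M)"
    by (intro add_mono nn_integral_mono) (auto simp: indicator_def divide_ennreal_def ac_simps intro!: nn_integral_mono)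
  also have "\<dots> = (\<integral>\<^sup>+a. (p a - m a) * ((1 - mass) / (1 - mass)) \<partial>M)"
    by (subst nn_integral_cmult) (auto simp: integral_q_minus_m divide_ennreal_def ac_simps)
  also have "\<dots> \<le> (\<integral>\<^sup>+a. (p a - m a) \<partial>M)"
    using gap_div_self_le by (intro nn_integral_mono) (metis mult.right_neutral mult_left_mono zero_le)
  also have "\<dots> = 1 - mass" by (rule integral_p_minus_m)
  finally show ?thesis .
qed

end

section \<open>Extending a process by one time step\<close>

text \<open>Abstract in the past space \<open>A\<close>, the new coordinate \<open>B\<close> and the
  longer path space \<open>C\<close>, so that single paths and pairs of paths share all proofs. The
  inverse laws are restricted to the spaces because truncation recovers only paths that are
  \<open>undefined\<close> outside their time set.\<close>

locale path_extension =
  fixes A :: "'a measure" and B :: "'b measure" and C :: "'c measure"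
    and e :: "'a \<times> 'b \<Rightarrow> 'c" and U :: "'c \<Rightarrow> 'a" and V :: "'c \<Rightarrow> 'b"
  assumes meas_e [measurable]: "e \<in> A \<Otimes>\<^sub>M B \<rightarrow>\<^sub>M C"
    and meas_U [measurable]: "U \<in> C \<rightarrow>\<^sub>M A" and meas_V [measurable]: "V \<in> C \<rightarrow>\<^sub>M B"
    and U_e: "\<And>a b. a \<in> space A \<Longrightarrow> b \<in> space B \<Longrightarrow> U (e (a, b)) = a"
    and V_e: "\<And>a b. a \<in> space A \<Longrightarrow> b \<in> space B \<Longrightarrow> V (e (a, b)) = b"
begin

lemma meas_section: "x \<in> space A \<Longrightarrow> (\<lambda>b. e (x, b)) \<in> B \<rightarrow>\<^sub>M C"
  by measurable

text \<open>The semidirect product of \<open>P\<close> with the kernel, transported to the longer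
  path space by \<open>e\<close>.\<close>

definition extend :: "'a measure \<Rightarrow> ('a \<Rightarrow> 'b measure) \<Rightarrow> 'c measure" where
  "extend P \<kappa> = P \<bind> (\<lambda>x. distr (\<kappa> x) C (\<lambda>b. e (x, b)))"

context
  fixes P \<kappa>
  assumes P: "P \<in> space (prob_algebra A)" and \<kappa>: "\<kappa> \<in> A \<rightarrow>\<^sub>M prob_algebra B"
begin

lemma sets_P [measurable_cong]: "sets P = sets A"
  using P by (simp add: space_prob_algebra)

lemma space_P: "space P = space A"
  using sets_P by (rule sets_eq_imp_space_eq)

lemma prob_space_P: "prob_space P"
  using P by (simp add: space_prob_algebra)

lemma space_P_nonempty: "space A \<noteq> {}"
  using prob_space.not_empty[OF prob_space_P] by (simp add: space_P)

lemma sets_kernel: "x \<in> space A \<Longrightarrow> sets (\<kappa> x) = sets B"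
  using measurable_space[OF \<kappa>] by (auto simp: space_prob_algebra)

lemma space_kernel: "x \<in> space A \<Longrightarrow> space (\<kappa> x) = space B"
  using sets_kernel by (rule sets_eq_imp_space_eq)

lemma prob_space_kernel: "x \<in> space A \<Longrightarrow> prob_space (\<kappa> x)"
  using measurable_space[OF \<kappa>] by (auto simp: space_prob_algebra)

lemma meas_step: "(\<lambda>x. distr (\<kappa> x) C (\<lambda>b. e (x, b))) \<in> A \<rightarrow>\<^sub>M subprob_algebra C"
  by (rule measurable_distr2[where M = B]) (use measurable_prob_algebraD[OF \<kappa>] in auto)

lemma sets_extend [measurable_cong]: "sets (extend P \<kappa>) = sets C"
  unfolding extend_def by (rule sets_bind) (auto simp: space_P space_P_nonempty)

lemma space_extend: "space (extend P \<kappa>) = space C"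
  using sets_extend by (rule sets_eq_imp_space_eq)

lemma nn_integral_extend:
  assumes [measurable]: "h \<in> borel_measurable C"
  shows "(\<integral>\<^sup>+w. h w \<partial>extend P \<kappa>) = (\<integral>\<^sup>+x. (\<integral>\<^sup>+b. h (e (x, b)) \<partial>\<kappa> x) \<partial>P)"
proof -
  have "(\<integral>\<^sup>+w. h w \<partial>extend P \<kappa>) = (\<integral>\<^sup>+x. (\<integral>\<^sup>+w. h w \<partial>distr (\<kappa> x) C (\<lambda>b. e (x, b))) \<partial>P)"
    unfolding extend_def
    by (rule nn_integral_bind[where B = C])
       (use meas_step sets_P in \<open>auto cong: measurable_cong_sets\<close>)
  also have "\<dots> = (\<integral>\<^sup>+x. (\<integral>\<^sup>+b. h (e (x, b)) \<partial>\<kappa> x) \<partial>P)"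
  proof (rule nn_integral_cong)
    fix x assume "x \<in> space P"
    then have x: "x \<in> space A" by (simp add: space_P)
    have "(\<lambda>b. e (x, b)) \<in> \<kappa> x \<rightarrow>\<^sub>M C"
      using meas_section[OF x] measurable_cong_sets[OF sets_kernel[OF x] refl] by blast
    then show "(\<integral>\<^sup>+w. h w \<partial>distr (\<kappa> x) C (\<lambda>b. e (x, b))) = (\<integral>\<^sup>+b. h (e (x, b)) \<partial>\<kappa> x)"
      by (rule nn_integral_distr) simp
  qed
  finally show ?thesis .
qed

text \<open>Past law and conditional law only test integrands that factor into a function of the
  past and one of the new coordinate; the former leaves the inner integral.\<close>

lemma nn_integral_extend_split:
  assumes h: "h \<in> borel_measurable C"
    and eq: "\<And>x b. x \<in> space A \<Longrightarrow> b \<in> space B \<Longrightarrow> h (e (x, b)) = g x * k b"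
    and k: "k \<in> borel_measurable B"
  shows "(\<integral>\<^sup>+w. h w \<partial>extend P \<kappa>) = (\<integral>\<^sup>+x. g x * (\<integral>\<^sup>+b. k b \<partial>\<kappa> x) \<partial>P)"
  unfolding nn_integral_extend[OF h]
proof (rule nn_integral_cong)
  fix x assume "x \<in> space P"
  then have x: "x \<in> space A" by (simp add: space_P)
  have k': "k \<in> borel_measurable (\<kappa> x)"
    using k measurable_cong_sets[OF sets_kernel[OF x] refl] by blast
  have "(\<integral>\<^sup>+b. h (e (x, b)) \<partial>\<kappa> x) = (\<integral>\<^sup>+b. g x * k b \<partial>\<kappa> x)"
    by (intro nn_integral_cong) (simp add: eq x space_kernel)
  then show "(\<integral>\<^sup>+b. h (e (x, b)) \<partial>\<kappa> x) = g x * (\<integral>\<^sup>+b. k b \<partial>\<kappa> x)"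
    by (simp add: nn_integral_cmult[OF k'])
qed

lemma nn_integral_extend_U:
  assumes [measurable]: "g \<in> borel_measurable A"
  shows "(\<integral>\<^sup>+w. g (U w) \<partial>extend P \<kappa>) = (\<integral>\<^sup>+x. g x \<partial>P)"
proof -
  have "(\<integral>\<^sup>+w. g (U w) \<partial>extend P \<kappa>) = (\<integral>\<^sup>+x. g x * (\<integral>\<^sup>+b. 1 \<partial>\<kappa> x) \<partial>P)"
    by (rule nn_integral_extend_split) (auto simp: U_e)
  also have "\<dots> = (\<integral>\<^sup>+x. g x \<partial>P)"
    by (intro nn_integral_cong) (simp add: prob_space.emeasure_space_1 prob_space_kernel space_P)
  finally show ?thesis .
qed

lemma distr_extend_U: "distr (extend P \<kappa>) A U = P"
proof (rule measure_eqI)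
  fix S assume "S \<in> sets (distr (extend P \<kappa>) A U)"
  then have S[measurable]: "S \<in> sets A" by simp
  have "emeasure (distr (extend P \<kappa>) A U) S = (\<integral>\<^sup>+w. indicator S w \<partial>distr (extend P \<kappa>) A U)"
    by simp
  also have "\<dots> = (\<integral>\<^sup>+w. indicator S (U w) \<partial>extend P \<kappa>)"
    by (rule nn_integral_distr) (auto cong: measurable_cong_sets)
  also have "\<dots> = emeasure P S"
    by (subst nn_integral_extend_U) (auto simp: sets_P)
  finally show "emeasure (distr (extend P \<kappa>) A U) S = emeasure P S" .
qed (simp add: sets_P)

lemma conditional_law_extend: "conditional_law (extend P \<kappa>) A B U V \<kappa>"
  unfolding conditional_law_def
proof (intro conjI ballI \<kappa>)
  fix S R assume [measurable]: "S \<in> sets A" "R \<in> sets B"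
  have m: "(\<lambda>x. emeasure (\<kappa> x) R) \<in> borel_measurable A"
    using measurable_emeasure_subprob_algebra measurable_prob_algebraD[OF \<kappa>]
    by (rule measurable_compose[rotated]) simp
  let ?E = "{w \<in> space C. U w \<in> S \<and> V w \<in> R}"
  have E: "?E \<in> sets C" by measurable
  have "emeasure (extend P \<kappa>) {w \<in> space (extend P \<kappa>). U w \<in> S \<and> V w \<in> R} =
      (\<integral>\<^sup>+w. indicator ?E w \<partial>extend P \<kappa>)"
    using E by (simp add: sets_extend space_extend)
  also have "\<dots> = (\<integral>\<^sup>+x. indicator S x * (\<integral>\<^sup>+b. indicator R b \<partial>\<kappa> x) \<partial>P)"
  proof (rule nn_integral_extend_split)
    fix x b assume "x \<in> space A" "b \<in> space B"
    moreover from this have "e (x, b) \<in> space C"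
      using measurable_space[OF meas_e] by (auto simp: space_pair_measure)
    ultimately show "indicator ?E (e (x, b)) = (indicator S x * indicator R b :: ennreal)"
      by (simp add: indicator_def U_e V_e)
  qed (use E in auto)
  also have "\<dots> = (\<integral>\<^sup>+x. indicator S x * emeasure (\<kappa> x) R \<partial>P)"
    by (intro nn_integral_cong) (simp add: sets_kernel space_P)
  also have "\<dots> = (\<integral>\<^sup>+w. indicator S (U w) * emeasure (\<kappa> (U w)) R \<partial>extend P \<kappa>)"
    using m by (subst nn_integral_extend_U) auto
  finally show "emeasure (extend P \<kappa>) {w \<in> space (extend P \<kappa>). U w \<in> S \<and> V w \<in> R} =
      (\<integral>\<^sup>+w. indicator S (U w) * emeasure (\<kappa> (U w)) R \<partial>extend P \<kappa>)" .
qed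

end

text \<open>Recognises an extension by its iterated integrals. It serves both for the disintegration
  of a density and for the projections of an extended coupling.\<close>

lemma eq_extendI:
  assumes P: "P \<in> space (prob_algebra A)" and \<kappa>: "\<kappa> \<in> A \<rightarrow>\<^sub>M prob_algebra B"
    and Q: "sets Q = sets C"
    and eq: "\<And>h. h \<in> borel_measurable C \<Longrightarrow> (\<integral>\<^sup>+w. h w \<partial>Q) = (\<integral>\<^sup>+x. (\<integral>\<^sup>+b. h (e (x, b)) \<partial>\<kappa> x) \<partial>P)"
  shows "Q = extend P \<kappa>"
proof (rule measure_eqI)
  show "sets Q = sets (extend P \<kappa>)" by (simp add: Q sets_extend[OF P \<kappa>])
  fix S assume S: "S \<in> sets Q"
  then have S': "S \<in> sets C" by (simp add: Q)
  have "emeasure Q S = (\<integral>\<^sup>+w. indicator S w \<partial>Q)" using S by simp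
  also have "\<dots> = (\<integral>\<^sup>+w. indicator S w \<partial>extend P \<kappa>)"
    using S' by (subst eq) (auto simp: nn_integral_extend[OF P \<kappa>])
  also have "\<dots> = emeasure (extend P \<kappa>) S" using S' by (simp add: sets_extend[OF P \<kappa>])
  finally show "emeasure Q S = emeasure (extend P \<kappa>) S" .
qed

end

text \<open>A conditional law depends only on the joint law of the conditioning and the conditioned
  variable, so it pulls back along any map \<open>V\<close> through which both factor. This keeps
  the kernels of earlier times when the horizon grows.\<close>

lemma conditional_law_distr:
  assumes "conditional_law P A B U W \<kappa>" and P: "P = distr P' M V"
    and [measurable]: "V \<in> P' \<rightarrow>\<^sub>M M" "U \<in> M \<rightarrow>\<^sub>M A" "W \<in> M \<rightarrow>\<^sub>M B"
    and U': "\<And>w. w \<in> space P' \<Longrightarrow> U' w = U (V w)"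
    and W': "\<And>w. w \<in> space P' \<Longrightarrow> W' w = W (V w)"
  shows "conditional_law P' A B U' W' \<kappa>"
  unfolding conditional_law_def
proof (intro conjI ballI)
  show \<kappa>: "\<kappa> \<in> A \<rightarrow>\<^sub>M prob_algebra B" using assms(1) by (simp add: conditional_law_def)
  fix S R assume [measurable]: "S \<in> sets A" "R \<in> sets B"
  have [measurable]: "(\<lambda>x. emeasure (\<kappa> x) R) \<in> borel_measurable A"
    using measurable_emeasure_subprob_algebra measurable_prob_algebraD[OF \<kappa>]
    by (rule measurable_compose[rotated]) simp
  have "emeasure P' {w \<in> space P'. U' w \<in> S \<and> W' w \<in> R} = emeasure P' (V -` {w \<in> space M. U w \<in> S \<and> W w \<in> R} \<inter> space P')"
    using measurable_space[OF assms(3)] by (intro arg_cong[of _ _ "emeasure P'"]) (auto simp: U' W')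
  also have "\<dots> = emeasure P {w \<in> space P. U w \<in> S \<and> W w \<in> R}"
    unfolding P by (subst emeasure_distr) auto
  also have "\<dots> = (\<integral>\<^sup>+w. indicator S (U w) * emeasure (\<kappa> (U w)) R \<partial>P)"
    using assms(1) by (simp add: conditional_law_def)
  also have "\<dots> = (\<integral>\<^sup>+w. indicator S (U (V w)) * emeasure (\<kappa> (U (V w))) R \<partial>P')"
    unfolding P by (rule nn_integral_distr) measurable
  also have "\<dots> = (\<integral>\<^sup>+w. indicator S (U' w) * emeasure (\<kappa> (U' w)) R \<partial>P')"
    by (intro nn_integral_cong) (simp add: U')
  finally show "emeasure P' {w \<in> space P'. U' w \<in> S \<and> W' w \<in> R} =
     (\<integral>\<^sup>+w. indicator S (U' w) * emeasure (\<kappa> (U' w)) R \<partial>P')" .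
qed

lemma prob_density:
  assumes "f \<in> borel_measurable M" "(\<integral>\<^sup>+x. f x \<partial>M) = 1"
  shows "prob_space (density M f)"
  using assms by (intro prob_spaceI) (simp add: emeasure_density space_density nn_integral_cong[of M "\<lambda>x. f x * indicator (space M) x" f])

lemma measurable_density_kernel:
  assumes "sigma_finite_measure B"
    and H [measurable]: "(\<lambda>(x, b). H x b) \<in> borel_measurable (A \<Otimes>\<^sub>M B)"
    and H1: "\<And>x. x \<in> space A \<Longrightarrow> (\<integral>\<^sup>+b. H x b \<partial>B) = 1"
  shows "(\<lambda>x. density B (H x)) \<in> A \<rightarrow>\<^sub>M prob_algebra B"
proof (rule measurable_prob_algebraI)
  interpret sigma_finite_measure B by fact
  have mH: "H x \<in> borel_measurable B" if "x \<in> space A" for x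
    using that H by measurable
  show prob: "prob_space (density B (H x))" if "x \<in> space A" for x
    using that by (intro prob_spaceI) (simp add: emeasure_density mH H1 cong: nn_integral_cong)
  show "(\<lambda>x. density B (H x)) \<in> A \<rightarrow>\<^sub>M subprob_algebra B"
  proof (rule measurable_subprob_algebra)
    fix S assume [measurable]: "S \<in> sets B"
    have "(\<lambda>x. \<integral>\<^sup>+b. H x b * indicator S b \<partial>B) \<in> borel_measurable A"
      by (rule borel_measurable_nn_integral) measurable
    then show "(\<lambda>x. emeasure (density B (H x)) S) \<in> borel_measurable A"
      by (rule measurable_cong[THEN iffD1, rotated]) (simp add: emeasure_density mH)
  qed (auto intro: prob_space_imp_subprob_space prob)
qed

section \<open>Path spaces: coordinates, truncation and equality of paths\<close>

lemma sets_path_lebesgue: "sets (path_lebesgue t) = sets (past_space t)"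
  unfolding path_lebesgue_def past_space_def by (intro sets_PiM_cong) auto

lemma space_path_lebesgue: "space (path_lebesgue t) = space (past_space t)"
  by (rule sets_eq_imp_space_eq[OF sets_path_lebesgue])

lemma measurable_path_lebesgueI: "h \<in> past_space t \<rightarrow>\<^sub>M N \<Longrightarrow> h \<in> path_lebesgue t \<rightarrow>\<^sub>M N"
  using measurable_cong_sets[OF sets_path_lebesgue refl] by blast

lemma path_space_eq_past_space: "path_space = past_space"
  unfolding path_space_def past_space_def ..

lemma measurable_coordinate:
  assumes "i \<in> {1..t}" shows "(\<lambda>x. x i) \<in> past_space t \<rightarrow>\<^sub>M borel"
  unfolding past_space_def using assms by measurable

lemma measurable_past:
  assumes "r \<le> t" shows "past r \<in> past_space t \<rightarrow>\<^sub>M past_space r"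
  unfolding past_space_def using assms by (intro measurable_restrict_subset) auto

lemma interval_Suc: "{1..Suc t} = insert (Suc t) {1..t}"
  by auto

lemma measurable_path_upd: "(\<lambda>(x, a). x(Suc t := a)) \<in> past_space t \<Otimes>\<^sub>M borel \<rightarrow>\<^sub>M past_space (Suc t)"
  unfolding past_space_def interval_Suc
  by (rule measurable_add_dim)

lemma past_upd:
  assumes "x \<in> space (past_space t)" shows "past t (x(Suc t := a)) = x"
  using assms unfolding past_space_def space_PiM
  by (intro extensionalityI[of _ "{1..t}"]) (auto simp: PiE_def)

lemma past_space_eqI:
  assumes "x \<in> space (past_space t)" "y \<in> space (past_space t)" "\<And>i. i \<in> {1..t} \<Longrightarrow> x i = y i"
  shows "x = y"
  using assms unfolding past_space_def space_PiM
  by (intro extensionalityI[of _ "{1..t}"]) (auto simp: PiE_def)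

text \<open>Elements of the path space agree outside the time set, so two of them differ exactly if
  one of finitely many coordinates differs.\<close>

lemma sets_path_neq:
  "{w \<in> space (past_space t \<Otimes>\<^sub>M past_space t). fst w \<noteq> (snd w :: ('d::finite) path)}
     \<in> sets (past_space t \<Otimes>\<^sub>M past_space t)"
proof -
  let ?P = "past_space t \<Otimes>\<^sub>M past_space t :: ('d path \<times> 'd path) measure"
  have "{w \<in> space ?P. fst w \<noteq> snd w} = (\<Union>i\<in>{1..t}. {w \<in> space ?P. fst w i \<noteq> snd w i})"
    by (auto simp: space_pair_measure intro: past_space_eqI)
  also have "\<dots> \<in> sets ?P"
  proof (rule sets.finite_UN)
    fix i assume [measurable]: "i \<in> {1..t}"
    note measurable_coordinate[of i t, measurable]
    show "{w \<in> space ?P. fst w i \<noteq> snd w i} \<in> sets ?P" by measurable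
  qed simp
  finally show ?thesis .
qed

lemma pred_path_eq [measurable]:
  "Measurable.pred (past_space t \<Otimes>\<^sub>M past_space t) (\<lambda>w. fst w = (snd w :: ('d::finite) path))"
  unfolding pred_def
  using sets.compl_sets[OF sets_path_neq] by (auto intro: back_subst[where P="\<lambda>S. S \<in> _"])

interpretation single: path_extension
  "past_space t :: ('d::finite) path measure" borel "past_space (Suc t)"
  "\<lambda>(x, a). x(Suc t := a)" "past t" "\<lambda>x. x (Suc t)" for t
proof unfold_locales
  show "past t \<in> past_space (Suc t) \<rightarrow>\<^sub>M past_space t" by (rule measurable_past) simp
  show "past t (case (a, b) of (x, a) \<Rightarrow> x(Suc t := a)) = a"
    if "a \<in> space (past_space t)" for a :: "'d path" and b
    using past_upd[OF that] by simp
qed (simp_all add: measurable_path_upd measurable_coordinate)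

interpretation double: path_extension
  "past_space t \<Otimes>\<^sub>M past_space t :: (('d::finite) path \<times> 'd path) measure" "borel \<Otimes>\<^sub>M borel"
  "past_space (Suc t) \<Otimes>\<^sub>M past_space (Suc t)"
  "\<lambda>((x, y), (a, b)). (x(Suc t := a), y(Suc t := b))"
  "\<lambda>(x, y). (past t x, past t y)" "\<lambda>(x, y). (x (Suc t), y (Suc t))" for t
proof (rule path_extension.intro, goal_cases)
  case 1
  show ?case
    unfolding split_beta
    by (intro measurable_Pair
        measurable_compose[OF _ measurable_path_upd, where f = "\<lambda>w. (fst (fst w), fst (snd w))", unfolded split_beta fst_conv snd_conv]
        measurable_compose[OF _ measurable_path_upd, where f = "\<lambda>w. (snd (fst w), snd (snd w))", unfolded split_beta fst_conv snd_conv])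
       measurable
next
  case 2
  note [measurable] = measurable_past[of t "Suc t"]
  show ?case by measurable
next
  case 3
  show ?case
    unfolding split_beta
    by (intro measurable_Pair measurable_compose[OF measurable_fst] measurable_compose[OF measurable_snd]
        measurable_coordinate) auto
next
  case (4 a b)
  obtain x y a' b' where "a = (x, y)" "b = (a', b')" by (metis surj_pair)
  moreover from this 4 have "x \<in> space (past_space t)" "y \<in> space (past_space t)"
    by (simp_all add: space_pair_measure)
  ultimately show ?case by (simp only: prod.case past_upd)
next
  case (5 a b)
  obtain x y a' b' where "a = (x, y)" "b = (a', b')" by (metis surj_pair)
  then show ?case by (simp only: prod.case fun_upd_same)
qed

section \<open>Marginal densities, conditional densities and disintegration\<close>

definition unit_density :: "real ^ 'd::finite \<Rightarrow> ennreal" where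
  "unit_density = indicator (cbox 0 One)"

lemma measurable_unit_density [measurable]: "unit_density \<in> borel_measurable borel"
  unfolding unit_density_def by measurable

lemma integral_unit_density: "(\<integral>\<^sup>+a. unit_density a \<partial>lborel) = 1"
  unfolding unit_density_def by (simp add: emeasure_lborel_cbox_eq)

text \<open>The index \<open>t\<close> counts the remaining times: \<open>f\<close> is meant as a
  density on \<open>Suc t\<close> times, of which the last is removed.\<close>

definition marginal :: "nat \<Rightarrow> (('d::finite) path \<Rightarrow> ennreal) \<Rightarrow> 'd path \<Rightarrow> ennreal" where
  "marginal t f x = (\<integral>\<^sup>+a. f (x(Suc t := a)) \<partial>lborel)"

text \<open>The fallback makes this a probability density for every \<open>x\<close>; for two comparable densities the
  degenerate cases occur at the same points.\<close>

definition cond_density :: "nat \<Rightarrow> (('d::finite) path \<Rightarrow> ennreal) \<Rightarrow> 'd path \<Rightarrow> real ^ 'd \<Rightarrow> ennreal" where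
  "cond_density t f x a =
     (if 0 < marginal t f x \<and> marginal t f x < \<infinity> then f (x(Suc t := a)) / marginal t f x else unit_density a)"

context
  fixes t :: nat and f :: "('d::finite) path \<Rightarrow> ennreal"
  assumes f: "f \<in> borel_measurable (past_space (Suc t))"
begin

lemma measurable_density_upd:
  "(\<lambda>(x, a). f (x(Suc t := a))) \<in> borel_measurable (past_space t \<Otimes>\<^sub>M lborel)"
proof -
  have "(\<lambda>(x, a). f (x(Suc t := a))) \<in> borel_measurable (past_space t \<Otimes>\<^sub>M borel)"
    using measurable_compose[OF measurable_path_upd f] by (simp add: split_beta)
  then show ?thesis
    by (simp cong: measurable_cong_sets sets_pair_measure_cong)
qed

lemma measurable_marginal: "marginal t f \<in> borel_measurable (past_space t)"
  unfolding marginal_def[abs_def]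
  by (rule lborel.borel_measurable_nn_integral) (rule measurable_density_upd)

lemma measurable_cond_density:
  "(\<lambda>(x, a). cond_density t f x a) \<in> borel_measurable (past_space t \<Otimes>\<^sub>M lborel)"
proof -
  have guarded_quotient: "(\<lambda>w. if 0 < g w \<and> g w < \<infinity> then k w / g w else v w) \<in> borel_measurable M"
    if [measurable]: "k \<in> borel_measurable M" "g \<in> borel_measurable M" "v \<in> borel_measurable M"
    for k g v :: "'d path \<times> (real ^ 'd) \<Rightarrow> ennreal" and M
    by measurable
  have 1: "(\<lambda>w. f ((fst w)(Suc t := snd w))) \<in> borel_measurable (past_space t \<Otimes>\<^sub>M lborel)"
    using measurable_density_upd unfolding split_beta .
  have 2: "(\<lambda>w. marginal t f (fst w)) \<in> borel_measurable (past_space t \<Otimes>\<^sub>M lborel)"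
    by (rule measurable_compose[OF measurable_fst measurable_marginal])
  have 3: "(\<lambda>w. unit_density (snd w)) \<in> borel_measurable (past_space t \<Otimes>\<^sub>M lborel)"
    by (rule measurable_compose[OF measurable_snd]) simp
  show ?thesis
    unfolding cond_density_def split_beta by (rule guarded_quotient[OF 1 2 3])
qed

lemma measurable_cond_density_section:
  assumes "x \<in> space (past_space t)" shows "cond_density t f x \<in> borel_measurable lborel"
  using measurable_Pair2[OF measurable_cond_density assms] by simp

lemma measurable_upd_section:
  assumes "x \<in> space (past_space t)" shows "(\<lambda>a. f (x(Suc t := a))) \<in> borel_measurable lborel"
  using measurable_Pair2[OF measurable_density_upd assms] unfolding split_beta fst_conv snd_conv .

lemma integral_cond_density:
  assumes x: "x \<in> space (past_space t)" shows "(\<integral>\<^sup>+a. cond_density t f x a \<partial>lborel) = 1"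
proof (cases "0 < marginal t f x \<and> marginal t f x < \<infinity>")
  case True
  have "(\<integral>\<^sup>+a. cond_density t f x a \<partial>lborel) = (\<integral>\<^sup>+a. f (x(Suc t := a)) / marginal t f x \<partial>lborel)"
    unfolding cond_density_def if_P[OF True] ..
  also have "\<dots> = marginal t f x / marginal t f x"
    by (subst nn_integral_divide) (use measurable_upd_section[OF x] in \<open>simp_all add: marginal_def\<close>)
  also have "\<dots> = 1"
    using True by (intro ennreal_divide_self) auto
  finally show ?thesis .
next
  case False
  show ?thesis unfolding cond_density_def if_not_P[OF False] by (rule integral_unit_density)
qed

lemma measurable_cond_kernel:
  "(\<lambda>x. density lborel (cond_density t f x)) \<in> past_space t \<rightarrow>\<^sub>M prob_algebra borel"
proof -
  have "(\<lambda>x. density lborel (cond_density t f x)) \<in> past_space t \<rightarrow>\<^sub>M prob_algebra lborel"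
    by (rule measurable_density_kernel)
       (auto simp: measurable_cond_density integral_cond_density lborel.sigma_finite_measure_axioms)
  moreover have "sets (prob_algebra lborel) = sets (prob_algebra (borel :: (real ^ 'd) measure))"
    unfolding prob_algebra_def subprob_algebra_cong[OF sets_lborel] ..
  ultimately show ?thesis using measurable_cong_sets[OF refl] by blast
qed

lemma nn_integral_path_lebesgue_Suc:
  assumes "h \<in> borel_measurable (past_space (Suc t))"
  shows "(\<integral>\<^sup>+x. h x \<partial>path_lebesgue (Suc t)) =
    (\<integral>\<^sup>+x. (\<integral>\<^sup>+a. h (x(Suc t := a)) \<partial>lborel) \<partial>(path_lebesgue t :: 'd path measure))"
proof -
  interpret product_sigma_finite "\<lambda>_ :: nat. lborel :: (real ^ 'd) measure" ..
  have "h \<in> borel_measurable (path_lebesgue (Suc t))"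
    by (rule measurable_path_lebesgueI[OF assms])
  then show ?thesis
    unfolding path_lebesgue_def interval_Suc
    by (intro product_nn_integral_insert) auto
qed

lemma integral_marginal:
  "(\<integral>\<^sup>+x. marginal t f x \<partial>path_lebesgue t) = (\<integral>\<^sup>+x. f x \<partial>path_lebesgue (Suc t))"
  unfolding marginal_def by (rule nn_integral_path_lebesgue_Suc[symmetric, OF f])

context
  assumes f1: "(\<integral>\<^sup>+x. f x \<partial>path_lebesgue (Suc t)) = 1"
begin

lemma density_marginal_prob: "density (path_lebesgue t) (marginal t f) \<in> space (prob_algebra (past_space t))"
proof -
  have "marginal t f \<in> borel_measurable (path_lebesgue t)"
    by (rule measurable_path_lebesgueI[OF measurable_marginal])
  then show ?thesis
    using integral_marginal f1
    by (simp add: space_prob_algebra sets_path_lebesgue prob_density)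
qed

text \<open>The marginal has finite integral, so it is infinite only on a null set; where it
  vanishes, \<open>f\<close> vanishes for almost every new coordinate, and the fallback density is
  multiplied by zero.\<close>

lemma cond_density_factor:
  "AE x in path_lebesgue t. AE a in lborel. f (x(Suc t := a)) = marginal t f x * cond_density t f x a"
proof -
  have m: "marginal t f \<in> borel_measurable (path_lebesgue t)"
    by (rule measurable_path_lebesgueI[OF measurable_marginal])
  have "AE x in path_lebesgue t. marginal t f x \<noteq> \<infinity>"
    using m integral_marginal f1 by (intro nn_integral_PInf_AE) auto
  moreover have "AE x in path_lebesgue t. x \<in> space (past_space t)"
    using AE_space[of "path_lebesgue t"] by (simp add: space_path_lebesgue)
  ultimately show ?thesis
  proof eventually_elim
    case (elim x)
    show ?case
    proof (cases "marginal t f x = 0")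
      case True
      then have "AE a in lborel. f (x(Suc t := a)) = 0"
        using measurable_upd_section[OF elim(2)] unfolding marginal_def
        by (intro iffD1[OF nn_integral_0_iff_AE]) auto
      then show ?thesis using True by simp
    next
      case False
      then show ?thesis
        using elim(1) ennreal_mult_divide_eq[of "marginal t f x"]
        by (auto simp: cond_density_def ennreal_times_divide zero_less_iff_neq_zero top.not_eq_extremum
            mult.commute[of "marginal t f x"])
    qed
  qed
qed

text \<open>Disintegration into the law of the past and the conditional kernel. It identifies
  absolutely continuous path laws with one-step extensions, so couplings can be built by induction
  on time.\<close>

lemma density_eq_extend:
  "density (path_lebesgue (Suc t)) f =
     single.extend t (density (path_lebesgue t) (marginal t f)) (\<lambda>x. density lborel (cond_density t f x))"
proof (rule single.eq_extendI[OF density_marginal_prob measurable_cond_kernel])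
  show "sets (density (path_lebesgue (Suc t)) f) = sets (past_space (Suc t))"
    by (simp add: sets_path_lebesgue)
  fix h :: "'d path \<Rightarrow> ennreal" assume h: "h \<in> borel_measurable (past_space (Suc t))"
  have f': "f \<in> borel_measurable (path_lebesgue (Suc t))" and h': "h \<in> borel_measurable (path_lebesgue (Suc t))"
    by (rule measurable_path_lebesgueI[OF f], rule measurable_path_lebesgueI[OF h])
  have m: "marginal t f \<in> borel_measurable (path_lebesgue t)"
    by (rule measurable_path_lebesgueI[OF measurable_marginal])
  have mh: "(\<lambda>(x, a). h (x(Suc t := a))) \<in> borel_measurable (past_space t \<Otimes>\<^sub>M lborel)"
    using measurable_compose[OF measurable_path_upd h]
    by (simp add: split_beta cong: measurable_cong_sets sets_pair_measure_cong)
  have mhx: "(\<lambda>a. h (x(Suc t := a))) \<in> borel_measurable lborel" if "x \<in> space (past_space t)" for x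
    using measurable_Pair2[OF mh that] by simp
  let ?\<kappa> = "\<lambda>x. density lborel (cond_density t f x)"
  have kern: "(\<integral>\<^sup>+a. h (x(Suc t := a)) \<partial>?\<kappa> x) = (\<integral>\<^sup>+a. cond_density t f x a * h (x(Suc t := a)) \<partial>lborel)"
    if "x \<in> space (past_space t)" for x
    using that by (intro nn_integral_density measurable_cond_density_section mhx)
  have mk: "(\<lambda>x. \<integral>\<^sup>+a. cond_density t f x a * h (x(Suc t := a)) \<partial>lborel) \<in> borel_measurable (past_space t)"
    using measurable_cond_density mh by (intro lborel.borel_measurable_nn_integral) (simp add: split_beta)
  have "(\<integral>\<^sup>+w. h w \<partial>density (path_lebesgue (Suc t)) f) = (\<integral>\<^sup>+w. f w * h w \<partial>path_lebesgue (Suc t))"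
    by (rule nn_integral_density[OF f' h'])
  also have "\<dots> = (\<integral>\<^sup>+x. (\<integral>\<^sup>+a. f (x(Suc t := a)) * h (x(Suc t := a)) \<partial>lborel) \<partial>path_lebesgue t)"
    using f h by (intro nn_integral_path_lebesgue_Suc) auto
  also have "\<dots> = (\<integral>\<^sup>+x. marginal t f x * (\<integral>\<^sup>+a. cond_density t f x a * h (x(Suc t := a)) \<partial>lborel) \<partial>path_lebesgue t)"
  proof (rule nn_integral_cong_AE)
    have "AE x in path_lebesgue t. x \<in> space (past_space t)"
      using AE_space[of "path_lebesgue t"] by (simp add: space_path_lebesgue)
    with cond_density_factor
    show "AE x in path_lebesgue t. (\<integral>\<^sup>+a. f (x(Suc t := a)) * h (x(Suc t := a)) \<partial>lborel) =
       marginal t f x * (\<integral>\<^sup>+a. cond_density t f x a * h (x(Suc t := a)) \<partial>lborel)"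
    proof eventually_elim
      case (elim x)
      have "(\<integral>\<^sup>+a. f (x(Suc t := a)) * h (x(Suc t := a)) \<partial>lborel) =
          (\<integral>\<^sup>+a. marginal t f x * (cond_density t f x a * h (x(Suc t := a))) \<partial>lborel)"
        using elim(1) by (intro nn_integral_cong_AE) (elim eventually_mono, simp add: mult.assoc)
      also have "\<dots> = marginal t f x * (\<integral>\<^sup>+a. cond_density t f x a * h (x(Suc t := a)) \<partial>lborel)"
        using measurable_cond_density_section[OF elim(2)] mhx[OF elim(2)] by (intro nn_integral_cmult) auto
      finally show ?case .
    qed
  qed
  also have "\<dots> = (\<integral>\<^sup>+x. (\<integral>\<^sup>+a. cond_density t f x a * h (x(Suc t := a)) \<partial>lborel) \<partial>density (path_lebesgue t) (marginal t f))"
    using m mk by (intro nn_integral_density[symmetric]) (simp_all add: sets_path_lebesgue cong: measurable_cong_sets)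
  also have "\<dots> = (\<integral>\<^sup>+x. (\<integral>\<^sup>+a. h (x(Suc t := a)) \<partial>?\<kappa> x) \<partial>density (path_lebesgue t) (marginal t f))"
    by (intro nn_integral_cong) (simp add: kern space_path_lebesgue)
  finally show "(\<integral>\<^sup>+w. h w \<partial>density (path_lebesgue (Suc t)) f) =
     (\<integral>\<^sup>+x. (\<integral>\<^sup>+a. h (case (x, a) of (x, a) \<Rightarrow> x(Suc t := a)) \<partial>?\<kappa> x) \<partial>density (path_lebesgue t) (marginal t f))"
    by simp
qed

end

end

section \<open>Kernels of maximal couplings and the one-step coupling\<close>

lemma measurable_overlap_kernel:
  assumes "sigma_finite_measure M"
    and PQS: "(\<lambda>(w, a). P w a) \<in> borel_measurable (W \<Otimes>\<^sub>M M)"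
      "(\<lambda>(w, a). Q w a) \<in> borel_measurable (W \<Otimes>\<^sub>M M)"
      "(\<lambda>(w, a). S w a) \<in> borel_measurable (W \<Otimes>\<^sub>M M)"
    and ov: "\<And>w. w \<in> space W \<Longrightarrow> overlap M u (S w) (P w) (Q w)"
  shows "(\<lambda>w. overlap_coupling M u (S w) (P w) (Q w)) \<in> W \<rightarrow>\<^sub>M prob_algebra (M \<Otimes>\<^sub>M M)"
proof (rule measurable_prob_algebraI)
  interpret sigma_finite_measure M by fact
  note [measurable] = PQS
  show prob: "prob_space (overlap_coupling M u (S w) (P w) (Q w))" if "w \<in> space W" for w
    using overlap.prob_space_overlap_coupling[OF ov[OF that]] .
  show "(\<lambda>w. overlap_coupling M u (S w) (P w) (Q w)) \<in> W \<rightarrow>\<^sub>M subprob_algebra (M \<Otimes>\<^sub>M M)"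
  proof (rule measurable_subprob_algebra)
    fix E assume E [measurable]: "E \<in> sets (M \<Otimes>\<^sub>M M)"
    have [measurable]: "(\<lambda>w. \<integral>\<^sup>+a. S w a \<partial>M) \<in> borel_measurable W"
      by (rule borel_measurable_nn_integral) measurable
    \<comment> \<open>The explicit integral formula reduces the dependence on the parameter to
      iterated integrals of jointly measurable functions.\<close>
    have "(\<lambda>w. (\<integral>\<^sup>+a. S w a * indicator E (a, a) \<partial>M) +
      (\<integral>\<^sup>+a. (\<integral>\<^sup>+b. (P w a - S w a) * (Q w b - S w b) / (1 - (\<integral>\<^sup>+a. S w a \<partial>M)) * indicator E (a, b) \<partial>M) \<partial>M))
      \<in> borel_measurable W"
      by measurable
    then show "(\<lambda>w. emeasure (overlap_coupling M u (S w) (P w) (Q w)) E) \<in> borel_measurable W"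
    proof (rule measurable_cong[THEN iffD1, rotated])
      fix w assume w: "w \<in> space W"
      interpret overlap M u "S w" "P w" "Q w" by (rule ov[OF w])
      show "(\<integral>\<^sup>+a. S w a * indicator E (a, a) \<partial>M) +
          (\<integral>\<^sup>+a. (\<integral>\<^sup>+b. (P w a - S w a) * (Q w b - S w b) / (1 - (\<integral>\<^sup>+a. S w a \<partial>M)) * indicator E (a, b) \<partial>M) \<partial>M)
        = emeasure (overlap_coupling M u (S w) (P w) (Q w)) E"
        using nn_integral_overlap_coupling[of "indicator E"] by (simp add: sets_overlap_coupling mass_def)
    qed
  qed (auto intro: prob_space_imp_subprob_space prob simp: sets_overlap_coupling)
qed

definition shared_density ::
  "nat \<Rightarrow> (('d::finite) path \<Rightarrow> ennreal) \<Rightarrow> ('d path \<Rightarrow> ennreal) \<Rightarrow> 'd path \<times> 'd path \<Rightarrow> real ^ 'd \<Rightarrow> ennreal"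
  where
  "shared_density t f g w a =
     (if fst w = snd w then min (cond_density t f (fst w) a) (cond_density t g (snd w) a) else 0)"

text \<open>Whether the coordinates are coupled depends on the past only through the equality of the two paths,
  so no independent randomisation enters and the resulting coupling is bicausal.\<close>

definition step_coupling ::
  "nat \<Rightarrow> (('d::finite) path \<Rightarrow> ennreal) \<Rightarrow> ('d path \<Rightarrow> ennreal) \<Rightarrow> 'd path \<times> 'd path \<Rightarrow> ((real ^ 'd) \<times> (real ^ 'd)) measure"
  where
  "step_coupling t f g w =
     overlap_coupling lborel unit_density (shared_density t f g w) (cond_density t f (fst w)) (cond_density t g (snd w))"

context
  fixes t :: nat and f g :: "('d::finite) path \<Rightarrow> ennreal"
  assumes f: "f \<in> borel_measurable (past_space (Suc t))" and g: "g \<in> borel_measurable (past_space (Suc t))"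
begin

lemma measurable_cond_density_fst:
  "(\<lambda>(w, a). cond_density t f (fst w) a) \<in> borel_measurable ((past_space t \<Otimes>\<^sub>M past_space t) \<Otimes>\<^sub>M lborel)"
proof -
  have "(\<lambda>z. (fst (fst z), snd z)) \<in> (past_space t \<Otimes>\<^sub>M past_space t) \<Otimes>\<^sub>M lborel \<rightarrow>\<^sub>M past_space t \<Otimes>\<^sub>M lborel"
    by measurable
  from measurable_compose[OF this measurable_cond_density[OF f]] show ?thesis unfolding split_beta fst_conv snd_conv .
qed

lemma measurable_cond_density_snd:
  "(\<lambda>(w, a). cond_density t g (snd w) a) \<in> borel_measurable ((past_space t \<Otimes>\<^sub>M past_space t) \<Otimes>\<^sub>M lborel)"
proof -
  have "(\<lambda>z. (snd (fst z), snd z)) \<in> (past_space t \<Otimes>\<^sub>M past_space t) \<Otimes>\<^sub>M lborel \<rightarrow>\<^sub>M past_space t \<Otimes>\<^sub>M lborel"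
    by measurable
  from measurable_compose[OF this measurable_cond_density[OF g]] show ?thesis unfolding split_beta fst_conv snd_conv .
qed

lemma measurable_shared_density:
  "(\<lambda>(w, a). shared_density t f g w a) \<in> borel_measurable ((past_space t \<Otimes>\<^sub>M past_space t) \<Otimes>\<^sub>M lborel)"
proof -
  have guarded_min: "(\<lambda>z. if R z then min (k z) (v z) else 0) \<in> borel_measurable M"
    if [measurable]: "k \<in> borel_measurable M" "v \<in> borel_measurable M" "Measurable.pred M R"
    for k v :: "('d path \<times> 'd path) \<times> (real ^ 'd) \<Rightarrow> ennreal" and M R
    by measurable
  have R: "Measurable.pred ((past_space t \<Otimes>\<^sub>M past_space t) \<Otimes>\<^sub>M lborel) (\<lambda>z. fst (fst z) = (snd (fst z) :: 'd path))"
    by (rule measurable_compose[OF measurable_fst pred_path_eq])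
  show ?thesis
    unfolding shared_density_def split_beta
    by (rule guarded_min[OF measurable_cond_density_fst[unfolded split_beta]
          measurable_cond_density_snd[unfolded split_beta] R])
qed

lemma overlap_step:
  assumes "w \<in> space (past_space t \<Otimes>\<^sub>M past_space t)"
  shows "overlap lborel unit_density (shared_density t f g w) (cond_density t f (fst w)) (cond_density t g (snd w))"
proof -
  have w: "fst w \<in> space (past_space t)" "snd w \<in> space (past_space t)"
    using assms by (auto simp: space_pair_measure)
  show ?thesis
  proof (intro overlap.intro overlap_axioms.intro)
    show "shared_density t f g w \<in> borel_measurable lborel"
      using measurable_Pair2[OF measurable_shared_density assms] by simp
  qed (auto simp: shared_density_def integral_unit_density integral_cond_density[OF f] integral_cond_density[OF g] w
      lborel.sigma_finite_measure_axioms intro: measurable_cond_density_section[OF f w(1), simplified]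
        measurable_cond_density_section[OF g w(2), simplified])
qed

lemma measurable_step_coupling:
  "step_coupling t f g \<in> past_space t \<Otimes>\<^sub>M past_space t \<rightarrow>\<^sub>M prob_algebra (borel \<Otimes>\<^sub>M borel)"
proof -
  have "step_coupling t f g \<in> past_space t \<Otimes>\<^sub>M past_space t \<rightarrow>\<^sub>M prob_algebra (lborel \<Otimes>\<^sub>M lborel)"
    unfolding step_coupling_def[abs_def]
    by (intro measurable_overlap_kernel lborel.sigma_finite_measure_axioms measurable_cond_density_fst
        measurable_cond_density_snd measurable_shared_density overlap_step)
  moreover have "sets (prob_algebra (lborel \<Otimes>\<^sub>M lborel)) = sets (prob_algebra (borel \<Otimes>\<^sub>M borel :: ((real ^ 'd) \<times> (real ^ 'd)) measure))"
    unfolding prob_algebra_def by (intro arg_cong[of _ _ "\<lambda>M. sets (restrict_space M _)"] subprob_algebra_cong sets_pair_measure_cong sets_lborel)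
  ultimately show ?thesis using measurable_cong_sets[OF refl] by blast
qed

lemma step_coupling_in_couplings:
  assumes "w \<in> space (past_space t \<Otimes>\<^sub>M past_space t)"
  shows "step_coupling t f g w
    \<in> couplings (density lborel (cond_density t f (fst w))) (density lborel (cond_density t g (snd w)))"
  unfolding step_coupling_def by (rule overlap.overlap_coupling_in_couplings[OF overlap_step[OF assms]])

context
  fixes K :: real
  assumes K: "K \<ge> 1"
    and close: "\<And>x. x \<in> space (past_space (Suc t)) \<Longrightarrow> f x \<le> ennreal K * g x"
      "\<And>x. x \<in> space (past_space (Suc t)) \<Longrightarrow> g x \<le> ennreal K * f x"
begin

lemma upd_in_space: "x \<in> space (past_space t) \<Longrightarrow> x(Suc t := a) \<in> space (past_space (Suc t))"
  using measurable_space[OF measurable_path_upd, of "(x, a)" t] by (auto simp: space_pair_measure)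

lemma marginal_close:
  assumes x: "x \<in> space (past_space t)"
  shows "marginal t f x \<le> ennreal K * marginal t g x" "marginal t g x \<le> ennreal K * marginal t f x"
  unfolding marginal_def
  by (subst nn_integral_cmult[symmetric];
      use measurable_upd_section[OF f x] measurable_upd_section[OF g x] close upd_in_space[OF x] in
        \<open>auto intro!: nn_integral_mono\<close>)+

text \<open>One factor \<open>K\<close> is lost in the numerator and one in the normalising
  marginal. If the marginal is degenerate, both sides use the same fallback density and 1 / K^2
  \<le> 1 suffices.\<close>

lemma cond_density_close:
  assumes x: "x \<in> space (past_space t)"
  shows "ennreal (1 / K\<^sup>2) * cond_density t f x a \<le> cond_density t g x a"
proof (cases "0 < marginal t f x \<and> marginal t f x < \<infinity>")
  case True
  let ?F = "marginal t f x" and ?G = "marginal t g x" and ?z = "x(Suc t := a)"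
  have G: "0 < ?G" "?G < \<infinity>"
    using marginal_close[OF x] True K
    by (auto simp: zero_less_iff_neq_zero ennreal_mult_eq_top_iff less_top[symmetric] top_unique)
  have z: "f ?z \<le> ennreal K * g ?z" using close(1) upd_in_space[OF x] by blast
  obtain F' G' where FG: "?F = ennreal F'" "F' > 0" "?G = ennreal G'" "G' > 0"
    using True G by (cases ?F; cases ?G) auto
  have FG': "G' \<le> K * F'" 
    using marginal_close(2)[OF x] FG K by (simp add: ennreal_mult[symmetric])
  have "ennreal (1 / K\<^sup>2) * (f ?z / ?F) \<le> ennreal (1 / K\<^sup>2) * (ennreal K * g ?z / ?F)"
    by (intro mult_left_mono divide_right_mono_ennreal z) simp
  also have "\<dots> = g ?z * (ennreal (1 / K\<^sup>2) * (ennreal K * ennreal (1 / F')))"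
    using FG by (simp only: divide_ennreal_def inverse_ennreal inverse_eq_divide mult_ac)
  also have "\<dots> = g ?z * ennreal (1 / K\<^sup>2 * (K * (1 / F')))"
    using FG K by (subst ennreal_mult[symmetric], simp, simp, subst ennreal_mult[symmetric]) auto
  also have "\<dots> \<le> g ?z * ennreal (1 / G')"
    using FG FG' K by (intro mult_left_mono ennreal_leI) (auto simp: field_simps power2_eq_square)
  also have "\<dots> = g ?z / ?G"
    using FG by (simp only: divide_ennreal_def inverse_ennreal inverse_eq_divide)
  finally show ?thesis using True G by (simp add: cond_density_def)
next
  case False
  then have G: "\<not> (0 < marginal t g x \<and> marginal t g x < \<infinity>)"
    using marginal_close[OF x] K
    by (auto simp: zero_less_iff_neq_zero ennreal_mult_less_top less_top[symmetric] top_unique ennreal_mult_eq_top_iff)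
  have "ennreal (1 / K\<^sup>2) * unit_density a \<le> 1 * unit_density a"
    using K by (intro mult_right_mono) (auto simp: ennreal_le_1)
  then show ?thesis unfolding cond_density_def if_not_P[OF False] if_not_P[OF G] by simp
qed

text \<open>For equal pasts both conditional densities dominate 1 / K^2 times that of
  \<open>f\<close>; hence so does their minimum, and the shared mass is at least 1 / K^2.\<close>

lemma step_coupling_off_diagonal:
  assumes w: "w \<in> space (past_space t \<Otimes>\<^sub>M past_space t)" and eq: "fst w = snd w"
  shows "emeasure (step_coupling t f g w) {v. fst v \<noteq> snd v} \<le> ennreal (1 - 1 / K\<^sup>2)"
proof -
  interpret overlap lborel unit_density "shared_density t f g w" "cond_density t f (fst w)" "cond_density t g (snd w)"
    by (rule overlap_step[OF w])
  have x: "fst w \<in> space (past_space t)" using w by (auto simp: space_pair_measure)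
  have "ennreal (1 / K\<^sup>2) = ennreal (1 / K\<^sup>2) * (\<integral>\<^sup>+a. cond_density t f (fst w) a \<partial>lborel)"
    by (simp add: integral_cond_density[OF f x])
  also have "\<dots> = (\<integral>\<^sup>+a. ennreal (1 / K\<^sup>2) * cond_density t f (fst w) a \<partial>lborel)"
    by (rule nn_integral_cmult[symmetric]) (rule measurable_cond_density_section[OF f x])
  also have "\<dots> \<le> mass"
    unfolding mass_def
  proof (rule nn_integral_mono)
    fix a
    have "ennreal (1 / K\<^sup>2) * cond_density t f (fst w) a \<le> 1 * cond_density t f (fst w) a"
      using K by (intro mult_right_mono) (auto simp: ennreal_le_1)
    then show "ennreal (1 / K\<^sup>2) * cond_density t f (fst w) a \<le> shared_density t f g w a"
      using cond_density_close[OF x] eq by (simp add: shared_density_def)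
  qed
  finally have mass: "ennreal (1 / K\<^sup>2) \<le> mass" .
  have meas: "{v \<in> space (lborel \<Otimes>\<^sub>M lborel :: ((real ^ 'd) \<times> (real ^ 'd)) measure). fst v \<noteq> snd v} \<in> sets (lborel \<Otimes>\<^sub>M lborel)"
  proof -
    have "open {v :: (real ^ 'd) \<times> (real ^ 'd). fst v \<noteq> snd v}"
      by (intro open_Collect_neq continuous_intros)
    then have "{v :: (real ^ 'd) \<times> (real ^ 'd). fst v \<noteq> snd v} \<in> sets (lborel \<Otimes>\<^sub>M lborel)"
      unfolding lborel_prod sets_lborel by (rule borel_open)
    moreover have "{v \<in> space (lborel \<Otimes>\<^sub>M lborel :: ((real ^ 'd) \<times> (real ^ 'd)) measure). fst v \<noteq> snd v} = {v. fst v \<noteq> snd v}"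
      by (simp add: space_pair_measure)
    ultimately show ?thesis by (simp only:)
  qed
  have "emeasure (step_coupling t f g w) {v. fst v \<noteq> snd v} \<le> 1 - mass"
    using overlap_coupling_off_diagonal[OF meas]
    unfolding step_coupling_def by (simp add: space_pair_measure)
  also have "\<dots> \<le> 1 - ennreal (1 / K\<^sup>2)"
    using mass by (rule ennreal_minus_mono[OF order_refl])
  also have "\<dots> = ennreal (1 - 1 / K\<^sup>2)"
    using K by (subst ennreal_minus[symmetric]) auto
  finally show ?thesis .
qed

end

end

section \<open>Gluing the one-step couplings along time\<close>

definition bicausal_at ::
  "nat \<Rightarrow> ('d::finite) path measure \<Rightarrow> 'd path measure \<Rightarrow> ('d path \<times> 'd path) measure \<Rightarrow> bool" where
  "bicausal_at t \<mu> \<nu> \<pi> \<longleftrightarrow>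
     (\<exists>\<kappa> \<kappa>\<^sub>\<mu> \<kappa>\<^sub>\<nu>.
        conditional_law \<pi> (past_space t \<Otimes>\<^sub>M past_space t) (borel \<Otimes>\<^sub>M borel)
          (\<lambda>(x, y). (past t x, past t y)) (\<lambda>(x, y). (x (t + 1), y (t + 1))) \<kappa> \<and>
        conditional_law \<mu> (past_space t) borel (past t) (\<lambda>x. x (t + 1)) \<kappa>\<^sub>\<mu> \<and>
        conditional_law \<nu> (past_space t) borel (past t) (\<lambda>y. y (t + 1)) \<kappa>\<^sub>\<nu> \<and>
        (AE (x, y) in \<pi>. \<kappa> (past t x, past t y) \<in> couplings (\<kappa>\<^sub>\<mu> (past t x)) (\<kappa>\<^sub>\<nu> (past t y))))"

lemma past_past: "r \<le> t \<Longrightarrow> past r (past t x) = past r x"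
  by (auto simp: restrict_def)

text \<open>A pushforward depends on its target only through the measurable sets, so the marginals
  used as targets in \<open>couplings\<close> may be replaced by fixed reference spaces.\<close>

lemma in_couplings_iff:
  assumes "sets M = sets A" "sets N = sets B"
  shows "\<pi> \<in> couplings M N \<longleftrightarrow> sets \<pi> = sets (A \<Otimes>\<^sub>M B) \<and> distr \<pi> A fst = M \<and> distr \<pi> B snd = N"
  unfolding couplings_def mem_Collect_eq sets_pair_measure_cong[OF assms]
    distr_cong[OF refl assms(1) refl, of \<pi> fst] distr_cong[OF refl assms(2) refl, of \<pi> snd] ..

text \<open>For r < t the condition involves only the times up to r + 1 \<le> t, hence only the laws
  of the truncated paths; the kernels themselves are kept.\<close>

lemma bicausal_at_transfer:
  fixes \<mu> \<nu> \<mu>' \<nu>' :: "('d::finite) path measure"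
  assumes "bicausal_at r \<mu> \<nu> \<pi>" and r: "r < t" 
    and \<mu>: "\<mu> = distr \<mu>' (past_space t) (past t)" and \<nu>: "\<nu> = distr \<nu>' (past_space t) (past t)"
    and \<pi>: "\<pi> = distr \<pi>' (past_space t \<Otimes>\<^sub>M past_space t) (\<lambda>(x, y). (past t x, past t y))"
    and s: "sets \<mu>' = sets (past_space (Suc t))" "sets \<nu>' = sets (past_space (Suc t))"
      "sets \<pi>' = sets (past_space (Suc t) \<Otimes>\<^sub>M past_space (Suc t))"
  shows "bicausal_at r \<mu>' \<nu>' \<pi>'"
proof -
  obtain \<kappa> \<kappa>\<^sub>\<mu> \<kappa>\<^sub>\<nu> where
    1: "conditional_law \<pi> (past_space r \<Otimes>\<^sub>M past_space r) (borel \<Otimes>\<^sub>M borel)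
          (\<lambda>(x, y). (past r x, past r y)) (\<lambda>(x, y). (x (r + 1), y (r + 1))) \<kappa>" and
    2: "conditional_law \<mu> (past_space r) borel (past r) (\<lambda>x. x (r + 1)) \<kappa>\<^sub>\<mu>" and
    3: "conditional_law \<nu> (past_space r) borel (past r) (\<lambda>y. y (r + 1)) \<kappa>\<^sub>\<nu>" and
    4: "AE w in \<pi>. \<kappa> (past r (fst w), past r (snd w)) \<in> couplings (\<kappa>\<^sub>\<mu> (past r (fst w))) (\<kappa>\<^sub>\<nu> (past r (snd w)))"
    using assms(1) unfolding bicausal_at_def split_beta by blast
  have rt: "r \<le> t" "r + 1 \<in> {1..t}" using r by auto
  have pm: "past t \<in> past_space (Suc t) \<rightarrow>\<^sub>M (past_space t :: 'd path measure)" by (rule measurable_past) simp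
  have m2: "past t \<in> \<mu>' \<rightarrow>\<^sub>M past_space t" "past t \<in> \<nu>' \<rightarrow>\<^sub>M past_space t"
    "(\<lambda>(x, y). (past t x, past t y)) \<in> \<pi>' \<rightarrow>\<^sub>M past_space t \<Otimes>\<^sub>M past_space t"
    unfolding measurable_cong_sets[OF s(1) refl] measurable_cong_sets[OF s(2) refl] measurable_cong_sets[OF s(3) refl]
    by (rule pm double.meas_U)+
  have mr: "past r \<in> past_space t \<rightarrow>\<^sub>M (past_space r :: 'd path measure)" by (rule measurable_past[OF rt(1)])
  have mc: "(\<lambda>x. x (r + 1)) \<in> (past_space t :: 'd path measure) \<rightarrow>\<^sub>M borel" by (rule measurable_coordinate[OF rt(2)])
  have mr2: "(\<lambda>(x, y). (past r x, past r y)) \<in> (past_space t :: 'd path measure) \<Otimes>\<^sub>M (past_space t :: 'd path measure) \<rightarrow>\<^sub>M past_space r \<Otimes>\<^sub>M past_space r"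
    unfolding split_beta
    by (intro measurable_Pair measurable_compose[OF measurable_fst mr] measurable_compose[OF measurable_snd mr])
  have mc2: "(\<lambda>(x, y). (x (r + 1), y (r + 1))) \<in> (past_space t :: 'd path measure) \<Otimes>\<^sub>M (past_space t :: 'd path measure) \<rightarrow>\<^sub>M borel \<Otimes>\<^sub>M borel"
    unfolding split_beta
    by (intro measurable_Pair measurable_compose[OF measurable_fst mc] measurable_compose[OF measurable_snd mc])
  have c1: "conditional_law \<pi>' (past_space r \<Otimes>\<^sub>M past_space r) (borel \<Otimes>\<^sub>M borel)
          (\<lambda>(x, y). (past r x, past r y)) (\<lambda>(x, y). (x (r + 1), y (r + 1))) \<kappa>"
    by (rule conditional_law_distr[OF 1 \<pi> m2(3) mr2 mc2]) (use rt in \<open>auto simp: past_past split_beta\<close>)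
  have c2: "conditional_law \<mu>' (past_space r) borel (past r) (\<lambda>x. x (r + 1)) \<kappa>\<^sub>\<mu>"
    by (rule conditional_law_distr[OF 2 \<mu> m2(1) mr mc]) (use rt in \<open>auto simp: past_past split_beta\<close>)
  have c3: "conditional_law \<nu>' (past_space r) borel (past r) (\<lambda>x. x (r + 1)) \<kappa>\<^sub>\<nu>"
    by (rule conditional_law_distr[OF 3 \<nu> m2(2) mr mc]) (use rt in \<open>auto simp: past_past split_beta\<close>)
  have "AE w in \<pi>'. \<kappa> (past r (fst w), past r (snd w)) \<in> couplings (\<kappa>\<^sub>\<mu> (past r (fst w))) (\<kappa>\<^sub>\<nu> (past r (snd w)))"
    using AE_distrD[OF m2(3) 4[unfolded \<pi>]] unfolding split_beta fst_conv snd_conv past_past[OF rt(1)] .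
  with c1 c2 c3 show ?thesis unfolding bicausal_at_def split_beta by blast
qed

text \<open>\<open>pr\<close> and \<open>pr'\<close> stand for both first or both second
  projections, so the two marginals need one proof. Projection and extension commute because the
  projected kernel depends on the pair of pasts \<open>w\<close> only through \<open>pr w\<close>;
  this is where causality enters.\<close>

lemma distr_double_extend:
  fixes \<pi> :: "(('d::finite) path \<times> 'd path) measure"
    and pr :: "'d path \<times> 'd path \<Rightarrow> 'd path" and pr' :: "(real ^ 'd) \<times> (real ^ 'd) \<Rightarrow> real ^ 'd"
  assumes \<pi>: "\<pi> \<in> space (prob_algebra (past_space t \<Otimes>\<^sub>M past_space t))"
    and k: "k \<in> past_space t \<Otimes>\<^sub>M past_space t \<rightarrow>\<^sub>M prob_algebra (borel \<Otimes>\<^sub>M borel)"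
    and \<mu>: "\<mu> \<in> space (prob_algebra (past_space t))" and p: "p \<in> past_space t \<rightarrow>\<^sub>M prob_algebra borel"
    and pr: "\<And>r. pr \<in> past_space r \<Otimes>\<^sub>M past_space r \<rightarrow>\<^sub>M past_space r" and pr': "pr' \<in> borel \<Otimes>\<^sub>M borel \<rightarrow>\<^sub>M borel"
    and step: "\<And>x y a b. pr (x(Suc t := a), y(Suc t := b)) = (pr (x, y))(Suc t := pr' (a, b))"
    and law: "distr \<pi> (past_space t) pr = \<mu>"
    and kernel: "\<And>w. w \<in> space (past_space t \<Otimes>\<^sub>M past_space t) \<Longrightarrow> distr (k w) borel pr' = p (pr w)"
  shows "distr (double.extend t \<pi> k) (past_space (Suc t)) pr = single.extend t \<mu> p"
proof (rule single.eq_extendI[OF \<mu> p])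
  let ?R = "past_space t :: 'd path measure" and ?R' = "past_space (Suc t) :: 'd path measure"
  fix h :: "'d path \<Rightarrow> ennreal" assume h: "h \<in> borel_measurable ?R'"
  have sets\<pi>: "sets \<pi> = sets (?R \<Otimes>\<^sub>M ?R)" using \<pi> by (simp add: space_prob_algebra)
  have mpr: "pr \<in> \<pi> \<rightarrow>\<^sub>M ?R" "pr \<in> double.extend t \<pi> k \<rightarrow>\<^sub>M ?R'"
    unfolding measurable_cong_sets[OF sets\<pi> refl] measurable_cong_sets[OF double.sets_extend[OF \<pi> k] refl]
    by (rule pr)+
  have inner: "(\<lambda>x. \<integral>\<^sup>+a. h (x(Suc t := a)) \<partial>p x) \<in> borel_measurable ?R"
    using measurable_compose[OF measurable_path_upd h] measurable_prob_algebraD[OF p]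
    by (intro nn_integral_measurable_subprob_algebra2[where N = borel]) (simp_all add: split_beta)
  have "(\<integral>\<^sup>+x. h x \<partial>distr (double.extend t \<pi> k) ?R' pr) = (\<integral>\<^sup>+w. h (pr w) \<partial>double.extend t \<pi> k)"
    by (rule nn_integral_distr[OF mpr(2)]) (simp add: h)
  also have "\<dots> = (\<integral>\<^sup>+w. (\<integral>\<^sup>+v. h ((pr w)(Suc t := pr' v)) \<partial>k w) \<partial>\<pi>)"
    by (subst double.nn_integral_extend[OF \<pi> k measurable_compose[OF pr h]]) (simp add: split_beta step)
  also have "\<dots> = (\<integral>\<^sup>+w. (\<integral>\<^sup>+a. h ((pr w)(Suc t := a)) \<partial>p (pr w)) \<partial>\<pi>)"
  proof (rule nn_integral_cong)
    fix w assume "w \<in> space \<pi>"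
    then have w: "w \<in> space (?R \<Otimes>\<^sub>M ?R)" by (simp add: sets_eq_imp_space_eq[OF sets\<pi>])
    have kw: "sets (k w) = sets (borel \<Otimes>\<^sub>M borel)"
      using measurable_space[OF k w] by (simp add: space_prob_algebra)
    have mk: "pr' \<in> k w \<rightarrow>\<^sub>M borel" unfolding measurable_cong_sets[OF kw refl] by (rule pr')
    have "(\<lambda>a. h ((pr w)(Suc t := a))) \<in> borel_measurable borel"
      using measurable_compose[OF single.meas_section[OF measurable_space[OF pr w]] h] by simp
    then show "(\<integral>\<^sup>+v. h ((pr w)(Suc t := pr' v)) \<partial>k w) = (\<integral>\<^sup>+a. h ((pr w)(Suc t := a)) \<partial>p (pr w))"
      unfolding kernel[OF w, symmetric] by (intro nn_integral_distr[symmetric] mk) simp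
  qed
  also have "\<dots> = (\<integral>\<^sup>+x. (\<integral>\<^sup>+a. h (x(Suc t := a)) \<partial>p x) \<partial>\<mu>)"
    unfolding law[symmetric] by (rule nn_integral_distr[symmetric, OF mpr(1)]) (simp add: inner)
  finally show "(\<integral>\<^sup>+x. h x \<partial>distr (double.extend t \<pi> k) ?R' pr) =
     (\<integral>\<^sup>+x. (\<integral>\<^sup>+a. h (case (x, a) of (x, a) \<Rightarrow> x(Suc t := a)) \<partial>p x) \<partial>\<mu>)" by simp
qed simp

lemma extend_in_couplings:
  fixes \<pi> :: "(('d::finite) path \<times> 'd path) measure"
  assumes \<pi>: "\<pi> \<in> couplings \<mu> \<nu>"
    and \<mu>: "\<mu> \<in> space (prob_algebra (past_space t))" and \<nu>: "\<nu> \<in> space (prob_algebra (past_space t))"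
    and k: "k \<in> past_space t \<Otimes>\<^sub>M past_space t \<rightarrow>\<^sub>M prob_algebra (borel \<Otimes>\<^sub>M borel)"
    and p: "p \<in> past_space t \<rightarrow>\<^sub>M prob_algebra borel" and q: "q \<in> past_space t \<rightarrow>\<^sub>M prob_algebra borel"
    and c: "\<And>w. w \<in> space (past_space t \<Otimes>\<^sub>M past_space t) \<Longrightarrow> k w \<in> couplings (p (fst w)) (q (snd w))"
  shows "\<pi> \<in> space (prob_algebra (past_space t \<Otimes>\<^sub>M past_space t))"
    and "double.extend t \<pi> k \<in> couplings (single.extend t \<mu> p) (single.extend t \<nu> q)"
proof -
  let ?R = "past_space t :: 'd path measure" and ?R' = "past_space (Suc t) :: 'd path measure"
  have \<mu>': "sets \<mu> = sets ?R" "prob_space \<mu>" and \<nu>': "sets \<nu> = sets ?R" 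
    using \<mu> \<nu> by (auto simp: space_prob_algebra)
  have \<pi>': "sets \<pi> = sets (?R \<Otimes>\<^sub>M ?R)" "distr \<pi> ?R fst = \<mu>" "distr \<pi> ?R snd = \<nu>"
    using \<pi> unfolding in_couplings_iff[OF \<mu>'(1) \<nu>'] by auto
  have mfst: "fst \<in> \<pi> \<rightarrow>\<^sub>M ?R"
    using measurable_cong_sets[OF \<pi>'(1) refl] by auto
  show \<pi>p: "\<pi> \<in> space (prob_algebra (?R \<Otimes>\<^sub>M ?R))"
    using prob_space_distrD[OF mfst] \<mu>'(2) \<pi>' by (auto simp: space_prob_algebra)
  have sp: "sets (p x) = sets borel" and sq: "sets (q x) = sets borel" if "x \<in> space ?R" for x
    using measurable_space[OF p that] measurable_space[OF q that] by (auto simp: space_prob_algebra)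
  have kw: "sets (k w) = sets (borel \<Otimes>\<^sub>M borel)" "distr (k w) borel fst = p (fst w)" "distr (k w) borel snd = q (snd w)"
    if "w \<in> space (?R \<Otimes>\<^sub>M ?R)" for w
  proof -
    have x: "fst w \<in> space ?R" "snd w \<in> space ?R" using that by (auto simp: space_pair_measure)
    show "sets (k w) = sets (borel \<Otimes>\<^sub>M borel)" "distr (k w) borel fst = p (fst w)" "distr (k w) borel snd = q (snd w)"
      using c[OF that] unfolding in_couplings_iff[OF sp[OF x(1)] sq[OF x(2)]] by auto
  qed
  have "distr (double.extend t \<pi> k) ?R' fst = single.extend t \<mu> p"
    by (rule distr_double_extend[OF \<pi>p k \<mu> p _ _ _ \<pi>'(2) kw(2)]) auto
  moreover have "distr (double.extend t \<pi> k) ?R' snd = single.extend t \<nu> q"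
    by (rule distr_double_extend[OF \<pi>p k \<nu> q _ _ _ \<pi>'(3) kw(3)]) auto
  ultimately show "double.extend t \<pi> k \<in> couplings (single.extend t \<mu> p) (single.extend t \<nu> q)"
    unfolding in_couplings_iff[OF single.sets_extend[OF \<mu> p] single.sets_extend[OF \<nu> q]]
    by (simp add: double.sets_extend[OF \<pi>p k])
qed

lemma pair_in_couplings:
  assumes "prob_space M" "prob_space N"
  shows "M \<Otimes>\<^sub>M N \<in> couplings M N"
proof -
  interpret M: prob_space M by fact
  interpret N: prob_space N by fact
  interpret pair_prob_space M N ..
  have "distr (M \<Otimes>\<^sub>M N) N snd = N"
  proof (rule measure_eqI)
    fix A assume A: "A \<in> sets (distr (M \<Otimes>\<^sub>M N) N snd)"
    then have "emeasure (distr (M \<Otimes>\<^sub>M N) N snd) A = emeasure (M \<Otimes>\<^sub>M N) (space M \<times> A)"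
      by (auto simp: emeasure_distr space_pair_measure dest: sets.sets_into_space intro!: arg_cong[where f="emeasure (M \<Otimes>\<^sub>M N)"])
    with A show "emeasure (distr (M \<Otimes>\<^sub>M N) N snd) A = emeasure N A"
      by (simp add: N.emeasure_pair_measure_Times M.emeasure_space_1)
  qed simp
  then show ?thesis
    by (simp add: couplings_def N.distr_pair_fst)
qed

lemma prob_space_density_path:
  assumes "f \<in> borel_measurable (past_space t)" "(\<integral>\<^sup>+x. f x \<partial>path_lebesgue t) = 1"
  shows "prob_space (density (path_lebesgue t) f)"
  using assms measurable_cong_sets[OF sets_path_lebesgue refl] by (intro prob_density) blast+

text \<open>The comparison of the densities is only a premise of the separation bound, so the same
  construction also serves densities that are not comparable, such as the Gaussian fallback. The
  bicausality claim includes time 0, where the past is the empty path, which lets the induction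
  start there.\<close>

lemma exists_bicausal_coupling:
  fixes f g :: "('d::finite) path \<Rightarrow> ennreal" and K :: real
  assumes K: "K \<ge> 1"
    and "f \<in> borel_measurable (past_space T)" "g \<in> borel_measurable (past_space T)"
    and "(\<integral>\<^sup>+x. f x \<partial>path_lebesgue T) = 1" "(\<integral>\<^sup>+x. g x \<partial>path_lebesgue T) = 1"
  shows "\<exists>\<pi>\<in>couplings (density (path_lebesgue T) f) (density (path_lebesgue T) g).
    (\<forall>t<T. bicausal_at t (density (path_lebesgue T) f) (density (path_lebesgue T) g) \<pi>) \<and>
    ((\<forall>x\<in>space (past_space T). f x \<le> ennreal K * g x \<and> g x \<le> ennreal K * f x) \<longrightarrow>
      emeasure \<pi> {w \<in> space (past_space T \<Otimes>\<^sub>M past_space T). fst w \<noteq> snd w} \<le> of_nat T * ennreal (1 - 1 / K\<^sup>2))"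
  using assms(2-)
proof (induction T arbitrary: f g)
  case 0
  \<comment> \<open>Without any times the path space has a single point, so the two paths have not
    separated yet.\<close>
  have diag: "{w \<in> space (past_space 0 \<Otimes>\<^sub>M past_space 0). fst w \<noteq> snd w} = ({} :: ('d path \<times> 'd path) set)"
    by (auto simp: space_pair_measure past_space_def space_PiM)
  have "density (path_lebesgue 0) f \<Otimes>\<^sub>M density (path_lebesgue 0) g
      \<in> couplings (density (path_lebesgue 0) f) (density (path_lebesgue 0) g)"
    by (intro pair_in_couplings prob_space_density_path 0)
  then show ?case unfolding diag by auto
next
  case (Suc t f g)
  let ?R = "past_space t :: 'd path measure" and ?R' = "past_space (Suc t) :: 'd path measure"
  let ?F = "marginal t f" and ?G = "marginal t g"
  let ?\<mu> = "density (path_lebesgue t) ?F" and ?\<nu> = "density (path_lebesgue t) ?G"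
  let ?\<mu>' = "density (path_lebesgue (Suc t)) f" and ?\<nu>' = "density (path_lebesgue (Suc t)) g"
  let ?p = "\<lambda>x. density lborel (cond_density t f x)" and ?q = "\<lambda>x. density lborel (cond_density t g x)"
  let ?k = "step_coupling t f g"
  note f = Suc.prems(1) and g = Suc.prems(2) and f1 = Suc.prems(3) and g1 = Suc.prems(4)
  obtain \<pi> where \<pi>: "\<pi> \<in> couplings ?\<mu> ?\<nu>"
    and bic: "\<forall>r<t. bicausal_at r ?\<mu> ?\<nu> \<pi>"
    and off: "(\<forall>x\<in>space ?R. ?F x \<le> ennreal K * ?G x \<and> ?G x \<le> ennreal K * ?F x) \<longrightarrow>
      emeasure \<pi> {w \<in> space (?R \<Otimes>\<^sub>M ?R). fst w \<noteq> snd w} \<le> of_nat t * ennreal (1 - 1 / K\<^sup>2)"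
    using Suc.IH[of ?F ?G] measurable_marginal[OF f] measurable_marginal[OF g]
      integral_marginal[OF f] integral_marginal[OF g] f1 g1 by auto
  note \<mu> = density_marginal_prob[OF f f1] and \<nu> = density_marginal_prob[OF g g1]
  note p = measurable_cond_kernel[OF f] and q = measurable_cond_kernel[OF g] and k = measurable_step_coupling[OF f g]
  note ext = extend_in_couplings[OF \<pi> \<mu> \<nu> k p q step_coupling_in_couplings[OF f g]]
  note \<pi>p = ext(1)
  let ?\<pi>' = "double.extend t \<pi> ?k"
  have \<pi>': "?\<pi>' \<in> couplings ?\<mu>' ?\<nu>'"
    using ext(2) unfolding density_eq_extend[OF f f1] density_eq_extend[OF g g1] .
  have s: "sets ?\<mu>' = sets ?R'" "sets ?\<nu>' = sets ?R'" "sets ?\<pi>' = sets (?R' \<Otimes>\<^sub>M ?R')"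
    using double.sets_extend[OF \<pi>p k] by (auto simp: sets_path_lebesgue)
  have m\<mu>: "?\<mu> = distr ?\<mu>' ?R (past t)"
    unfolding density_eq_extend[OF f f1] by (rule single.distr_extend_U[OF \<mu> p, symmetric])
  have m\<nu>: "?\<nu> = distr ?\<nu>' ?R (past t)"
    unfolding density_eq_extend[OF g g1] by (rule single.distr_extend_U[OF \<nu> q, symmetric])
  have m\<pi>: "\<pi> = distr ?\<pi>' (?R \<Otimes>\<^sub>M ?R) (\<lambda>(x, y). (past t x, past t y))"
    by (rule double.distr_extend_U[OF \<pi>p k, symmetric])
  have last: "bicausal_at t ?\<mu>' ?\<nu>' ?\<pi>'"
    unfolding bicausal_at_def
  proof (intro exI conjI)
    show "conditional_law ?\<pi>' (past_space t \<Otimes>\<^sub>M past_space t) (borel \<Otimes>\<^sub>M borel)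
          (\<lambda>(x, y). (past t x, past t y)) (\<lambda>(x, y). (x (t + 1), y (t + 1))) ?k"
      using double.conditional_law_extend[OF \<pi>p k] by simp
    show "conditional_law ?\<mu>' (past_space t) borel (past t) (\<lambda>x. x (t + 1)) ?p"
      using single.conditional_law_extend[OF \<mu> p] unfolding density_eq_extend[OF f f1] by simp
    show "conditional_law ?\<nu>' (past_space t) borel (past t) (\<lambda>x. x (t + 1)) ?q"
      using single.conditional_law_extend[OF \<nu> q] unfolding density_eq_extend[OF g g1] by simp
    have "?k (past t (fst w), past t (snd w)) \<in> couplings (?p (past t (fst w))) (?q (past t (snd w)))"
      if "w \<in> space ?\<pi>'" for w
    proof -
      have "(past t (fst w), past t (snd w)) \<in> space (?R \<Otimes>\<^sub>M ?R)"
        using measurable_space[OF double.meas_U[of t], of w] that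
        by (simp add: double.space_extend[OF \<pi>p k] split_beta)
      from step_coupling_in_couplings[OF f g this] show ?thesis by simp
    qed
    then show "AE (x, y) in ?\<pi>'. ?k (past t x, past t y) \<in> couplings (?p (past t x)) (?q (past t y))"
      by (intro AE_I2) (auto simp: split_beta)
  qed
  have all: "\<forall>r<Suc t. bicausal_at r ?\<mu>' ?\<nu>' ?\<pi>'"
    using bicausal_at_transfer[OF _ _ m\<mu> m\<nu> m\<pi> s] bic last by (auto simp: less_Suc_eq)
  have "emeasure ?\<pi>' {w \<in> space (?R' \<Otimes>\<^sub>M ?R'). fst w \<noteq> snd w} \<le> of_nat (Suc t) * ennreal (1 - 1 / K\<^sup>2)"
    if close: "\<forall>x\<in>space ?R'. f x \<le> ennreal K * g x \<and> g x \<le> ennreal K * f x"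
  proof -
    let ?N = "{w \<in> space (?R \<Otimes>\<^sub>M ?R). fst w \<noteq> snd w}" and ?N' = "{w \<in> space (?R' \<Otimes>\<^sub>M ?R'). fst w \<noteq> snd w}"
    let ?e = "ennreal (1 - 1 / K\<^sup>2)"
    have sets\<pi>: "sets \<pi> = sets (?R \<Otimes>\<^sub>M ?R)" and prob\<pi>: "prob_space \<pi>"
      using \<pi>p by (auto simp: space_prob_algebra)
    have sp\<pi>: "space \<pi> = space (?R \<Otimes>\<^sub>M ?R)" by (rule sets_eq_imp_space_eq[OF sets\<pi>])
    have "emeasure ?\<pi>' ?N' = (\<integral>\<^sup>+w. indicator ?N' w \<partial>?\<pi>')"
      using sets_path_neq by (simp add: s)
    also have "\<dots> = (\<integral>\<^sup>+w. (\<integral>\<^sup>+v. indicator ?N' ((fst w)(Suc t := fst v), (snd w)(Suc t := snd v)) \<partial>?k w) \<partial>\<pi>)"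
      using sets_path_neq by (subst double.nn_integral_extend[OF \<pi>p k]) (auto simp: split_beta)
    \<comment> \<open>Paths already separated are charged in full; paths still equal separate in the
      new step with probability at most \<open>?e\<close>. Hence the separation probability grows by
      at most \<open>?e\<close> per step.\<close>
    also have "\<dots> \<le> (\<integral>\<^sup>+w. indicator ?N w + ?e \<partial>\<pi>)"
    proof (rule nn_integral_mono)
      fix w assume "w \<in> space \<pi>"
      then have w: "w \<in> space (?R \<Otimes>\<^sub>M ?R)" by (simp add: sp\<pi>)
      interpret kw: prob_space "?k w"
        using measurable_space[OF k w] by (simp add: space_prob_algebra)
      show "(\<integral>\<^sup>+v. indicator ?N' ((fst w)(Suc t := fst v), (snd w)(Suc t := snd v)) \<partial>?k w) \<le> indicator ?N w + ?e"
      proof (cases "fst w = snd w")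
        case False
        have "(\<integral>\<^sup>+v. indicator ?N' ((fst w)(Suc t := fst v), (snd w)(Suc t := snd v)) \<partial>?k w) \<le> (\<integral>\<^sup>+v. 1 \<partial>?k w)"
          by (intro nn_integral_mono) (auto simp: indicator_def)
        also have "\<dots> = 1" by (simp add: kw.emeasure_space_1)
        also have "\<dots> \<le> indicator ?N w + ?e" using False w by (simp add: indicator_def)
        finally show ?thesis .
      next
        case True
        have sk: "sets (?k w) = sets (borel \<Otimes>\<^sub>M borel)"
          using measurable_space[OF k w] by (simp add: space_prob_algebra)
        have D: "{v :: (real ^ 'd) \<times> (real ^ 'd). fst v \<noteq> snd v} \<in> sets (?k w)"
          unfolding sk borel_prod by (intro borel_open open_Collect_neq continuous_intros)
        have "(\<integral>\<^sup>+v. indicator ?N' ((fst w)(Suc t := fst v), (snd w)(Suc t := snd v)) \<partial>?k w)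
           \<le> (\<integral>\<^sup>+v. indicator {v. fst v \<noteq> snd v} v \<partial>?k w)"
          by (intro nn_integral_mono) (auto simp: indicator_def True)
        also have "\<dots> = emeasure (?k w) {v. fst v \<noteq> snd v}" using D by simp
        also have "\<dots> \<le> ?e"
          using close by (intro step_coupling_off_diagonal[OF f g K _ _ w True]) auto
        finally show ?thesis by (simp add: add_increasing)
      qed
    qed
    also have "\<dots> = emeasure \<pi> ?N + ?e"
      using sets_path_neq prob_space.emeasure_space_1[OF prob\<pi>]
      by (subst nn_integral_add) (auto simp: sets\<pi> intro!: borel_measurable_indicator)
    also have "\<dots> \<le> of_nat t * ?e + ?e"
    proof (intro add_right_mono off[rule_format] ballI conjI)
      fix x assume x: "x \<in> space ?R"
      show "?F x \<le> ennreal K * ?G x" "?G x \<le> ennreal K * ?F x"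
        using marginal_close[OF f g K _ _ x] close by auto
    qed
    also have "\<dots> = of_nat (Suc t) * ?e" by (simp add: distrib_right add.commute)
    finally show ?thesis .
  qed
  then show ?case using \<pi>' all by blast
qed

section \<open>Bounds for the adapted Wasserstein distance\<close>

lemma finite_coords: "finite (coords T :: (nat \<times> 'd::finite) set)"
  by (simp add: coords_def)

lemma card_coords: "card (coords T :: (nat \<times> 'd::finite) set) = CARD('d) * T"
  by (simp add: coords_def card_cartesian_product)

lemma measurable_coord:
  assumes "p \<in> coords T" shows "(\<lambda>x. coord x p) \<in> borel_measurable (past_space T)"
proof -
  have "(\<lambda>v :: real ^ 'a. v $ snd p) \<in> borel_measurable borel"
    by (intro borel_measurable_continuous_onI continuous_intros)
  moreover have "(\<lambda>x. x (fst p)) \<in> past_space T \<rightarrow>\<^sub>M borel"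
    using assms by (intro measurable_coordinate) (auto simp: coords_def)
  ultimately show ?thesis by (rule measurable_compose[rotated])
qed

lemma measurable_l1_norm: "(\<lambda>x. l1_dist T x (\<lambda>_. 0)) \<in> borel_measurable (past_space T)"
  unfolding l1_dist_def
  by (intro borel_measurable_sum borel_measurable_abs borel_measurable_diff measurable_coord) simp_all

lemma l1_dist_triangle: "l1_dist T x y \<le> l1_dist T x (\<lambda>_. 0) + l1_dist T y (\<lambda>_. 0)"
  unfolding l1_dist_def sum.distrib[symmetric] by (intro sum_mono) auto

lemma l1_dist_same: "l1_dist T x x = 0"
  by (simp add: l1_dist_def)

lemma l1_dist_nonneg: "0 \<le> l1_dist T x y"
  by (simp add: l1_dist_def sum_nonneg)

lemma l1_dist_cube:
  assumes "x \<in> unit_cube T" "y \<in> (unit_cube T :: ('d::finite) path set)"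
  shows "l1_dist T x y \<le> real (CARD('d) * T)"
proof -
  have "l1_dist T x y \<le> (\<Sum>p\<in>(coords T :: (nat \<times> 'd) set). 1)"
    unfolding l1_dist_def
  proof (rule sum_mono)
    fix p :: "nat \<times> 'd" assume "p \<in> coords T"
    with assms have "coord x p \<in> {0..1}" "coord y p \<in> {0..1}" by (simp_all add: unit_cube_def)
    then show "\<bar>coord x p - coord y p\<bar> \<le> 1" by auto
  qed
  then show ?thesis by (simp add: card_coords)
qed

lemma sets_unit_cube: "unit_cube T \<in> sets (past_space T)"
  unfolding unit_cube_def path_space_eq_past_space
proof (rule sets.sets_Collect_finite_All[OF _ finite_coords])
  fix p :: "nat \<times> 'a" assume p: "p \<in> coords T"
  have "(\<lambda>x. coord x p) -` {0..1} \<inter> space (past_space T) \<in> sets (past_space T)"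
    by (rule measurable_sets[OF measurable_coord[OF p]]) simp
  also have "(\<lambda>x. coord x p) -` {0..1} \<inter> space (past_space T) = {x \<in> space (past_space T). coord x p \<in> {0..1}}"
    by blast
  finally show "{x \<in> space (past_space T). coord x p \<in> {0..1}} \<in> sets (past_space T)" .
qed

text \<open>The clause on the first coordinates follows by evaluating both marginals of the coupling
  at time 1.\<close>

lemma bicausal_couplingsI:
  assumes \<pi>: "\<pi> \<in> couplings \<mu> \<nu>" and b: "\<forall>t<T. bicausal_at t \<mu> \<nu> \<pi>" and T: "T \<ge> 1"
    and s: "sets \<mu> = sets (past_space T)" "sets \<nu> = sets (past_space T)"
  shows "\<pi> \<in> bicausal_couplings T \<mu> \<nu>"
proof -
  let ?R = "past_space T :: 'a path measure"
  have \<pi>': "sets \<pi> = sets (?R \<Otimes>\<^sub>M ?R)" "distr \<pi> ?R fst = \<mu>" "distr \<pi> ?R snd = \<nu>"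
    using \<pi> unfolding in_couplings_iff[OF s] by auto
  have m1: "(\<lambda>x. x 1) \<in> ?R \<rightarrow>\<^sub>M borel" using T by (intro measurable_coordinate) auto
  have mf: "fst \<in> \<pi> \<rightarrow>\<^sub>M ?R" and ms: "snd \<in> \<pi> \<rightarrow>\<^sub>M ?R"
    unfolding measurable_cong_sets[OF \<pi>'(1) refl] by auto
  have m2: "(\<lambda>(x, y). (x 1, y 1)) \<in> \<pi> \<rightarrow>\<^sub>M borel \<Otimes>\<^sub>M borel"
    unfolding split_beta by (rule measurable_Pair[OF measurable_compose[OF mf m1] measurable_compose[OF ms m1]])
  have "distr (distr \<pi> (borel \<Otimes>\<^sub>M borel) (\<lambda>(x, y). (x 1, y 1))) borel fst = distr \<mu> borel (\<lambda>x. x 1)"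
    unfolding \<pi>'(2)[symmetric]
    by (subst distr_distr[OF _ m2], simp, subst distr_distr[OF m1 mf]) (simp add: comp_def split_beta)
  moreover have "distr (distr \<pi> (borel \<Otimes>\<^sub>M borel) (\<lambda>(x, y). (x 1, y 1))) borel snd = distr \<nu> borel (\<lambda>x. x 1)"
    unfolding \<pi>'(3)[symmetric]
    by (subst distr_distr[OF _ m2], simp, subst distr_distr[OF m1 ms]) (simp add: comp_def split_beta)
  ultimately have "distr \<pi> (borel \<Otimes>\<^sub>M borel) (\<lambda>(x, y). (x 1, y 1))
          \<in> couplings (distr \<mu> borel (\<lambda>x. x 1)) (distr \<nu> borel (\<lambda>y. y 1))"
    by (subst in_couplings_iff[OF sets_distr sets_distr]) auto
  with \<pi> b show ?thesis
    unfolding bicausal_couplings_def bicausal_at_def by auto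
qed

text \<open>By the triangle inequality through the zero path the bound holds for the cost of any
  coupling, so the mere existence of a bicausal one suffices.\<close>

lemma AW1_le_moments:
  fixes f g :: "('d::finite) path \<Rightarrow> ennreal"
  assumes T: "T \<ge> 1"
    and f: "f \<in> borel_measurable (past_space T)" and g: "g \<in> borel_measurable (past_space T)"
    and f1: "(\<integral>\<^sup>+x. f x \<partial>path_lebesgue T) = 1" and g1: "(\<integral>\<^sup>+x. g x \<partial>path_lebesgue T) = 1"
  shows "AW1 T (density (path_lebesgue T) f) (density (path_lebesgue T) g)
    \<le> (\<integral>\<^sup>+x. ennreal (l1_dist T x (\<lambda>_. 0)) \<partial>density (path_lebesgue T) f) +
      (\<integral>\<^sup>+x. ennreal (l1_dist T x (\<lambda>_. 0)) \<partial>density (path_lebesgue T) g)"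
proof -
  let ?\<mu> = "density (path_lebesgue T) f" and ?\<nu> = "density (path_lebesgue T) g" and ?R = "past_space T :: 'd path measure"
  let ?n = "\<lambda>x :: 'd path. ennreal (l1_dist T x (\<lambda>_. 0))"
  \<comment> \<open>The choice \<open>K\<close> = 1, made by \<open>order_refl\<close>, is
    arbitrary: only existence and bicausality of the coupling matter here.\<close>
  obtain \<pi> where \<pi>: "\<pi> \<in> couplings ?\<mu> ?\<nu>" and b: "\<forall>t<T. bicausal_at t ?\<mu> ?\<nu> \<pi>"
    using exists_bicausal_coupling[OF order_refl f g f1 g1] by auto
  have s: "sets ?\<mu> = sets ?R" "sets ?\<nu> = sets ?R" by (simp_all add: sets_path_lebesgue)
  have \<pi>': "sets \<pi> = sets (?R \<Otimes>\<^sub>M ?R)" "distr \<pi> ?R fst = ?\<mu>" "distr \<pi> ?R snd = ?\<nu>"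
    using \<pi> unfolding in_couplings_iff[OF s] by auto
  have mf: "fst \<in> \<pi> \<rightarrow>\<^sub>M ?R" and ms: "snd \<in> \<pi> \<rightarrow>\<^sub>M ?R"
    unfolding measurable_cong_sets[OF \<pi>'(1) refl] by auto
  have n: "?n \<in> borel_measurable ?R" using measurable_l1_norm by measurable
  have "AW1 T ?\<mu> ?\<nu> \<le> (\<integral>\<^sup>+(x, y). ennreal (l1_dist T x y) \<partial>\<pi>)"
    unfolding AW1_def by (intro INF_lower bicausal_couplingsI[OF \<pi> b T s])
  also have "\<dots> \<le> (\<integral>\<^sup>+w. ?n (fst w) + ?n (snd w) \<partial>\<pi>)"
    by (intro nn_integral_mono)
       (auto simp: split_beta ennreal_plus[symmetric] l1_dist_nonneg simp del: ennreal_plus intro!: ennreal_leI l1_dist_triangle)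
  also have "\<dots> = (\<integral>\<^sup>+w. ?n (fst w) \<partial>\<pi>) + (\<integral>\<^sup>+w. ?n (snd w) \<partial>\<pi>)"
    by (intro nn_integral_add measurable_compose[OF mf n] measurable_compose[OF ms n])
  also have "(\<integral>\<^sup>+w. ?n (fst w) \<partial>\<pi>) = (\<integral>\<^sup>+x. ?n x \<partial>?\<mu>)"
    unfolding \<pi>'(2)[symmetric] by (rule nn_integral_distr[symmetric, OF mf]) (simp add: n)
  also have "(\<integral>\<^sup>+w. ?n (snd w) \<partial>\<pi>) = (\<integral>\<^sup>+x. ?n x \<partial>?\<nu>)"
    unfolding \<pi>'(3)[symmetric] by (rule nn_integral_distr[symmetric, OF ms]) (simp add: n)
  finally show ?thesis .
qed

text \<open>The cost vanishes if the paths agree and is at most d T on the cube, so its integral is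
  at most d T times the separation probability.\<close>

lemma AW1_le_close:
  fixes f g :: "('d::finite) path \<Rightarrow> ennreal"
  assumes T: "T \<ge> 1" and K: "K \<ge> 1"
    and f: "f \<in> borel_measurable (past_space T)" and g: "g \<in> borel_measurable (past_space T)"
    and f1: "(\<integral>\<^sup>+x. f x \<partial>path_lebesgue T) = 1" and g1: "(\<integral>\<^sup>+x. g x \<partial>path_lebesgue T) = 1"
    and close: "\<And>x. x \<in> space (past_space T) \<Longrightarrow> f x \<le> ennreal K * g x"
      "\<And>x. x \<in> space (past_space T) \<Longrightarrow> g x \<le> ennreal K * f x"
    and supp: "\<And>x. x \<in> space (past_space T) \<Longrightarrow> x \<notin> unit_cube T \<Longrightarrow> f x = 0"
      "\<And>x. x \<in> space (past_space T) \<Longrightarrow> x \<notin> unit_cube T \<Longrightarrow> g x = 0"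
  shows "AW1 T (density (path_lebesgue T) f) (density (path_lebesgue T) g)
    \<le> ennreal (real (CARD('d) * T) * (real T * (1 - 1 / K\<^sup>2)))"
proof -
  let ?\<mu> = "density (path_lebesgue T) f" and ?\<nu> = "density (path_lebesgue T) g" and ?R = "past_space T :: 'd path measure"
  let ?N = "{w \<in> space (?R \<Otimes>\<^sub>M ?R). fst w \<noteq> snd w}"
  let ?D = "real (CARD('d) * T)"
  obtain \<pi> where \<pi>: "\<pi> \<in> couplings ?\<mu> ?\<nu>" and b: "\<forall>t<T. bicausal_at t ?\<mu> ?\<nu> \<pi>"
    and off: "emeasure \<pi> ?N \<le> of_nat T * ennreal (1 - 1 / K\<^sup>2)"
    using exists_bicausal_coupling[OF K f g f1 g1] close by blast
  have s: "sets ?\<mu> = sets ?R" "sets ?\<nu> = sets ?R" by (simp_all add: sets_path_lebesgue)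
  have \<pi>': "sets \<pi> = sets (?R \<Otimes>\<^sub>M ?R)" "distr \<pi> ?R fst = ?\<mu>" "distr \<pi> ?R snd = ?\<nu>"
    using \<pi> unfolding in_couplings_iff[OF s] by auto
  have mf: "fst \<in> \<pi> \<rightarrow>\<^sub>M ?R" and ms: "snd \<in> \<pi> \<rightarrow>\<^sub>M ?R"
    unfolding measurable_cong_sets[OF \<pi>'(1) refl] by auto
  have f': "f \<in> borel_measurable (path_lebesgue T)" and g': "g \<in> borel_measurable (path_lebesgue T)"
    by (rule measurable_path_lebesgueI[OF f], rule measurable_path_lebesgueI[OF g])
  have "AE x in ?\<mu>. x \<in> unit_cube T" "AE x in ?\<nu>. x \<in> unit_cube T"
    unfolding AE_density[OF f'] AE_density[OF g']
    by (intro AE_I2 impI; rule ccontr; use supp in \<open>simp add: space_path_lebesgue\<close>)+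
  then have "AE w in \<pi>. fst w \<in> unit_cube T" "AE w in \<pi>. snd w \<in> unit_cube T"
    using AE_distrD[OF mf, unfolded \<pi>'(2)] AE_distrD[OF ms, unfolded \<pi>'(3)] by auto
  then have bound: "AE w in \<pi>. ennreal (l1_dist T (fst w) (snd w)) \<le> ennreal ?D * indicator ?N w"
    using AE_space[of \<pi>] unfolding sets_eq_imp_space_eq[OF \<pi>'(1)]
  proof eventually_elim
    case (elim w)
    then show ?case
      using l1_dist_cube[of "fst w" T "snd w"]
      by (cases "fst w = snd w") (auto simp: l1_dist_same indicator_def intro!: ennreal_leI)
  qed
  have "AW1 T ?\<mu> ?\<nu> \<le> (\<integral>\<^sup>+(x, y). ennreal (l1_dist T x y) \<partial>\<pi>)"
    unfolding AW1_def by (intro INF_lower bicausal_couplingsI[OF \<pi> b T s])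
  also have "\<dots> \<le> (\<integral>\<^sup>+w. ennreal ?D * indicator ?N w \<partial>\<pi>)"
    unfolding split_beta by (rule nn_integral_mono_AE[OF bound])
  also have "\<dots> = ennreal ?D * emeasure \<pi> ?N"
    using sets_path_neq by (intro nn_integral_cmult_indicator) (simp add: \<pi>')
  also have "\<dots> \<le> ennreal ?D * (of_nat T * ennreal (1 - 1 / K\<^sup>2))"
    by (intro mult_left_mono off) simp
  also have "\<dots> = ennreal (?D * (real T * (1 - 1 / K\<^sup>2)))"
  proof -
    have "0 \<le> 1 - 1 / K\<^sup>2" using K by simp
    then show ?thesis
      by (simp only: ennreal_of_nat_eq_real_of_nat ennreal_mult[OF of_nat_0_le_iff mult_nonneg_nonneg[OF of_nat_0_le_iff]]
          ennreal_mult[OF of_nat_0_le_iff])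
  qed
  finally show ?thesis .
qed

section \<open>Wavelets on the unit interval\<close>

text \<open>The support [1 - N, N] has length 2 N - 1, so at most 2 N integer translates are alive
  at a given point.\<close>

lemma card_near_le:
  fixes y :: real
  shows "card {m :: nat. 1 - real N \<le> y - real m \<and> y - real m \<le> real N} \<le> 2 * N"
proof -
  have "{m :: nat. 1 - real N \<le> y - real m \<and> y - real m \<le> real N} \<subseteq> {nat \<lceil>y - real N\<rceil>..<nat \<lceil>y - real N\<rceil> + 2 * N}"
  proof (intro subsetI)
    fix m assume "m \<in> {m :: nat. 1 - real N \<le> y - real m \<and> y - real m \<le> real N}"
    then have m: "1 - real N \<le> y - real m" "y - real m \<le> real N" by auto
    have 1: "nat \<lceil>y - real N\<rceil> \<le> m" using m(2) by (simp add: ceiling_le_iff)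
    have 2: "y - real N \<le> real (nat \<lceil>y - real N\<rceil>)" by (rule real_nat_ceiling_ge)
    with m have "real m < real (nat \<lceil>y - real N\<rceil> + 2 * N)" by simp
    then have "m < nat \<lceil>y - real N\<rceil> + 2 * N" by (simp only: of_nat_less_iff)
    with 1 show "m \<in> {nat \<lceil>y - real N\<rceil>..<nat \<lceil>y - real N\<rceil> + 2 * N}" by simp
  qed
  from card_mono[OF _ this] show ?thesis by simp
qed

lemma continuous_compact_bounded:
  fixes g :: "'a::topological_space \<Rightarrow> real"
  assumes "continuous_on S g" "compact S"
  shows "\<exists>B. \<forall>x\<in>S. \<bar>g x\<bar> \<le> B"
proof -
  have "bounded (g ` S)" by (intro compact_imp_bounded compact_continuous_image assms)
  then show ?thesis by (auto simp: bounded_iff)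
qed

lemma bounded_of_compact_support:
  fixes g :: "real \<Rightarrow> real"
  assumes "continuous_on UNIV g" and supp: "\<And>x. x \<notin> {a..b} \<Longrightarrow> g x = 0"
  shows "\<exists>M. \<forall>x. \<bar>g x\<bar> \<le> M"
proof -
  have "continuous_on {a..b} g" using assms(1) by (rule continuous_on_subset) simp
  from continuous_compact_bounded[OF this] obtain M where M: "\<forall>x\<in>{a..b}. \<bar>g x\<bar> \<le> M" by auto
  have "\<bar>g x\<bar> \<le> max M 0" for x
    using M supp[of x] by (cases "x \<in> {a..b}") force+
  then show ?thesis by blast
qed

text \<open>No decay is recorded: there are only \<open>N\<close> edge functions at each end of a
  level, so boundedness alone controls their contribution to a pointwise sum.\<close>

definition good_edge :: "nat \<Rightarrow> (nat \<Rightarrow> real \<Rightarrow> real) \<Rightarrow> bool" where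
  "good_edge N e \<longleftrightarrow> (\<forall>k<N. continuous_on {0..} (e k)) \<and> (\<exists>M. \<forall>k<N. \<forall>x\<ge>0. \<bar>e k x\<bar> \<le> M)"

lemma bounded_sum_abs:
  fixes h :: "'i \<Rightarrow> real \<Rightarrow> real"
  assumes "finite I" "\<And>i. i \<in> I \<Longrightarrow> \<exists>M. \<forall>x\<in>S. \<bar>h i x\<bar> \<le> M"
  shows "\<exists>M. \<forall>x\<in>S. \<bar>\<Sum>i\<in>I. h i x\<bar> \<le> M"
proof -
  obtain M where M: "\<And>i x. i \<in> I \<Longrightarrow> x \<in> S \<Longrightarrow> \<bar>h i x\<bar> \<le> M i" using assms(2) by metis
  have "\<bar>\<Sum>i\<in>I. h i x\<bar> \<le> (\<Sum>i\<in>I. M i)" if "x \<in> S" for x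
    using M that by (intro order.trans[OF sum_abs] sum_mono) auto
  then show ?thesis by blast
qed

lemma good_edgeI:
  assumes "\<And>k. k < N \<Longrightarrow> continuous_on {0..} (e k)" "\<And>k. k < N \<Longrightarrow> \<exists>M. \<forall>x\<in>{0..}. \<bar>e k x\<bar> \<le> M"
  shows "good_edge N e"
proof -
  obtain M where M: "\<And>k x. k < N \<Longrightarrow> x \<in> {0..} \<Longrightarrow> \<bar>e k x\<bar> \<le> M k" using assms(2) by metis
  have "\<bar>e k x\<bar> \<le> (\<Sum>k<N. \<bar>M k\<bar>)" if "k < N" "x \<ge> 0" for k x
  proof -
    have "\<bar>e k x\<bar> \<le> \<bar>M k\<bar>" using M[of k x] that by auto
    also have "\<dots> \<le> (\<Sum>k<N. \<bar>M k\<bar>)" using that by (intro member_le_sum) auto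
    finally show ?thesis .
  qed
  with assms(1) show ?thesis unfolding good_edge_def by blast
qed

lemma good_edge_scaling:
  assumes \<phi>: "continuous_on UNIV \<phi>" "\<And>x. \<bar>\<phi> x\<bar> \<le> M" and e: "edge_scaling N \<phi> e"
  shows "good_edge N e"
proof (rule good_edgeI)
  have c: "continuous_on {0..} (raw_edge N \<phi> l)" for l
    unfolding raw_edge_def[abs_def]
    by (intro continuous_intros continuous_on_compose2[OF \<phi>(1)]) auto
  have b: "\<exists>B. \<forall>x\<in>{0..}. \<bar>a * raw_edge N \<phi> l x\<bar> \<le> B" for l and a :: real
  proof -
    have "\<exists>B. \<forall>x\<in>{0..}. \<bar>raw_edge N \<phi> l x\<bar> \<le> B"
      unfolding raw_edge_def
    proof (rule bounded_sum_abs)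
      show "\<exists>B. \<forall>x\<in>{0..}. \<bar>real (i choose l) * \<phi> (x + real i - real N + 1)\<bar> \<le> B" for i
        using \<phi>(2) by (intro exI[of _ "real (i choose l) * M"]) (auto simp: abs_mult intro!: mult_left_mono)
    qed simp
    then obtain B where "\<forall>x\<in>{0..}. \<bar>raw_edge N \<phi> l x\<bar> \<le> B" by blast
    then show ?thesis by (intro exI[of _ "\<bar>a\<bar> * B"]) (auto simp: abs_mult intro!: mult_left_mono)
  qed
  fix k assume "k < N"
  then obtain a where a: "\<And>x. x \<ge> 0 \<Longrightarrow> e k x = (\<Sum>l<N. a l * raw_edge N \<phi> l x)"
    using e unfolding edge_scaling_def by blast
  have "continuous_on {0..} (\<lambda>x. \<Sum>l<N. a l * raw_edge N \<phi> l x)"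
    by (intro continuous_intros c)
  then show "continuous_on {0..} (e k)" using a by (subst continuous_on_cong[OF refl]) auto
  have "\<exists>B. \<forall>x\<in>{0..}. \<bar>\<Sum>l<N. a l * raw_edge N \<phi> l x\<bar> \<le> B"
    using b by (intro bounded_sum_abs) auto
  then show "\<exists>B. \<forall>x\<in>{0..}. \<bar>e k x\<bar> \<le> B" using a by auto
qed

lemma good_edge_wavelets:
  assumes \<phi>: "continuous_on UNIV \<phi>" "\<And>x. \<bar>\<phi> x\<bar> \<le> M" and e: "good_edge N e" and w: "edge_wavelets N \<phi> \<psi> e w"
  shows "good_edge N w"
proof (rule good_edgeI)
  obtain B where ce: "\<And>l. l < N \<Longrightarrow> continuous_on {0..} (e l)" and B: "\<And>l x. l < N \<Longrightarrow> x \<ge> 0 \<Longrightarrow> \<bar>e l x\<bar> \<le> B"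
    using e unfolding good_edge_def by blast
  fix k assume "k < N"
  then obtain a b where ab: "\<And>x. x \<ge> 0 \<Longrightarrow> w k x =
        (\<Sum>l<N. a l * (sqrt 2 * e l (2 * x))) + (\<Sum>m\<in>{N..3 * N - 2}. b m * (sqrt 2 * \<phi> (2 * x - real m)))"
    using w unfolding edge_wavelets_def by blast
  have "continuous_on {0..} (\<lambda>x. (\<Sum>l<N. a l * (sqrt 2 * e l (2 * x))) + (\<Sum>m\<in>{N..3 * N - 2}. b m * (sqrt 2 * \<phi> (2 * x - real m))))"
    by (intro continuous_intros continuous_on_compose2[OF \<phi>(1)] continuous_on_compose2[OF ce]) auto
  then show "continuous_on {0..} (w k)" using ab by (subst continuous_on_cong[OF refl]) auto
  have "\<exists>C. \<forall>x\<in>{0..}. \<bar>\<Sum>l<N. a l * (sqrt 2 * e l (2 * x))\<bar> \<le> C"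
    by (intro bounded_sum_abs exI[of _ "\<bar>a _\<bar> * (sqrt 2 * B)"]) (auto simp: abs_mult intro!: mult_left_mono B)
  moreover have "\<exists>C. \<forall>x\<in>{0..}. \<bar>\<Sum>m\<in>{N..3 * N - 2}. b m * (sqrt 2 * \<phi> (2 * x - real m))\<bar> \<le> C"
    by (intro bounded_sum_abs exI[of _ "\<bar>b _\<bar> * (sqrt 2 * M)"]) (auto simp: abs_mult intro!: mult_left_mono \<phi>(2))
  ultimately obtain C1 C2 where C: "\<And>x. x \<ge> 0 \<Longrightarrow> \<bar>\<Sum>l<N. a l * (sqrt 2 * e l (2 * x))\<bar> \<le> C1"
      "\<And>x. x \<ge> 0 \<Longrightarrow> \<bar>\<Sum>m\<in>{N..3 * N - 2}. b m * (sqrt 2 * \<phi> (2 * x - real m))\<bar> \<le> C2" by auto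
  have "\<bar>w k x\<bar> \<le> C1 + C2" if "x \<ge> 0" for x
    unfolding ab[OF that] using C[OF that] by linarith
  then show "\<exists>M. \<forall>x\<in>{0..}. \<bar>w k x\<bar> \<le> M" by auto
qed

lemma interval_system_continuous:
  assumes g: "continuous_on UNIV g" and eL: "good_edge N eL" and eR: "good_edge N eR" and m: "m < 2 ^ j"
    and j: "2 * N \<le> 2 ^ j"
  shows "continuous_on {0..1} (interval_system N g eL eR j m)"
proof -
  have "continuous_on {0..1} (\<lambda>x. eL m (2 ^ j * x))" if "m < N"
    by (rule continuous_on_compose2[of "{0..}" "eL m"])
       (use eL that in \<open>auto simp: good_edge_def intro!: continuous_intros\<close>)
  moreover have "continuous_on {0..1} (\<lambda>x. g (2 ^ j * x - real m))"
    by (rule continuous_on_compose2[OF g]) (auto intro!: continuous_intros)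
  moreover have "continuous_on {0..1} (\<lambda>x. eR (2 ^ j - 1 - m) (2 ^ j * (1 - x)))" if "\<not> m < 2 ^ j - N"
  proof -
    have "2 ^ j - 1 - m < N" using that m j by auto
    then show ?thesis
      by (intro continuous_on_compose2[of "{0..}" "eR (2 ^ j - 1 - m)" _ "\<lambda>x. 2 ^ j * (1 - x)"])
         (use eR in \<open>auto simp: good_edge_def intro!: continuous_intros\<close>)
  qed
  ultimately have "continuous_on {0..1} (\<lambda>x. if m < N then eL m (2 ^ j * x)
      else if m < 2 ^ j - N then g (2 ^ j * x - real m) else eR (2 ^ j - 1 - m) (2 ^ j * (1 - x)))"
    by (cases "m < N"; cases "m < 2 ^ j - N") (simp_all only: if_True if_False not_False_eq_True)
  then show ?thesis
    unfolding interval_system_def[abs_def] by (rule continuous_on_mult_left)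
qed

text \<open>There are 2 N edge functions, and at a fixed point at most 2 N interior functions are
  non-zero; each is at most M 2^(j/2). Hence the constant does not see the number 2^j of
  functions.\<close>

lemma interval_system_bound:
  assumes gM: "\<And>x. \<bar>g x\<bar> \<le> M1" and g0: "\<And>x. x \<notin> {1 - real N..real N} \<Longrightarrow> g x = 0"
    and eL: "good_edge N eL" and eR: "good_edge N eR"
  shows "\<exists>C. \<forall>j. 2 * N \<le> 2 ^ j \<longrightarrow> (\<forall>x\<in>{0..1}. (\<Sum>m<2 ^ j. \<bar>interval_system N g eL eR j m x\<bar>) \<le> C * 2 powr (real j / 2))"
proof -
  obtain M2 where M2: "\<And>k x. k < N \<Longrightarrow> x \<ge> 0 \<Longrightarrow> \<bar>eL k x\<bar> \<le> M2"
    using eL unfolding good_edge_def by blast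
  obtain M3 where M3: "\<And>k x. k < N \<Longrightarrow> x \<ge> 0 \<Longrightarrow> \<bar>eR k x\<bar> \<le> M3"
    using eR unfolding good_edge_def by blast
  define M where "M = \<bar>M1\<bar> + \<bar>M2\<bar> + \<bar>M3\<bar>"
  have count: "(\<Sum>m\<in>I. indicator S m :: real) = real (card (I \<inter> S))" if "finite I" for I S :: "nat set"
    using that by (simp add: indicator_def of_bool_def sum.If_cases)
  have "(\<Sum>m<2 ^ j. \<bar>interval_system N g eL eR j m x\<bar>) \<le> (M * (4 * real N)) * 2 powr (real j / 2)"
    if j: "2 * N \<le> 2 ^ j" and x: "x \<in> {0..1}" for j x
  proof -
    let ?A = "{..<N}" and ?B = "{2 ^ j - N..<2 ^ j}"
      and ?D = "{m :: nat. 1 - real N \<le> 2 ^ j * x - real m \<and> 2 ^ j * x - real m \<le> real N}"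
    have "\<bar>interval_system N g eL eR j m x\<bar> \<le> 2 powr (real j / 2) * (M * indicator (?A \<union> ?B \<union> ?D) m)"
      if m: "m < 2 ^ j" for m
    proof -
      have "\<bar>eL m (2 ^ j * x)\<bar> \<le> M" if "m < N"
        using M2[OF that, of "2 ^ j * x"] x by (auto simp: M_def)
      moreover have "\<bar>g (2 ^ j * x - real m)\<bar> \<le> M * indicator ?D m"
        using gM[of "2 ^ j * x - real m"] g0[of "2 ^ j * x - real m"] by (auto simp: M_def indicator_def)
      moreover have "\<bar>eR (2 ^ j - 1 - m) (2 ^ j * (1 - x))\<bar> \<le> M" if "\<not> m < 2 ^ j - N"
      proof -
        have "2 ^ j - 1 - m < N" using that m j by auto
        moreover have "0 \<le> 2 ^ j * (1 - x)" using x by auto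
        ultimately show ?thesis using M3 unfolding M_def by fastforce
      qed
      moreover have "M \<ge> 0" by (simp add: M_def)
      ultimately show ?thesis
        using m unfolding interval_system_def abs_mult
        by (intro mult_mono) (auto simp: indicator_def split: if_splits)
    qed
    then have "(\<Sum>m<2 ^ j. \<bar>interval_system N g eL eR j m x\<bar>)
        \<le> (\<Sum>m<2 ^ j. 2 powr (real j / 2) * (M * indicator (?A \<union> ?B \<union> ?D) m))"
      by (intro sum_mono) auto
    also have "\<dots> = 2 powr (real j / 2) * (M * real (card ({..<2 ^ j} \<inter> (?A \<union> ?B \<union> ?D))))"
      unfolding sum_distrib_left[symmetric] count[of "{..<2 ^ j}", OF finite_lessThan] ..
    also have "\<dots> \<le> 2 powr (real j / 2) * (M * (4 * real N))"
    proof -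
      have "finite ?D"
      proof (cases "N = 0")
        case False
        have "?D \<subseteq> {..nat \<lceil>2 ^ j * x + real N\<rceil>}"
        proof
          fix m assume "m \<in> ?D"
          then have "real m \<le> 2 ^ j * x + real N" by auto
          also have "\<dots> \<le> real (nat \<lceil>2 ^ j * x + real N\<rceil>)" by (rule real_nat_ceiling_ge)
          finally show "m \<in> {..nat \<lceil>2 ^ j * x + real N\<rceil>}" by simp
        qed
        then show ?thesis by (rule finite_subset) simp
      qed (auto intro: finite_subset[of _ "{}"])
      then have "card ({..<2 ^ j} \<inter> (?A \<union> ?B \<union> ?D)) \<le> card (?A \<union> ?B \<union> ?D)"
        by (intro card_mono) auto
      also have "\<dots> \<le> card ?A + card ?B + card ?D"
        by (rule order.trans[OF card_Un_le]) (intro add_right_mono card_Un_le)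
      also have "\<dots> \<le> 4 * N" using card_near_le[of N "2 ^ j * x"] j by auto
      finally have "real (card ({..<2 ^ j} \<inter> (?A \<union> ?B \<union> ?D))) \<le> real (4 * N)" by (simp only: of_nat_le_iff)
      then show ?thesis by (intro mult_left_mono) (auto simp: M_def)
    qed
    finally show ?thesis by (simp add: mult_ac)
  qed
  then show ?thesis by blast
qed

text \<open>The wavelet is a finite combination of the functions
  \<open>\<phi> (2 * x - of_int n)\<close> with n between 1 - N and N; if x lies outside [1 - N, N],
  then so does every 2 x - n.\<close>

lemma daubechies_wavelet_props:
  assumes "daubechies N h \<phi> \<psi>"
  shows "continuous_on UNIV \<phi>" "\<And>x. x \<notin> {1 - real N..real N} \<Longrightarrow> \<phi> x = 0"
    "continuous_on UNIV \<psi>" "\<And>x. x \<notin> {1 - real N..real N} \<Longrightarrow> \<psi> x = 0"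
proof -
  have c: "continuous_on UNIV \<phi>"
    using assms unfolding daubechies_def by (elim conjE)
  have z': "\<forall>x. x \<notin> {1 - real N..real N} \<longrightarrow> \<phi> x = 0"
    using assms unfolding daubechies_def by (elim conjE)
  have e': "\<forall>x. \<psi> x = sqrt 2 * (\<Sum>n\<in>{1 - int N..int N}. (- 1) powi n * h (1 - n) * \<phi> (2 * x - of_int n))"
    using assms unfolding daubechies_def by (elim conjE)
  note z = z'[rule_format] and e = e'[rule_format]
  show "continuous_on UNIV \<phi>" by fact
  show "\<phi> x = 0" if "x \<notin> {1 - real N..real N}" for x by (rule z[OF that])
  show "continuous_on UNIV \<psi>"
    unfolding e[abs_def] by (intro continuous_intros continuous_on_compose2[OF c]) auto
  show "\<psi> x = 0" if x: "x \<notin> {1 - real N..real N}" for x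
  proof -
    have "\<phi> (2 * x - of_int n) = 0" if n: "n \<in> {1 - int N..int N}" for n
    proof (rule z)
      have "1 - real N \<le> real_of_int n" "real_of_int n \<le> real N" using n by auto
      then show "2 * x - real_of_int n \<notin> {1 - real N..real N}" using x by auto
    qed
    then show ?thesis unfolding e by simp
  qed
qed

context
  fixes N j0 :: nat and \<zeta> \<xi> :: "nat \<Rightarrow> nat \<Rightarrow> real \<Rightarrow> real"
  assumes N: "N \<ge> 2" and j0: "real j0 \<ge> log 2 (real N)" and cdv: "cdv_system N j0 \<zeta> \<xi>"
begin

text \<open>The interval form of the system is only prescribed for \<open>2 N \<le> 2 ^ j\<close>; the possible exceptional level
  \<open>j0\<close> is reached from the next one by the refinement relation.\<close>

lemma level_large:
  assumes "j \<ge> j0" shows "2 * N \<le> 2 ^ (j + 1)"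
proof -
  have "real N = 2 powr (log 2 (real N))" using N by simp
  also have "\<dots> \<le> 2 powr (real j)" using assms j0 by (intro powr_mono) auto
  finally have "real N \<le> real (2 ^ j)" by (simp add: powr_realpow)
  then have "N \<le> 2 ^ j" by (simp only: of_nat_le_iff)
  then show ?thesis by simp
qed

lemma cdv_two_level:
  assumes "j \<ge> j0" "m < 2 ^ j"
  shows "\<exists>c. \<forall>x\<in>{0..1}. \<zeta> j m x = (\<Sum>l<2 ^ (j + 1). c l * \<zeta> (j + 1) l x)"
    "\<exists>c. \<forall>x\<in>{0..1}. \<xi> j m x = (\<Sum>l<2 ^ (j + 1). c l * \<zeta> (j + 1) l x)"
  using cdv assms unfolding cdv_system_def by blast+

lemma cdv_fine_levels:
  shows "\<exists>C. \<forall>j\<ge>j0. 2 * N \<le> 2 ^ j \<longrightarrow>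
      (\<forall>m<2 ^ j. continuous_on {0..1} (\<zeta> j m)) \<and>
      (\<forall>x\<in>{0..1}. (\<Sum>m<2 ^ j. \<bar>\<zeta> j m x\<bar>) \<le> C * 2 powr (real j / 2) \<and>
                   (\<Sum>m<2 ^ j. \<bar>\<xi> j m x\<bar>) \<le> C * 2 powr (real j / 2))"
proof -
  obtain h \<phi> \<psi> eL eR wL wR where d: "daubechies N h \<phi> \<psi>"
    and eL: "edge_scaling N \<phi> eL" and wL: "edge_wavelets N \<phi> \<psi> eL wL"
    and eR: "edge_scaling N (\<lambda>x. \<phi> (1 - x)) eR"
    and wR: "edge_wavelets N (\<lambda>x. \<phi> (1 - x)) (\<lambda>x. \<psi> (1 - x)) eR wR"
    and form': "\<forall>j\<ge>j0. 2 * N \<le> 2 ^ j \<longrightarrow> (\<forall>m<2 ^ j. \<forall>x\<in>{0..1}.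
           \<zeta> j m x = interval_system N \<phi> eL eR j m x \<and> \<xi> j m x = interval_system N \<psi> wL wR j m x)"
    using cdv unfolding cdv_system_def by (elim exE conjE) (rule that)
  have form: "\<zeta> j m x = interval_system N \<phi> eL eR j m x \<and> \<xi> j m x = interval_system N \<psi> wL wR j m x"
    if "j \<ge> j0" "2 * N \<le> 2 ^ j" "m < 2 ^ j" "x \<in> {0..1}" for j m x
    using form' that by blast
  note p = daubechies_wavelet_props[OF d]
  obtain M where M: "\<And>x. \<bar>\<phi> x\<bar> \<le> M" using bounded_of_compact_support[OF p(1) p(2)] by blast
  obtain M' where M': "\<And>x. \<bar>\<psi> x\<bar> \<le> M'" using bounded_of_compact_support[OF p(3) p(4)] by blast
  have rc: "continuous_on UNIV (\<lambda>x. \<phi> (1 - x))"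
    by (rule continuous_on_compose2[OF p(1)]) (auto intro!: continuous_intros)
  have geL: "good_edge N eL" by (rule good_edge_scaling[OF p(1) M eL])
  have geR: "good_edge N eR" by (rule good_edge_scaling[OF rc M eR])
  have gwL: "good_edge N wL" by (rule good_edge_wavelets[OF p(1) M geL wL])
  have gwR: "good_edge N wR" by (rule good_edge_wavelets[OF rc M geR wR])
  obtain C1 where C1: "\<forall>j. 2 * N \<le> 2 ^ j \<longrightarrow> (\<forall>x\<in>{0..1}. (\<Sum>m<2 ^ j. \<bar>interval_system N \<phi> eL eR j m x\<bar>) \<le> C1 * 2 powr (real j / 2))"
    using interval_system_bound[of \<phi> M N eL eR, OF M p(2) geL geR] by blast
  obtain C2 where C2: "\<forall>j. 2 * N \<le> 2 ^ j \<longrightarrow> (\<forall>x\<in>{0..1}. (\<Sum>m<2 ^ j. \<bar>interval_system N \<psi> wL wR j m x\<bar>) \<le> C2 * 2 powr (real j / 2))"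
    using interval_system_bound[of \<psi> M' N wL wR, OF M' p(4) gwL gwR] by blast
  show ?thesis
  proof (intro exI[of _ "max C1 C2"] allI impI conjI ballI)
    fix j m assume j: "j0 \<le> j" "2 * N \<le> 2 ^ j" and m: "m < (2 :: nat) ^ j"
    have "continuous_on {0..1} (interval_system N \<phi> eL eR j m)"
      by (rule interval_system_continuous[OF p(1) geL geR m j(2)])
    then show "continuous_on {0..1} (\<zeta> j m)"
      using form[OF j m] by (subst continuous_on_cong[OF refl]) auto
  next
    fix j x assume j: "j0 \<le> j" "2 * N \<le> 2 ^ j" and x: "x \<in> {0..1::real}"
    have "(\<Sum>m<2 ^ j. \<bar>\<zeta> j m x\<bar>) = (\<Sum>m<2 ^ j. \<bar>interval_system N \<phi> eL eR j m x\<bar>)"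
      using form[OF j _ x] by (intro sum.cong) auto
    also have "\<dots> \<le> C1 * 2 powr (real j / 2)" using C1 j x by blast
    also have "\<dots> \<le> max C1 C2 * 2 powr (real j / 2)" by (intro mult_right_mono) auto
    finally show "(\<Sum>m<2 ^ j. \<bar>\<zeta> j m x\<bar>) \<le> max C1 C2 * 2 powr (real j / 2)" .
    have "(\<Sum>m<2 ^ j. \<bar>\<xi> j m x\<bar>) = (\<Sum>m<2 ^ j. \<bar>interval_system N \<psi> wL wR j m x\<bar>)"
      using form[OF j _ x] by (intro sum.cong) auto
    also have "\<dots> \<le> C2 * 2 powr (real j / 2)" using C2 j x by blast
    also have "\<dots> \<le> max C1 C2 * 2 powr (real j / 2)" by (intro mult_right_mono) auto
    finally show "(\<Sum>m<2 ^ j. \<bar>\<xi> j m x\<bar>) \<le> max C1 C2 * 2 powr (real j / 2)" .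
  qed
qed

text \<open>Expanding on level j + 1, where the interval form always applies, treats all levels
  alike.\<close>

lemma cdv_continuous:
  assumes j: "j \<ge> j0" and m: "m < 2 ^ j"
  shows "continuous_on {0..1} (\<zeta> j m)" "continuous_on {0..1} (\<xi> j m)"
proof -
  have fine: "continuous_on {0..1} (\<zeta> (j + 1) l)" if "l < 2 ^ (j + 1)" for l
  proof -
    from cdv_fine_levels obtain C where "\<forall>j\<ge>j0. 2 * N \<le> 2 ^ j \<longrightarrow>
      (\<forall>m<2 ^ j. continuous_on {0..1} (\<zeta> j m)) \<and>
      (\<forall>x\<in>{0..1}. (\<Sum>m<2 ^ j. \<bar>\<zeta> j m x\<bar>) \<le> C * 2 powr (real j / 2) \<and>
                   (\<Sum>m<2 ^ j. \<bar>\<xi> j m x\<bar>) \<le> C * 2 powr (real j / 2))" by (rule exE)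
    from this[THEN spec, of "j + 1"] level_large[OF j] that j show ?thesis by simp
  qed
  have lin: "continuous_on {0..1} g" if ex: "\<exists>c. \<forall>x\<in>{0..1}. g x = (\<Sum>l<2 ^ (j + 1). c l * \<zeta> (j + 1) l x)" for g
  proof -
    obtain c where c: "\<forall>x\<in>{0..1}. g x = (\<Sum>l<2 ^ (j + 1). c l * \<zeta> (j + 1) l x)" using ex by (rule exE)
    have "continuous_on {0..1} (\<lambda>x. \<Sum>l<2 ^ (j + 1). c l * \<zeta> (j + 1) l x)"
      by (intro continuous_on_sum continuous_on_mult_left fine) auto
    then show ?thesis using c by (subst continuous_on_cong[OF refl]) auto
  qed
  show "continuous_on {0..1} (\<zeta> j m)" "continuous_on {0..1} (\<xi> j m)"
    by (intro lin cdv_two_level[OF j m])+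
qed

text \<open>The fine levels share one constant by locality. At most one coarse level remains, and
  there continuity on the compact interval gives a bound that \<open>C'\<close> absorbs.\<close>

lemma cdv_sum_bound:
  "\<exists>C>0. \<forall>j\<ge>j0. \<forall>x\<in>{0..1}. (\<Sum>m<2 ^ j. \<bar>\<zeta> j m x\<bar>) \<le> C * 2 powr (real j / 2) \<and>
                   (\<Sum>m<2 ^ j. \<bar>\<xi> j m x\<bar>) \<le> C * 2 powr (real j / 2)"
proof -
  obtain C where C: "\<And>j x. j \<ge> j0 \<Longrightarrow> 2 * N \<le> 2 ^ j \<Longrightarrow> x \<in> {0..1} \<Longrightarrow>
      (\<Sum>m<2 ^ j. \<bar>\<zeta> j m x\<bar>) \<le> C * 2 powr (real j / 2) \<and> (\<Sum>m<2 ^ j. \<bar>\<xi> j m x\<bar>) \<le> C * 2 powr (real j / 2)"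
    using cdv_fine_levels by blast
  have "continuous_on {0..1} (\<lambda>x. (\<Sum>m<2 ^ j0. \<bar>\<zeta> j0 m x\<bar>) + (\<Sum>m<2 ^ j0. \<bar>\<xi> j0 m x\<bar>))"
    by (intro continuous_intros cdv_continuous) auto
  from continuous_compact_bounded[OF this] obtain B
    where B: "\<forall>x\<in>{0..1}. \<bar>(\<Sum>m<2 ^ j0. \<bar>\<zeta> j0 m x\<bar>) + (\<Sum>m<2 ^ j0. \<bar>\<xi> j0 m x\<bar>)\<bar> \<le> B"
    by blast
  define C' where "C' = \<bar>C\<bar> + \<bar>B\<bar> + 1"
  have main: "(\<Sum>m<2 ^ j. \<bar>\<zeta> j m x\<bar>) \<le> C' * 2 powr (real j / 2) \<and> (\<Sum>m<2 ^ j. \<bar>\<xi> j m x\<bar>) \<le> C' * 2 powr (real j / 2)"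
    if j: "j \<ge> j0" and x: "x \<in> {0..1}" for j x
  proof (cases "2 * N \<le> 2 ^ j")
    case True
    have "C * 2 powr (real j / 2) \<le> C' * 2 powr (real j / 2)"
      by (intro mult_right_mono) (auto simp: C'_def)
    then show ?thesis using C[OF j True x] by linarith
  next
    case False
    \<comment> \<open>Were j larger than \<open>j0\<close>, then \<open>level_large\<close> at level
      j - 1 would already give 2 N \<le> 2^j.\<close>
    have "j = j0"
    proof (rule ccontr)
      assume "j \<noteq> j0"
      then have "j - 1 \<ge> j0" "j - 1 + 1 = j" using j by auto
      then show False using level_large[of "j - 1"] False by simp
    qed
    have "B \<le> C' * 1" by (auto simp: C'_def)
    also have "\<dots> \<le> C' * 2 powr (real j / 2)"
      by (intro mult_left_mono ge_one_powr_ge_zero) (auto simp: C'_def)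
    finally have "B \<le> C' * 2 powr (real j / 2)" .
    moreover have "(\<Sum>m<2 ^ j0. \<bar>\<zeta> j0 m x\<bar>) \<ge> 0" "(\<Sum>m<2 ^ j0. \<bar>\<xi> j0 m x\<bar>) \<ge> 0"
      by (intro sum_nonneg; simp)+
    ultimately show ?thesis using B[rule_format, OF x] unfolding \<open>j = j0\<close> by linarith
  qed
  show ?thesis
    by (rule exI[of _ C']) (use main in \<open>auto simp: C'_def\<close>)
qed

abbreviation "unit_lborel \<equiv> restrict_space lborel {0..1::real}"

lemma integrable_unit_lborel:
  assumes "continuous_on {0..1} g" shows "integrable unit_lborel (g :: real \<Rightarrow> real)"
  using borel_integrable_compact[OF _ assms] by (simp add: integrable_restrict_space)

lemma cdv_orthonormal:
  assumes "j \<ge> j0"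
  shows "orthonormal_family unit_lborel (onb_index j) (case_sum (\<zeta> j) (\<lambda>(i, m). \<xi> i m))"
  using cdv assms unfolding cdv_system_def orthonormal_basis_L2_def by blast

lemma cdv_integral_square:
  assumes "j \<ge> j0" "m < 2 ^ j"
  shows "(LINT x|unit_lborel. (\<zeta> j m x)\<^sup>2) = 1" "(LINT x|unit_lborel. (\<xi> j m x)\<^sup>2) = 1"
proof -
  have o: "(LINT x|unit_lborel. case_sum (\<zeta> j) (\<lambda>(i, m). \<xi> i m) a x * case_sum (\<zeta> j) (\<lambda>(i, m). \<xi> i m) a x) = 1"
    if "a \<in> onb_index j" for a
    using cdv_orthonormal[OF assms(1)] that unfolding orthonormal_family_def by simp
  have "Inl m \<in> onb_index j" "Inr (j, m) \<in> onb_index j" using assms by (auto simp: onb_index_def)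
  from o[OF this(1)] o[OF this(2)]
  show "(LINT x|unit_lborel. (\<zeta> j m x)\<^sup>2) = 1" "(LINT x|unit_lborel. (\<xi> j m x)\<^sup>2) = 1"
    by (simp_all add: power2_eq_square)
qed

lemma cdv_orthogonal:
  assumes "m < 2 ^ j0"
  shows "l < 2 ^ j0 \<Longrightarrow> (LINT x|unit_lborel. \<zeta> j0 m x * \<zeta> j0 l x) = (if m = l then 1 else 0)"
    "j \<ge> j0 \<Longrightarrow> l < 2 ^ j \<Longrightarrow> (LINT x|unit_lborel. \<xi> j l x * \<zeta> j0 m x) = 0"
proof -
  have o: "(LINT x|unit_lborel. case_sum (\<zeta> j0) (\<lambda>(i, m). \<xi> i m) a x * case_sum (\<zeta> j0) (\<lambda>(i, m). \<xi> i m) b x) = (if a = b then 1 else 0)"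
    if "a \<in> onb_index j0" "b \<in> onb_index j0" for a b
    using cdv_orthonormal[OF order_refl] that unfolding orthonormal_family_def by blast
  have m: "Inl m \<in> onb_index j0" using assms by (auto simp: onb_index_def)
  show "(LINT x|unit_lborel. \<zeta> j0 m x * \<zeta> j0 l x) = (if m = l then 1 else 0)" if "l < 2 ^ j0"
    using o[OF m, of "Inl l"] that by (simp add: onb_index_def)
  show "(LINT x|unit_lborel. \<xi> j l x * \<zeta> j0 m x) = 0" if "j \<ge> j0" "l < 2 ^ j"
  proof -
    have "Inr (j, l) \<in> onb_index j0" using that by (auto simp: onb_index_def)
    from o[OF this m] show ?thesis by simp
  qed
qed

text \<open>The polynomial 1 is a combination of scaling functions with coefficients c. Multiplying
  this expansion by a continuous g expresses the integral of g through inner products;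
  orthonormality then identifies c as the integrals of the scaling functions and makes the integral
  of every wavelet vanish.\<close>

lemma cdv_constant:
  shows "x \<in> {0..1} \<Longrightarrow> (\<Sum>m<2 ^ j0. (LINT x|unit_lborel. \<zeta> j0 m x) * \<zeta> j0 m x) = 1"
    and "j \<ge> j0 \<Longrightarrow> l < 2 ^ j \<Longrightarrow> (LINT x|unit_lborel. \<xi> j l x) = 0"
proof -
  have "\<forall>p::real poly. degree p \<le> N - 1 \<longrightarrow> (\<exists>c. \<forall>x\<in>{0..1}. poly p x = (\<Sum>m<2 ^ j0. c m * \<zeta> j0 m x))"
    using cdv unfolding cdv_system_def by (elim conjE) assumption
  from this[rule_format, of 1] obtain c where "\<forall>x\<in>{0..1}. poly 1 x = (\<Sum>m<2 ^ j0. c m * \<zeta> j0 m x)"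
    by auto
  then have c: "1 = (\<Sum>m<2 ^ j0. c m * \<zeta> j0 m x)" if "x \<in> {0..1}" for x using that by simp
  have expand: "(LINT x|unit_lborel. g x) = (\<Sum>m<2 ^ j0. c m * (LINT x|unit_lborel. g x * \<zeta> j0 m x))"
    if g: "continuous_on {0..1} g" for g
  proof -
    have "(LINT x|unit_lborel. g x) = (LINT x|unit_lborel. (\<Sum>m<2 ^ j0. c m * (g x * \<zeta> j0 m x)))"
    proof (rule Bochner_Integration.integral_cong[OF refl])
      fix x assume "x \<in> space unit_lborel"
      then have "x \<in> {0..1}" by (simp add: space_restrict_space)
      then have "g x = g x * (\<Sum>m<2 ^ j0. c m * \<zeta> j0 m x)" using c[of x] by simp
      then show "g x = (\<Sum>m<2 ^ j0. c m * (g x * \<zeta> j0 m x))" by (simp add: sum_distrib_left mult_ac)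
    qed
    also have "\<dots> = (\<Sum>m<2 ^ j0. (LINT x|unit_lborel. c m * (g x * \<zeta> j0 m x)))"
      by (intro Bochner_Integration.integral_sum integrable_mult_right integrable_unit_lborel continuous_on_mult g cdv_continuous) auto
    finally show ?thesis by simp
  qed
  have cm: "(LINT x|unit_lborel. \<zeta> j0 m x) = c m" if "m < 2 ^ j0" for m
    using that by (subst expand[OF cdv_continuous(1)[OF order_refl that]]) (simp add: cdv_orthogonal(1) mult_delta_right)
  show "(\<Sum>m<2 ^ j0. (LINT x|unit_lborel. \<zeta> j0 m x) * \<zeta> j0 m x) = 1" if "x \<in> {0..1}"
    using c[OF that] cm by simp
  show "(LINT x|unit_lborel. \<xi> j l x) = 0" if "j \<ge> j0" "l < 2 ^ j"
    using that by (subst expand[OF cdv_continuous(2)[OF that]]) (simp add: cdv_orthogonal(2))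
qed

end

section \<open>Tensor products\<close>

lemma Basis_vec_eq: "(Basis :: (real ^ 'd::finite) set) = (\<lambda>i. axis i 1) ` UNIV"
  by (auto simp: Basis_vec_def)

lemma prod_Basis_vec:
  fixes F :: "real ^ 'd::finite \<Rightarrow> 'b::comm_monoid_mult"
  shows "(\<Prod>b\<in>Basis. F b) = (\<Prod>i\<in>UNIV. F (axis i 1))"
  unfolding Basis_vec_eq by (subst prod.reindex) (auto simp: inj_on_def axis_eq_axis)

lemma prod_coords:
  fixes F :: "nat \<times> 'd::finite \<Rightarrow> 'b::comm_monoid_mult"
  shows "(\<Prod>p\<in>coords T. F p) = (\<Prod>t\<in>{1..T}. \<Prod>i\<in>UNIV. F (t, i))"
  unfolding coords_def by (simp add: prod.cartesian_product)

text \<open>Inverse of i \<mapsto> \<open>axis i 1\<close>. Fubini on a Euclidean space runs over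
  \<open>Basis\<close>, the tensor products over component indices.\<close>

definition axis_index :: "real ^ 'd::finite \<Rightarrow> 'd" where
  "axis_index b = (SOME i. b = axis i 1)"

lemma axis_index_axis: "axis_index (axis i 1 :: real ^ 'd::finite) = i"
  unfolding axis_index_def by (rule some_equality) (auto simp: axis_eq_axis)

lemma nn_integral_vec_prod:
  fixes u :: "'d::finite \<Rightarrow> real \<Rightarrow> ennreal"
  assumes "\<And>i. u i \<in> borel_measurable borel"
  shows "(\<integral>\<^sup>+v. (\<Prod>i\<in>UNIV. u i (v $ i)) \<partial>lborel) = (\<Prod>i\<in>UNIV. \<integral>\<^sup>+y. u i y \<partial>lborel)"
proof -
  have "(\<integral>\<^sup>+v. (\<Prod>b\<in>Basis. u (axis_index b) (v \<bullet> b)) \<partial>(lborel :: (real ^ 'd) measure))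
    = (\<Prod>b\<in>(Basis :: (real ^ 'd) set). \<integral>\<^sup>+y. u (axis_index b) y \<partial>lborel)"
    by (rule nn_integral_lborel_prod) (use assms in auto)
  then show ?thesis
    unfolding prod_Basis_vec by (simp add: axis_index_axis inner_axis)
qed

text \<open>Lebesgue measure on \<open>real ^ 'd\<close> is the image of the product measure over
  \<open>Basis\<close>; transported there, the integrand is a product of functions of single
  coordinates.\<close>

lemma integral_vec_prod:
  fixes u :: "'d::finite \<Rightarrow> real \<Rightarrow> real"
  assumes u: "\<And>i. integrable lborel (u i)"
  shows "integrable lborel (\<lambda>v :: real ^ 'd. \<Prod>i\<in>UNIV. u i (v $ i))" (is ?I)
    and "(LINT v|lborel. (\<Prod>i\<in>UNIV. u i (v $ i))) = (\<Prod>i\<in>UNIV. LINT y|lborel. u i y)"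
proof -
  interpret product_sigma_finite "\<lambda>_ :: real ^ 'd. lborel :: real measure" ..
  let ?S = "\<lambda>f :: real ^ 'd \<Rightarrow> real. \<Sum>b\<in>Basis. f b *\<^sub>R b"
  let ?P = "Pi\<^sub>M Basis (\<lambda>b :: real ^ 'd. lborel :: real measure)"
  have mS: "?S \<in> ?P \<rightarrow>\<^sub>M borel" by measurable
  have [measurable]: "u i \<in> borel_measurable borel" for i
    using u[of i] by (simp add: borel_measurable_integrable)
  have comp [measurable]: "(\<lambda>v :: real ^ 'd. v $ i) \<in> borel_measurable borel" for i
    by (intro borel_measurable_continuous_onI continuous_intros)
  have mu: "(\<lambda>v :: real ^ 'd. \<Prod>i\<in>UNIV. u i (v $ i)) \<in> borel_measurable borel" by measurable
  have eq: "(\<Prod>i\<in>UNIV. u i (?S f $ i)) = (\<Prod>b\<in>Basis. u (axis_index b) (f b))" for f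
  proof -
    have "?S f $ i = f (axis i 1)" for i
    proof -
      have "?S f $ i = ?S f \<bullet> axis i 1" by (simp add: inner_axis)
      also have "\<dots> = f (axis i 1)"
        by (subst inner_sum_left_Basis) (auto simp: Basis_vec_eq)
      finally show ?thesis .
    qed
    then show ?thesis unfolding prod_Basis_vec by (simp add: axis_index_axis)
  qed
  show ?I
    unfolding lborel_eq[where 'a = "real ^ 'd"] integrable_distr_eq[OF mS mu] eq
    by (rule product_integrable_prod) (use u in auto)
  show "(LINT v|lborel. (\<Prod>i\<in>UNIV. u i (v $ i))) = (\<Prod>i\<in>UNIV. LINT y|lborel. u i y)"
    unfolding lborel_eq[where 'a = "real ^ 'd"] integral_distr[OF mS mu] eq
    by (subst product_integral_prod) (use u in \<open>auto simp: prod_Basis_vec axis_index_axis\<close>)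
qed

lemma nn_integral_path_prod:
  fixes u :: "nat \<times> 'd::finite \<Rightarrow> real \<Rightarrow> ennreal"
  assumes "\<And>p. u p \<in> borel_measurable borel"
  shows "(\<integral>\<^sup>+x. (\<Prod>p\<in>coords T. u p (coord x p)) \<partial>path_lebesgue T) = (\<Prod>p\<in>coords T. \<integral>\<^sup>+y. u p y \<partial>lborel)"
proof -
  interpret product_sigma_finite "\<lambda>_ :: nat. lborel :: (real ^ 'd) measure" ..
  have comp [measurable]: "(\<lambda>v :: real ^ 'd. v $ i) \<in> borel_measurable borel" for i
    by (intro borel_measurable_continuous_onI continuous_intros)
  note assms [measurable]
  show ?thesis
    unfolding prod_coords path_lebesgue_def fst_conv snd_conv
    by (subst product_nn_integral_prod; simp?)
       (intro prod.cong refl nn_integral_vec_prod[of "\<lambda>i. u (_, i)"] assms)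
qed

lemma integral_path_prod:
  fixes u :: "nat \<times> 'd::finite \<Rightarrow> real \<Rightarrow> real"
  assumes "\<And>p. p \<in> coords T \<Longrightarrow> integrable lborel (u p)"
  shows "integrable (path_lebesgue T) (\<lambda>x. \<Prod>p\<in>coords T. u p (coord x p))"
    and "(LINT x|path_lebesgue T. (\<Prod>p\<in>coords T. u p (coord x p))) = (\<Prod>p\<in>coords T. LINT y|lborel. u p y)"
proof -
  interpret product_sigma_finite "\<lambda>_ :: nat. lborel :: (real ^ 'd) measure" ..
  have u: "integrable lborel (u (t, i))" if "t \<in> {1..T}" for t i
    using assms that by (auto simp: coords_def)
  show "integrable (path_lebesgue T) (\<lambda>x. \<Prod>p\<in>coords T. u p (coord x p))"
    unfolding prod_coords path_lebesgue_def fst_conv snd_conv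
  proof (rule product_integrable_prod)
    fix t assume "t \<in> {1..T}"
    from integral_vec_prod(1)[of "\<lambda>i. u (t, i)", OF u[OF this]]
    show "integrable lborel (\<lambda>v :: real ^ 'd. \<Prod>i\<in>UNIV. u (t, i) (v $ i))" .
  qed simp
  have "(LINT x|path_lebesgue T. (\<Prod>p\<in>coords T. u p (coord x p)))
      = (\<Prod>t\<in>{1..T}. LINT v|(lborel :: (real ^ 'd) measure). (\<Prod>i\<in>UNIV. u (t, i) (v $ i)))"
    unfolding prod_coords path_lebesgue_def fst_conv snd_conv
  proof (rule product_integral_prod)
    fix t assume "t \<in> {1..T}"
    from integral_vec_prod(1)[of "\<lambda>i. u (t, i)", OF u[OF this]]
    show "integrable lborel (\<lambda>v :: real ^ 'd. \<Prod>i\<in>UNIV. u (t, i) (v $ i))" .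
  qed simp
  also have "\<dots> = (\<Prod>t\<in>{1..T}. \<Prod>i\<in>UNIV. LINT y|lborel. u (t, i) y)"
    by (intro prod.cong refl integral_vec_prod(2)[of "\<lambda>i. u (_, i)"] u)
  finally show "(LINT x|path_lebesgue T. (\<Prod>p\<in>coords T. u p (coord x p))) = (\<Prod>p\<in>coords T. LINT y|lborel. u p y)"
    unfolding prod_coords .
qed

type_synonym 'd windex = "(nat \<times> 'd \<Rightarrow> nat) \<times> (nat \<times> 'd \<Rightarrow> nat)"

text \<open>Contains \<open>Psi_index T j\<close> and also the pure scaling functions of level
  \<open>j\<close>, so both parts of a wavelet series are covered. Being a full product, it makes
  sums over types and translations factor over the coordinates; upper bounds may run over this
  larger set.\<close>

definition all_index :: "nat \<Rightarrow> nat \<Rightarrow> ('d::finite) windex set" where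
  "all_index T j = (coords T \<rightarrow>\<^sub>E {0, 1}) \<times> (coords T \<rightarrow>\<^sub>E {..<2 ^ j})"

lemma Phi_index_subset: "Phi_index T j \<subseteq> all_index T j"
  unfolding Phi_index_def all_index_def by auto

lemma Psi_index_subset: "Psi_index T j \<subseteq> all_index T j"
  unfolding Psi_index_def all_index_def by auto

lemma finite_all_index: "finite (all_index T j)"
  unfolding all_index_def by (intro finite_cartesian_product finite_PiE finite_coords) auto

lemma card_all_index:
  "card (all_index T j :: ('d::finite) windex set) = 2 ^ (CARD('d) * T) * 2 ^ (j * (CARD('d) * T))"
  unfolding all_index_def by (simp add: card_cartesian_product card_PiE finite_coords card_coords power_mult numeral_2_eq_2)

lemma unit_cube_coord: "x \<in> unit_cube T \<Longrightarrow> p \<in> coords T \<Longrightarrow> coord x p \<in> {0..1}"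
  by (simp add: unit_cube_def)

lemma unit_cube_space: "x \<in> unit_cube T \<Longrightarrow> x \<in> space (past_space T)"
  by (simp add: unit_cube_def path_space_eq_past_space)

text \<open>The indicator of the cube is distributed to the coordinates, so that a tensor wavelet is
  a product on the whole path space and Fubini applies without restricting the measure.\<close>

definition unit_factor :: "(nat \<Rightarrow> nat \<Rightarrow> real \<Rightarrow> real) \<Rightarrow> (nat \<Rightarrow> nat \<Rightarrow> real \<Rightarrow> real) \<Rightarrow> nat \<Rightarrow> nat \<Rightarrow> nat \<Rightarrow> real \<Rightarrow> real" where
  "unit_factor \<zeta> \<xi> j l m y = indicator {0..1} y * (if l = 0 then \<zeta> j m y else \<xi> j m y)"

lemma tensor_wavelet_outside: "x \<notin> unit_cube T \<Longrightarrow> tensor_wavelet T \<zeta> \<xi> j i x = 0"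
  by (cases i) (simp add: tensor_wavelet_def)

lemma tensor_wavelet_factor:
  assumes "x \<in> space (past_space T)"
  shows "tensor_wavelet T \<zeta> \<xi> j (l, m) x = (\<Prod>p\<in>coords T. unit_factor \<zeta> \<xi> j (l p) (m p) (coord x p))"
proof (cases "x \<in> unit_cube T")
  case True
  then have "indicator {0..1} (coord x p) = (1 :: real)" if "p \<in> coords T" for p
    using unit_cube_coord[OF True that] by (simp only: indicator_simps)
  with True show ?thesis unfolding tensor_wavelet_def unit_factor_def by (auto intro!: prod.cong)
next
  case False
  with assms obtain p where "p \<in> coords T" "coord x p \<notin> {0..1}"
    unfolding unit_cube_def path_space_eq_past_space by blast
  then have "(\<Prod>p\<in>coords T. unit_factor \<zeta> \<xi> j (l p) (m p) (coord x p)) = 0"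
    by (intro prod_zero finite_coords) (auto simp: unit_factor_def indicator_def)
  then show ?thesis using tensor_wavelet_outside[OF False] by simp
qed

context
  fixes N j0 :: nat and \<zeta> \<xi> :: "nat \<Rightarrow> nat \<Rightarrow> real \<Rightarrow> real"
  assumes N: "N \<ge> 2" and j0: "real j0 \<ge> log 2 (real N)" and cdv: "cdv_system N j0 \<zeta> \<xi>"
begin

lemma factor_continuous:
  assumes "j \<ge> j0" "m < 2 ^ j"
  shows "continuous_on {0..1} (\<lambda>y. if l = (0 :: nat) then \<zeta> j m y else \<xi> j m y)"
  using cdv_continuous[OF N j0 cdv assms] by (cases "l = 0") simp_all

lemma unit_factor_measurable:
  assumes "j \<ge> j0" "m < 2 ^ j" shows "unit_factor \<zeta> \<xi> j l m \<in> borel_measurable borel"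
  using borel_measurable_continuous_on_indicator[OF _ factor_continuous[OF assms, of l]]
  by (simp add: unit_factor_def[abs_def])

lemma integrable_unit_factor:
  assumes "j \<ge> j0" "m < 2 ^ j"
  shows "integrable lborel (unit_factor \<zeta> \<xi> j l m)" "integrable lborel (\<lambda>y. (unit_factor \<zeta> \<xi> j l m y)\<^sup>2)"
proof -
  show "integrable lborel (unit_factor \<zeta> \<xi> j l m)"
    using borel_integrable_compact[OF compact_Icc factor_continuous[OF assms, of l]]
    by (simp add: unit_factor_def[abs_def])
  have "(unit_factor \<zeta> \<xi> j l m y)\<^sup>2 = indicator {0..1} y *\<^sub>R (if l = 0 then \<zeta> j m y else \<xi> j m y)\<^sup>2" for y
    by (simp add: unit_factor_def indicator_def)
  then show "integrable lborel (\<lambda>y. (unit_factor \<zeta> \<xi> j l m y)\<^sup>2)"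
    using borel_integrable_compact[OF compact_Icc continuous_on_power[OF factor_continuous[OF assms, of l], of 2]]
    by (simp only:)
qed

lemma integral_unit_factor:
  assumes "j \<ge> j0" "m < 2 ^ j"
  shows "(LINT y|lborel. unit_factor \<zeta> \<xi> j l m y) = (if l = 0 then (LINT y|unit_lborel. \<zeta> j m y) else 0)"
    and "(LINT y|lborel. (unit_factor \<zeta> \<xi> j l m y)\<^sup>2) = 1"
proof -
  have r: "(LINT y|unit_lborel. g y) = (LINT y|lborel. indicator {0..1} y * g y)" for g :: "real \<Rightarrow> real"
    by (subst integral_restrict_space) auto
  show "(LINT y|lborel. unit_factor \<zeta> \<xi> j l m y) = (if l = 0 then (LINT y|unit_lborel. \<zeta> j m y) else 0)"
    using cdv_constant(2)[OF N j0 cdv assms] by (simp add: unit_factor_def r)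
  have "(unit_factor \<zeta> \<xi> j l m y)\<^sup>2 = indicator {0..1} y * (if l = 0 then \<zeta> j m y else \<xi> j m y)\<^sup>2" for y
    by (simp add: unit_factor_def indicator_def)
  then show "(LINT y|lborel. (unit_factor \<zeta> \<xi> j l m y)\<^sup>2) = 1"
    using cdv_integral_square[OF N j0 cdv assms] by (cases "l = 0") (simp_all add: r)
qed

context
  fixes T j :: nat and i :: "('d::finite) windex"
  assumes j: "j \<ge> j0" and i: "i \<in> all_index T j"
begin

lemma index_bound: "p \<in> coords T \<Longrightarrow> snd i p < 2 ^ j"
  using i by (auto simp: all_index_def)

lemma measurable_tensor_wavelet: "tensor_wavelet T \<zeta> \<xi> j i \<in> borel_measurable (past_space T)"
proof -
  have "(\<lambda>x. \<Prod>p\<in>coords T. unit_factor \<zeta> \<xi> j (fst i p) (snd i p) (coord x p)) \<in> borel_measurable (past_space T)"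
    by (intro borel_measurable_prod measurable_compose[OF measurable_coord unit_factor_measurable[OF j index_bound]])
  then show ?thesis
    by (rule measurable_cong[THEN iffD2, rotated]) (cases i, simp add: tensor_wavelet_factor)
qed

lemma tensor_wavelet_integrals:
  shows "integrable (path_lebesgue T) (tensor_wavelet T \<zeta> \<xi> j i)"
    "integrable (path_lebesgue T) (\<lambda>x. (tensor_wavelet T \<zeta> \<xi> j i x)\<^sup>2)"
    "(LINT x|path_lebesgue T. tensor_wavelet T \<zeta> \<xi> j i x) =
       (\<Prod>p\<in>coords T. if fst i p = 0 then (LINT y|unit_lborel. \<zeta> j (snd i p) y) else 0)"
    "(LINT x|path_lebesgue T. (tensor_wavelet T \<zeta> \<xi> j i x)\<^sup>2) = 1"
proof -
  let ?u = "\<lambda>p. unit_factor \<zeta> \<xi> j (fst i p) (snd i p)"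
  have eq: "tensor_wavelet T \<zeta> \<xi> j i x = (\<Prod>p\<in>coords T. ?u p (coord x p))" if "x \<in> space (path_lebesgue T)" for x
    using tensor_wavelet_factor[of x T \<zeta> \<xi> j "fst i" "snd i"] that by (simp add: space_path_lebesgue)
  have eq2: "(tensor_wavelet T \<zeta> \<xi> j i x)\<^sup>2 = (\<Prod>p\<in>coords T. (?u p (coord x p))\<^sup>2)" if "x \<in> space (path_lebesgue T)" for x
    unfolding eq[OF that] by (simp add: prod_power_distrib)
  have u1: "integrable lborel (?u p)" and u2: "integrable lborel (\<lambda>y. (?u p y)\<^sup>2)" if "p \<in> coords T" for p
    using integrable_unit_factor[OF j index_bound[OF that]] by auto
  have P1: "integrable (path_lebesgue T) (\<lambda>x. \<Prod>p\<in>coords T. ?u p (coord x p))"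
      "(LINT x|path_lebesgue T. (\<Prod>p\<in>coords T. ?u p (coord x p))) = (\<Prod>p\<in>coords T. LINT y|lborel. ?u p y)"
    using integral_path_prod[of T ?u] u1 by blast+
  have P2: "integrable (path_lebesgue T) (\<lambda>x. \<Prod>p\<in>coords T. (?u p (coord x p))\<^sup>2)"
      "(LINT x|path_lebesgue T. (\<Prod>p\<in>coords T. (?u p (coord x p))\<^sup>2)) = (\<Prod>p\<in>coords T. LINT y|lborel. (?u p y)\<^sup>2)"
    using integral_path_prod[of T "\<lambda>p y. (?u p y)\<^sup>2"] u2 by blast+
  show "integrable (path_lebesgue T) (tensor_wavelet T \<zeta> \<xi> j i)"
    by (rule Bochner_Integration.integrable_cong[THEN iffD2, OF refl _ P1(1)]) (rule eq)
  show "integrable (path_lebesgue T) (\<lambda>x. (tensor_wavelet T \<zeta> \<xi> j i x)\<^sup>2)"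
    by (rule Bochner_Integration.integrable_cong[THEN iffD2, OF refl _ P2(1)]) (rule eq2)
  have "(LINT x|path_lebesgue T. tensor_wavelet T \<zeta> \<xi> j i x) = (\<Prod>p\<in>coords T. LINT y|lborel. ?u p y)"
    unfolding P1(2)[symmetric] by (rule Bochner_Integration.integral_cong[OF refl eq])
  also have "\<dots> = (\<Prod>p\<in>coords T. if fst i p = 0 then (LINT y|unit_lborel. \<zeta> j (snd i p) y) else 0)"
    by (intro prod.cong refl integral_unit_factor[OF j index_bound])
  finally show "(LINT x|path_lebesgue T. tensor_wavelet T \<zeta> \<xi> j i x) =
       (\<Prod>p\<in>coords T. if fst i p = 0 then (LINT y|unit_lborel. \<zeta> j (snd i p) y) else 0)" .
  have "(LINT x|path_lebesgue T. (tensor_wavelet T \<zeta> \<xi> j i x)\<^sup>2) = (\<Prod>p\<in>coords T. LINT y|lborel. (?u p y)\<^sup>2)"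
    unfolding P2(2)[symmetric] by (rule Bochner_Integration.integral_cong[OF refl eq2])
  also have "\<dots> = 1" 
    by (rule prod.neutral) (simp add: integral_unit_factor[OF j index_bound])
  finally show "(LINT x|path_lebesgue T. (tensor_wavelet T \<zeta> \<xi> j i x)\<^sup>2) = 1" .
qed

lemma tensor_wavelet_tendsto:
  assumes y: "\<And>k :: nat. y k \<in> unit_cube T" and x: "x \<in> unit_cube T"
    and lim: "\<And>p. p \<in> coords T \<Longrightarrow> (\<lambda>k. coord (y k) p) \<longlonglongrightarrow> coord x p"
  shows "(\<lambda>k. tensor_wavelet T \<zeta> \<xi> j i (y k)) \<longlonglongrightarrow> tensor_wavelet T \<zeta> \<xi> j i x"
proof -
  let ?g = "\<lambda>p z. if fst i p = 0 then \<zeta> j (snd i p) z else \<xi> j (snd i p) z"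
  have e: "tensor_wavelet T \<zeta> \<xi> j i z = (\<Prod>p\<in>coords T. ?g p (coord z p))" if "z \<in> unit_cube T" for z
    using that by (simp add: tensor_wavelet_def split_beta)
  have "(\<lambda>k. \<Prod>p\<in>coords T. ?g p (coord (y k) p)) \<longlonglongrightarrow> (\<Prod>p\<in>coords T. ?g p (coord x p))"
  proof (rule tendsto_prod)
    fix p :: "nat \<times> 'd" assume p: "p \<in> coords T"
    have "eventually (\<lambda>k. coord (y k) p \<in> {0..1}) sequentially"
      using unit_cube_coord[OF y p] by (intro always_eventually allI)
    from continuous_on_tendsto_compose[OF factor_continuous[OF j index_bound[OF p], of "fst i p"] lim[OF p] unit_cube_coord[OF x p] this]
    show "(\<lambda>k. ?g p (coord (y k) p)) \<longlonglongrightarrow> ?g p (coord x p)" .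
  qed
  then show ?thesis using e[OF y] e[OF x] by simp
qed

end

text \<open>The sum over types and translations is a product over coordinates of one-dimensional
  sums; the factor 2 C collects the two types in each coordinate. By locality the order is 2^(jD/2),
  although 2^(jD) translations occur.\<close>

lemma tensor_sum_bound:
  "\<exists>C>0. \<forall>j\<ge>j0. \<forall>x. (\<Sum>i\<in>(all_index T j :: ('d::finite) windex set).
      \<bar>tensor_wavelet T \<zeta> \<xi> j i x\<bar>) \<le> C * 2 powr (real j * real (CARD('d) * T) / 2)"
proof -
  obtain C where "C > 0" and C: "\<forall>j\<ge>j0. \<forall>x\<in>{0..1}. (\<Sum>m<2 ^ j. \<bar>\<zeta> j m x\<bar>) \<le> C * 2 powr (real j / 2) \<and>
                   (\<Sum>m<2 ^ j. \<bar>\<xi> j m x\<bar>) \<le> C * 2 powr (real j / 2)"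
    using cdv_sum_bound[OF N j0 cdv] by blast
  let ?D = "CARD('d) * T"
  have "(\<Sum>i\<in>(all_index T j :: 'd windex set). \<bar>tensor_wavelet T \<zeta> \<xi> j i x\<bar>)
      \<le> (2 * C) ^ ?D * 2 powr (real j * real ?D / 2)" if j: "j \<ge> j0" for j and x :: "'d path"
  proof (cases "x \<in> unit_cube T")
    case False
    then show ?thesis using \<open>C > 0\<close> by (simp add: tensor_wavelet_outside)
  next
    case True
    let ?g = "\<lambda>p (l :: nat) m. \<bar>if l = 0 then \<zeta> j m (coord x p) else \<xi> j m (coord x p)\<bar>"
    have "(\<Sum>i\<in>(all_index T j :: 'd windex set). \<bar>tensor_wavelet T \<zeta> \<xi> j i x\<bar>)
       = (\<Sum>l\<in>coords T \<rightarrow>\<^sub>E {0, 1}. \<Sum>m\<in>coords T \<rightarrow>\<^sub>E {..<2 ^ j}. \<Prod>p\<in>coords T. ?g p (l p) (m p))"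
      using True unfolding all_index_def sum.cartesian_product
      by (intro sum.cong refl) (auto simp: tensor_wavelet_def abs_prod)
    also have "\<dots> = (\<Sum>l\<in>coords T \<rightarrow>\<^sub>E {0, 1}. \<Prod>p\<in>coords T. \<Sum>m<2 ^ j. ?g p (l p) m)"
      by (intro sum.cong refl prod_sum_PiE[symmetric] finite_coords) auto
    also have "\<dots> = (\<Prod>p\<in>coords T. \<Sum>l\<in>{0, 1}. \<Sum>m<2 ^ j. ?g p l m)"
      by (intro prod_sum_PiE[symmetric] finite_coords) auto
    also have "\<dots> \<le> (\<Prod>p\<in>(coords T :: (nat \<times> 'd) set). 2 * (C * 2 powr (real j / 2)))"
    proof (intro prod_mono conjI sum_nonneg)
      fix p :: "nat \<times> 'd" assume p: "p \<in> coords T"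
      show "(\<Sum>l\<in>{0, 1}. \<Sum>m<2 ^ j. ?g p l m) \<le> 2 * (C * 2 powr (real j / 2))"
        using C[rule_format, OF j unit_cube_coord[OF True p]] by simp
    qed auto
    also have "\<dots> = (2 * C * 2 powr (real j / 2)) ^ ?D" by (simp add: card_coords mult.assoc)
    also have "\<dots> = (2 * C) ^ ?D * 2 powr (real j * real ?D / 2)"
      unfolding power_mult_distrib[of "2 * C"] powr_power[of 2 "real j / 2", simplified]
      by (simp add: mult_ac)
    finally show ?thesis .
  qed
  then show ?thesis using \<open>C > 0\<close> by (intro exI[of _ "(2 * C) ^ ?D"]) auto
qed

text \<open>Tensorised reproduction of the constant 1: distributing the product over the sums
  reduces it to one dimension. Applied at the sample points, it gives the estimator mass
  one.\<close>

lemma Phi_partition_of_unity: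
  assumes x: "x \<in> (unit_cube T :: ('d::finite) path set)"
  shows "(\<Sum>i\<in>Phi_index T j0. (LINT y|path_lebesgue T. tensor_wavelet T \<zeta> \<xi> j0 i y) * tensor_wavelet T \<zeta> \<xi> j0 i x) = 1"
proof -
  let ?c = "\<lambda>m. LINT y|unit_lborel. \<zeta> j0 m y"
  have "(\<Sum>i\<in>Phi_index T j0. (LINT y|path_lebesgue T. tensor_wavelet T \<zeta> \<xi> j0 i y) * tensor_wavelet T \<zeta> \<xi> j0 i x)
     = (\<Sum>i\<in>Phi_index T j0. \<Prod>p\<in>coords T. ?c (snd i p) * \<zeta> j0 (snd i p) (coord x p))"
  proof (rule sum.cong[OF refl])
    fix i :: "'d windex" assume i: "i \<in> Phi_index T j0"
    then have z: "fst i p = 0" if "p \<in> coords T" for p using that by (auto simp: Phi_index_def)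
    have "(LINT y|path_lebesgue T. tensor_wavelet T \<zeta> \<xi> j0 i y) = (\<Prod>p\<in>coords T. ?c (snd i p))"
      using i Phi_index_subset by (subst tensor_wavelet_integrals(3)) (auto simp: z)
    moreover have "tensor_wavelet T \<zeta> \<xi> j0 i x = (\<Prod>p\<in>coords T. \<zeta> j0 (snd i p) (coord x p))"
      using x z by (simp add: tensor_wavelet_def split_beta)
    ultimately show "(LINT y|path_lebesgue T. tensor_wavelet T \<zeta> \<xi> j0 i y) * tensor_wavelet T \<zeta> \<xi> j0 i x
      = (\<Prod>p\<in>coords T. ?c (snd i p) * \<zeta> j0 (snd i p) (coord x p))"
      by (simp add: prod.distrib)
  qed
  also have "\<dots> = (\<Sum>m\<in>coords T \<rightarrow>\<^sub>E {..<2 ^ j0}. \<Prod>p\<in>coords T. ?c (m p) * \<zeta> j0 (m p) (coord x p))"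
    unfolding Phi_index_def
    by (rule sum.reindex_bij_witness[of _ "\<lambda>m. (\<lambda>p\<in>coords T. 0, m)" snd]) auto
  also have "\<dots> = (\<Prod>p\<in>coords T. \<Sum>m<2 ^ j0. ?c m * \<zeta> j0 m (coord x p))"
    by (intro prod_sum_PiE[symmetric] finite_coords) auto
  also have "\<dots> = 1"
    by (rule prod.neutral) (use cdv_constant(1)[OF N j0 cdv] unit_cube_coord[OF x] in blast)
  finally show ?thesis .
qed

text \<open>A non-zero type has a coordinate carrying a wavelet factor, whose integral
  vanishes.\<close>

lemma Psi_integral_zero:
  assumes j: "j \<ge> j0" and i: "i \<in> (Psi_index T j :: ('d::finite) windex set)"
  shows "(LINT y|path_lebesgue T. tensor_wavelet T \<zeta> \<xi> j i y) = 0"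
proof -
  have "fst i \<in> coords T \<rightarrow>\<^sub>E {0, 1}" "fst i \<noteq> (\<lambda>p\<in>coords T. 0)" using i by (simp_all add: Psi_index_def mem_Times_iff)
  then obtain p where "p \<in> coords T" "fst i p \<noteq> 0"
    using extensionalityI[of "fst i" "coords T" "\<lambda>p\<in>coords T. 0"] by (auto simp: PiE_def)
  moreover have "i \<in> all_index T j" using i Psi_index_subset by blast
  ultimately show ?thesis
    using j by (subst tensor_wavelet_integrals(3), simp, simp) (rule prod_zero[OF finite_coords], rule bexI[of _ p], simp_all)
qed

end

section \<open>Wavelet series and the approximation error\<close>

text \<open>For q \<le> 1/2 each term q^j is at most q^(j-1) - q^j, so the sum telescopes; keeping
  the subtracted end term makes the induction go through.\<close>

lemma sum_geometric_tail:
  fixes q :: real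
  assumes "0 \<le> q" "q \<le> 1 / 2"
  shows "(\<Sum>j\<in>{J<..J + n}. q ^ j) \<le> q ^ J - q ^ (J + n)"
proof (induction n)
  case (Suc n)
  have "{J<..J + Suc n} = insert (J + Suc n) {J<..J + n}" by auto
  moreover have "2 * q ^ (J + Suc n) \<le> q ^ (J + n)"
    using assms mult_right_mono[OF assms(2), of "q ^ (J + n)"] by simp
  ultimately show ?case using Suc by simp
qed simp

lemma sum_geometric_head:
  fixes r :: real
  assumes "r \<ge> 2"
  shows "(\<Sum>j\<in>{..J}. r ^ j) \<le> 2 * r ^ J"
proof (induction J)
  case (Suc J)
  have "2 * r ^ J \<le> r ^ Suc J" using assms mult_right_mono[OF assms, of "r ^ J"] by simp
  then show ?case using Suc by simp
qed simp

lemma unit_cube_Int_space: "unit_cube T \<inter> space (path_lebesgue T) = unit_cube T"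
  unfolding space_path_lebesgue using unit_cube_space by blast

lemma sets_unit_cube_lebesgue: "unit_cube T \<inter> space (path_lebesgue T) \<in> sets (path_lebesgue T)"
  unfolding unit_cube_Int_space sets_path_lebesgue by (rule sets_unit_cube)

lemma AE_cube_lebesgue:
  "(AE x in cube_lebesgue T. P x) \<longleftrightarrow> (AE x in path_lebesgue T. x \<in> unit_cube T \<longrightarrow> P x)"
  unfolding cube_lebesgue_def
  by (rule AE_restrict_space_iff[OF sets_unit_cube_lebesgue])

lemma integral_cube_lebesgue:
  fixes g :: "('d::finite) path \<Rightarrow> real"
  shows "(LINT x|cube_lebesgue T. g x) = (LINT x|path_lebesgue T. indicator (unit_cube T) x * g x)"
  unfolding cube_lebesgue_def
  by (subst integral_restrict_space[OF sets_unit_cube_lebesgue]) simp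

text \<open>Together with the continuity of the wavelets this upgrades almost sure bounds on a finite wavelet
  series to bounds at every point of the cube, as required by the definition of the estimator.\<close>

lemma AE_dense_sequence:
  fixes x :: "('d::finite) path"
  assumes P: "AE y in cube_lebesgue T. P y" and x: "x \<in> unit_cube T"
  shows "\<exists>y. (\<forall>k :: nat. y k \<in> unit_cube T \<and> P (y k)) \<and> (\<forall>p\<in>coords T. (\<lambda>k. coord (y k) p) \<longlonglongrightarrow> coord x p)"
proof -
  \<comment> \<open>Clipping to [0, 1] keeps the boxes inside the cube; their sides stay positive
    even if \<open>x\<close> lies on the boundary, so no box can consist of exceptional points
    only.\<close>
  let ?S = "\<lambda>k p. {max 0 (coord x p - 1 / real (Suc k))..min 1 (coord x p + 1 / real (Suc k))}"
  have "\<exists>y. y \<in> unit_cube T \<and> P y \<and> (\<forall>p\<in>coords T. coord y p \<in> ?S k p)" for k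
  proof (rule ccontr)
    assume none: "\<nexists>y. y \<in> unit_cube T \<and> P y \<and> (\<forall>p\<in>coords T. coord y p \<in> ?S k p)"
    have "AE y in path_lebesgue T. (\<Prod>p\<in>coords T. indicator (?S k p) (coord y p) :: ennreal) = 0"
      using P[unfolded AE_cube_lebesgue] AE_space
    proof eventually_elim
      case (elim y)
      show ?case
      proof (cases "\<forall>p\<in>coords T. coord y p \<in> ?S k p")
        case True
        then have "y \<in> unit_cube T" using elim(2)
          by (auto simp: unit_cube_def path_space_eq_past_space space_path_lebesgue)
        with True none elim(1) show ?thesis by blast
      next
        case False
        then obtain p where p: "p \<in> coords T" "coord y p \<notin> ?S k p" by blast
        show ?thesis
          by (rule prod_zero[OF finite_coords], rule bexI[OF _ p(1)]) (rule indicator_simps(2)[OF p(2)])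
      qed
    qed
    then have "(\<integral>\<^sup>+y. (\<Prod>p\<in>coords T. indicator (?S k p) (coord y p)) \<partial>path_lebesgue T) = (\<integral>\<^sup>+y. 0 \<partial>(path_lebesgue T :: 'd path measure))"
      by (rule nn_integral_cong_AE)
    then have "(\<Prod>p\<in>coords T. \<integral>\<^sup>+z. indicator (?S k p) z \<partial>lborel) = 0"
      by (subst (asm) nn_integral_path_prod[of "\<lambda>p z. indicator (?S k p) z"]) simp_all
    then obtain p where p: "p \<in> coords T" "emeasure lborel (?S k p) = 0"
      using finite_coords by (auto simp: prod_zero_iff)
    have "0 \<le> coord x p" "coord x p \<le> 1" using unit_cube_coord[OF x p(1)] by auto
    moreover have "0 < 1 / real (Suc k)" by simp
    ultimately have lt: "max 0 (coord x p - 1 / real (Suc k)) < min 1 (coord x p + 1 / real (Suc k))" by linarith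
    show False
      using p(2) lt unfolding emeasure_lborel_Icc[OF less_imp_le[OF lt]] ennreal_eq_0_iff by linarith
  qed
  then obtain y where y: "\<And>k. y k \<in> unit_cube T" "\<And>k. P (y k)" "\<And>k p. p \<in> coords T \<Longrightarrow> coord (y k) p \<in> ?S k p"
    by metis
  have "(\<lambda>k. coord (y k) p) \<longlonglongrightarrow> coord x p" if p: "p \<in> coords T" for p
  proof (rule tendsto_sandwich)
    show "eventually (\<lambda>k. coord x p - 1 / real (Suc k) \<le> coord (y k) p) sequentially"
      using y(3)[OF p] by (intro always_eventually allI) auto
    show "eventually (\<lambda>k. coord (y k) p \<le> coord x p + 1 / real (Suc k)) sequentially"
      using y(3)[OF p] by (intro always_eventually allI) auto
    show "(\<lambda>k. coord x p - 1 / real (Suc k)) \<longlonglongrightarrow> coord x p"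
      using tendsto_diff[OF tendsto_const LIMSEQ_Suc[OF lim_1_over_n]] by simp
    show "(\<lambda>k. coord x p + 1 / real (Suc k)) \<longlonglongrightarrow> coord x p"
      using tendsto_add[OF tendsto_const LIMSEQ_Suc[OF lim_1_over_n]] by simp
  qed
  with y(1,2) show ?thesis by blast
qed

lemma wavelet_sum_outside: "x \<notin> unit_cube T \<Longrightarrow> wavelet_sum T j0 \<zeta> \<xi> L J x = 0"
  by (simp add: wavelet_sum_def tensor_wavelet_outside)

context
  fixes N j0 :: nat and \<zeta> \<xi> :: "nat \<Rightarrow> nat \<Rightarrow> real \<Rightarrow> real"
  assumes N: "N \<ge> 2" and j0: "real j0 \<ge> log 2 (real N)" and cdv: "cdv_system N j0 \<zeta> \<xi>"
begin

lemmas Phi_all = Phi_index_subset[THEN subsetD] and Psi_all = Psi_index_subset[THEN subsetD]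

lemma measurable_wavelet_sum: "wavelet_sum T j0 \<zeta> \<xi> L J \<in> borel_measurable (past_space T)"
  unfolding wavelet_sum_def[abs_def]
  by (intro borel_measurable_add borel_measurable_sum borel_measurable_times borel_measurable_const
      measurable_tensor_wavelet[OF N j0 cdv order_refl Phi_all] measurable_tensor_wavelet[OF N j0 cdv _ Psi_all]) auto

lemma integral_wavelet_sum:
  fixes L :: "(('d::finite) path \<Rightarrow> real) \<Rightarrow> real"
  shows "integrable (path_lebesgue T) (wavelet_sum T j0 \<zeta> \<xi> L J)"
    "(LINT x|path_lebesgue T. wavelet_sum T j0 \<zeta> \<xi> L J x) =
     (\<Sum>i\<in>Phi_index T j0. L (tensor_wavelet T \<zeta> \<xi> j0 i) * (LINT x|path_lebesgue T. tensor_wavelet T \<zeta> \<xi> j0 i x))"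
proof -
  have i1: "integrable (path_lebesgue T) (\<lambda>x. L (tensor_wavelet T \<zeta> \<xi> j0 i) * tensor_wavelet T \<zeta> \<xi> j0 i x)"
    if "i \<in> Phi_index T j0" for i
    using tensor_wavelet_integrals(1)[OF N j0 cdv order_refl Phi_all[OF that]] by (rule integrable_mult_right)
  have i2: "integrable (path_lebesgue T) (\<lambda>x. L (tensor_wavelet T \<zeta> \<xi> j i) * tensor_wavelet T \<zeta> \<xi> j i x)"
    if "j \<in> {j0..J}" "i \<in> Psi_index T j" for i j
    using that by (intro integrable_mult_right tensor_wavelet_integrals(1)[OF N j0 cdv _ Psi_all]) auto
  have i3: "integrable (path_lebesgue T) (\<lambda>x. \<Sum>i\<in>Phi_index T j0. L (tensor_wavelet T \<zeta> \<xi> j0 i) * tensor_wavelet T \<zeta> \<xi> j0 i x)"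
    by (intro Bochner_Integration.integrable_sum i1)
  have i4: "integrable (path_lebesgue T) (\<lambda>x. \<Sum>i\<in>Psi_index T j. L (tensor_wavelet T \<zeta> \<xi> j i) * tensor_wavelet T \<zeta> \<xi> j i x)"
    if "j \<in> {j0..J}" for j
    by (intro Bochner_Integration.integrable_sum i2 that)
  have i5: "integrable (path_lebesgue T) (\<lambda>x. \<Sum>j=j0..J. \<Sum>i\<in>Psi_index T j. L (tensor_wavelet T \<zeta> \<xi> j i) * tensor_wavelet T \<zeta> \<xi> j i x)"
    by (intro Bochner_Integration.integrable_sum i4)
  show "integrable (path_lebesgue T) (wavelet_sum T j0 \<zeta> \<xi> L J)"
    unfolding wavelet_sum_def[abs_def] by (intro Bochner_Integration.integrable_add i3 i5)
  have "(LINT x|path_lebesgue T. wavelet_sum T j0 \<zeta> \<xi> L J x) =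
     (LINT x|path_lebesgue T. (\<Sum>i\<in>Phi_index T j0. L (tensor_wavelet T \<zeta> \<xi> j0 i) * tensor_wavelet T \<zeta> \<xi> j0 i x)) +
     (LINT x|path_lebesgue T. (\<Sum>j=j0..J. \<Sum>i\<in>Psi_index T j. L (tensor_wavelet T \<zeta> \<xi> j i) * tensor_wavelet T \<zeta> \<xi> j i x))"
    unfolding wavelet_sum_def by (rule Bochner_Integration.integral_add[OF i3 i5])
  also have "(LINT x|path_lebesgue T. (\<Sum>j=j0..J. \<Sum>i\<in>Psi_index T j. L (tensor_wavelet T \<zeta> \<xi> j i) * tensor_wavelet T \<zeta> \<xi> j i x))
    = (\<Sum>j=j0..J. \<Sum>i\<in>Psi_index T j. L (tensor_wavelet T \<zeta> \<xi> j i) * (LINT x|path_lebesgue T. tensor_wavelet T \<zeta> \<xi> j i x))"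
    by (subst Bochner_Integration.integral_sum[OF i4], assumption, intro sum.cong refl,
        subst Bochner_Integration.integral_sum[OF i2]) auto
  also have "\<dots> = 0"
    by (intro sum.neutral ballI) (simp add: Psi_integral_zero[OF N j0 cdv])
  also have "(LINT x|path_lebesgue T. (\<Sum>i\<in>Phi_index T j0. L (tensor_wavelet T \<zeta> \<xi> j0 i) * tensor_wavelet T \<zeta> \<xi> j0 i x))
    = (\<Sum>i\<in>Phi_index T j0. L (tensor_wavelet T \<zeta> \<xi> j0 i) * (LINT x|path_lebesgue T. tensor_wavelet T \<zeta> \<xi> j0 i x))"
    by (subst Bochner_Integration.integral_sum[OF i1]) auto
  finally show "(LINT x|path_lebesgue T. wavelet_sum T j0 \<zeta> \<xi> L J x) =
     (\<Sum>i\<in>Phi_index T j0. L (tensor_wavelet T \<zeta> \<xi> j0 i) * (LINT x|path_lebesgue T. tensor_wavelet T \<zeta> \<xi> j0 i x))"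
    by simp
qed

lemma wavelet_sum_tendsto:
  assumes y: "\<And>k :: nat. y k \<in> unit_cube T" and x: "x \<in> unit_cube T"
    and lim: "\<And>p. p \<in> coords T \<Longrightarrow> (\<lambda>k. coord (y k) p) \<longlonglongrightarrow> coord x p"
  shows "(\<lambda>k. wavelet_sum T j0 \<zeta> \<xi> L J (y k)) \<longlonglongrightarrow> wavelet_sum T j0 \<zeta> \<xi> L J x"
  unfolding wavelet_sum_def
  by (intro tendsto_add tendsto_sum tendsto_mult_left
      tensor_wavelet_tendsto[OF N j0 cdv order_refl Phi_all y x lim] tensor_wavelet_tendsto[OF N j0 cdv _ Psi_all y x lim]) auto

text \<open>Good points accumulate at \<open>x\<close>, and the finite series is continuous along
  them. It is applied with c = 0, so that the sign test of the estimator succeeds at every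
  point.\<close>

lemma wavelet_sum_ge_everywhere:
  assumes "AE y in cube_lebesgue T. c \<le> wavelet_sum T j0 \<zeta> \<xi> L J y" and x: "x \<in> unit_cube T"
  shows "c \<le> wavelet_sum T j0 \<zeta> \<xi> L J x"
proof -
  obtain y where y: "\<And>k :: nat. y k \<in> unit_cube T" "\<And>k. c \<le> wavelet_sum T j0 \<zeta> \<xi> L J (y k)"
    and lim: "\<And>p. p \<in> coords T \<Longrightarrow> (\<lambda>k. coord (y k) p) \<longlonglongrightarrow> coord x p"
    using AE_dense_sequence[OF assms] by blast
  from wavelet_sum_tendsto[OF y(1) x lim, of L J] y(2) show ?thesis
    by (intro LIMSEQ_le_const) auto
qed

text \<open>A coefficient error \<open>\<tau>\<close> costs at most \<open>\<tau>\<close> C r^j on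
  level j. As r \<ge> 2, the sum over the levels is at most twice the contribution of the last one;
  the scaling functions add one more, whence the factor 3.\<close>

lemma wavelet_sum_diff_bound:
  fixes L L' :: "(('d::finite) path \<Rightarrow> real) \<Rightarrow> real"
  assumes D: "CARD('d) * T \<ge> 2" and J: "J \<ge> j0" and \<tau>: "\<tau> \<ge> 0"
    and C: "C \<ge> 0" "\<And>j x. j \<ge> j0 \<Longrightarrow> (\<Sum>i\<in>(all_index T j :: 'd windex set).
      \<bar>tensor_wavelet T \<zeta> \<xi> j i x\<bar>) \<le> C * 2 powr (real j * real (CARD('d) * T) / 2)"
    and close: "\<And>j i. j \<in> {j0..J} \<Longrightarrow> i \<in> all_index T j \<Longrightarrow>
      \<bar>L (tensor_wavelet T \<zeta> \<xi> j i) - L' (tensor_wavelet T \<zeta> \<xi> j i)\<bar> \<le> \<tau>"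
  shows "\<bar>wavelet_sum T j0 \<zeta> \<xi> L J x - wavelet_sum T j0 \<zeta> \<xi> L' J x\<bar>
    \<le> 3 * C * \<tau> * 2 powr (real J * real (CARD('d) * T) / 2)"
proof -
  let ?t = "tensor_wavelet T \<zeta> \<xi>"
  define r where "r = 2 powr (real (CARD('d) * T) / 2)"
  have rj: "2 powr (real j * real (CARD('d) * T) / 2) = r ^ j" for j
    unfolding r_def by (simp add: powr_realpow[symmetric] powr_powr mult_ac)
  have "2 powr 1 \<le> r" unfolding r_def using D by (intro powr_mono) linarith+
  then have r: "r \<ge> 2" by simp
  have lev: "\<bar>\<Sum>i\<in>I. L (?t j i) * ?t j i x - L' (?t j i) * ?t j i x\<bar> \<le> \<tau> * (C * r ^ j)"
    if j: "j \<in> {j0..J}" and I: "I \<subseteq> all_index T j" for j and I :: "'d windex set"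
  proof -
    have "\<bar>\<Sum>i\<in>I. L (?t j i) * ?t j i x - L' (?t j i) * ?t j i x\<bar> \<le> (\<Sum>i\<in>I. \<tau> * \<bar>?t j i x\<bar>)"
      using close[OF j] I
      by (intro order.trans[OF sum_abs] sum_mono)
         (auto simp: left_diff_distrib[symmetric] abs_mult intro!: mult_right_mono)
    also have "\<dots> \<le> (\<Sum>i\<in>all_index T j. \<tau> * \<bar>?t j i x\<bar>)"
      using I \<tau> by (intro sum_mono2 finite_all_index) auto
    also have "\<dots> \<le> \<tau> * (C * r ^ j)"
      unfolding sum_distrib_left[symmetric] rj[symmetric] using \<tau> j by (intro mult_left_mono C(2)) auto
    finally show ?thesis .
  qed
  have eq: "wavelet_sum T j0 \<zeta> \<xi> L J x - wavelet_sum T j0 \<zeta> \<xi> L' J x =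
    (\<Sum>i\<in>Phi_index T j0. L (?t j0 i) * ?t j0 i x - L' (?t j0 i) * ?t j0 i x) +
    (\<Sum>j=j0..J. \<Sum>i\<in>Psi_index T j. L (?t j i) * ?t j i x - L' (?t j i) * ?t j i x)"
    unfolding wavelet_sum_def by (simp add: sum_subtractf)
  have "\<bar>wavelet_sum T j0 \<zeta> \<xi> L J x - wavelet_sum T j0 \<zeta> \<xi> L' J x\<bar> \<le> \<tau> * (C * r ^ j0) + (\<Sum>j=j0..J. \<tau> * (C * r ^ j))"
    unfolding eq
  proof (rule order.trans[OF abs_triangle_ineq], rule add_mono)
    show "\<bar>\<Sum>i\<in>Phi_index T j0. L (?t j0 i) * ?t j0 i x - L' (?t j0 i) * ?t j0 i x\<bar> \<le> \<tau> * (C * r ^ j0)"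
      using J by (intro lev Phi_index_subset) auto
    show "\<bar>\<Sum>j=j0..J. \<Sum>i\<in>Psi_index T j. L (?t j i) * ?t j i x - L' (?t j i) * ?t j i x\<bar> \<le> (\<Sum>j=j0..J. \<tau> * (C * r ^ j))"
      by (rule order.trans[OF sum_abs], rule sum_mono) (rule lev[OF _ Psi_index_subset])
  qed
  also have "\<dots> \<le> \<tau> * (C * r ^ J) + \<tau> * (C * (2 * r ^ J))"
  proof (intro add_mono)
    have "r ^ j0 \<le> r ^ J" using J r by (intro power_increasing) auto
    then show "\<tau> * (C * r ^ j0) \<le> \<tau> * (C * r ^ J)" using C(1) \<tau> by (intro mult_left_mono) auto
    have "(\<Sum>j=j0..J. r ^ j) \<le> (\<Sum>j\<in>{..J}. r ^ j)" using r by (intro sum_mono2) auto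
    also have "\<dots> \<le> 2 * r ^ J" by (rule sum_geometric_head[OF r])
    finally show "(\<Sum>j=j0..J. \<tau> * (C * r ^ j)) \<le> \<tau> * (C * (2 * r ^ J))"
      unfolding sum_distrib_left[symmetric] using C(1) \<tau> by (intro mult_left_mono) auto
  qed
  also have "\<dots> = 3 * C * \<tau> * r ^ J" by simp
  finally show ?thesis unfolding rj .
qed

lemma besov_coeff_bound:
  fixes f :: "('d::finite) path \<Rightarrow> real"
  assumes "f \<in> besov_space T j0 \<zeta> \<xi> s"
  shows "\<exists>B\<ge>0. \<forall>j\<ge>j0. \<forall>i\<in>Psi_index T j.
    \<bar>coeff_of T f (tensor_wavelet T \<zeta> \<xi> j i)\<bar> \<le> B * 2 powr (- (real j * (s + real (CARD('d) * T) / 2)))"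
proof -
  let ?e = "\<lambda>j. real j * (s + real (CARD('d) * T) / 2)"
  have fin: "besov_norm T j0 \<zeta> \<xi> s f < \<infinity>" using assms by (simp add: besov_space_def)
  define B where "B = enn2real (besov_norm T j0 \<zeta> \<xi> s f)"
  have B: "besov_norm T j0 \<zeta> \<xi> s f = ennreal B" "B \<ge> 0" using fin by (auto simp: B_def less_top)
  have "\<bar>coeff_of T f (tensor_wavelet T \<zeta> \<xi> j i)\<bar> \<le> B * 2 powr (- ?e j)"
    if j: "j \<ge> j0" and i: "i \<in> Psi_index T j" for j i
  proof -
    have "ennreal (2 powr ?e j) * ennreal \<bar>coeff_of T f (tensor_wavelet T \<zeta> \<xi> j i)\<bar> \<le>
      ennreal (2 powr ?e j) * (SUP i\<in>Psi_index T j. ennreal \<bar>coeff_of T f (tensor_wavelet T \<zeta> \<xi> j i)\<bar>)"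
      using i by (intro mult_left_mono SUP_upper) auto
    also have "\<dots> \<le> (SUP j\<in>{j0..}. ennreal (2 powr ?e j) *
        (SUP i\<in>Psi_index T j. ennreal \<bar>coeff_of T f (tensor_wavelet T \<zeta> \<xi> j i)\<bar>))"
      using j by (intro SUP_upper[of j "{j0..}"]) auto
    also have "\<dots> \<le> besov_norm T j0 \<zeta> \<xi> s f"
      unfolding besov_norm_def by (rule add_increasing) auto
    finally have "ennreal (2 powr ?e j * \<bar>coeff_of T f (tensor_wavelet T \<zeta> \<xi> j i)\<bar>) \<le> ennreal B"
      by (simp add: ennreal_mult B)
    then have "2 powr ?e j * \<bar>coeff_of T f (tensor_wavelet T \<zeta> \<xi> j i)\<bar> \<le> B" using B(2) by simp
    then show ?thesis by (simp add: powr_minus field_simps)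
  qed
  then show ?thesis using B(2) by blast
qed

lemma besov_bounded:
  assumes "f \<in> besov_space T j0 \<zeta> \<xi> s"
  shows "\<exists>B. AE x in cube_lebesgue T. \<bar>f x\<bar> \<le> B"
proof -
  have fin: "esssup (cube_lebesgue T) (\<lambda>x. ereal \<bar>f x\<bar>) < \<infinity>" using assms by (simp add: besov_space_def)
  then obtain B where "esssup (cube_lebesgue T) (\<lambda>x. ereal \<bar>f x\<bar>) \<le> ereal B"
    by (cases "esssup (cube_lebesgue T) (\<lambda>x. ereal \<bar>f x\<bar>)") auto
  then have "AE x in cube_lebesgue T. \<bar>f x\<bar> \<le> B"
    using esssup_AE[of "\<lambda>x. ereal \<bar>f x\<bar>" "cube_lebesgue T"]
    by (auto elim!: eventually_mono dest: order.trans)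
  then show ?thesis by blast
qed

text \<open>The coefficient decay 2^(-j(s + D/2)) times the pointwise sum 2^(jD/2) leaves q^j with q
  = 2^(-s). As s \<ge> 1 gives q \<le> 1/2, all partial sums beyond J differ from the J-th by a
  multiple of q^J.\<close>

lemma besov_bias:
  fixes f :: "('d::finite) path \<Rightarrow> real"
  assumes f: "f \<in> besov_space T j0 \<zeta> \<xi> s" and s: "s \<ge> 1"
  shows "\<exists>A\<ge>0. \<forall>J\<ge>j0. AE x in cube_lebesgue T.
     \<bar>f x - wavelet_sum T j0 \<zeta> \<xi> (coeff_of T f) J x\<bar> \<le> A * 2 powr (- (real J * s))"
proof -
  let ?t = "tensor_wavelet T \<zeta> \<xi>" and ?W = "wavelet_sum T j0 \<zeta> \<xi> (coeff_of T f)"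
  obtain B where B: "B \<ge> 0" "\<And>j i. j \<ge> j0 \<Longrightarrow> i \<in> Psi_index T j \<Longrightarrow>
    \<bar>coeff_of T f (?t j i)\<bar> \<le> B * 2 powr (- (real j * (s + real (CARD('d) * T) / 2)))"
    using besov_coeff_bound[OF f] by blast
  obtain C where C: "C > 0" "\<And>j x. j \<ge> j0 \<Longrightarrow> (\<Sum>i\<in>(all_index T j :: 'd windex set).
      \<bar>?t j i x\<bar>) \<le> C * 2 powr (real j * real (CARD('d) * T) / 2)"
    using tensor_sum_bound[OF N j0 cdv] by blast
  define q where "q = 2 powr (- s)"
  have "q \<le> 2 powr (-1)" unfolding q_def using s by (intro powr_mono) auto
  then have q: "0 \<le> q" "q \<le> 1 / 2" by (auto simp: q_def powr_minus)
  have qj: "2 powr (- (real j * s)) = q ^ j" for j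
    unfolding q_def by (simp add: powr_realpow[symmetric] powr_powr mult_ac)
  have lev: "\<bar>\<Sum>i\<in>Psi_index T j. coeff_of T f (?t j i) * ?t j i x\<bar> \<le> B * C * q ^ j" if j: "j \<ge> j0" for j x
  proof -
    let ?b = "B * 2 powr (- (real j * (s + real (CARD('d) * T) / 2)))"
    have "\<bar>\<Sum>i\<in>Psi_index T j. coeff_of T f (?t j i) * ?t j i x\<bar> \<le> (\<Sum>i\<in>Psi_index T j. ?b * \<bar>?t j i x\<bar>)"
      using B(2)[OF j] by (intro order.trans[OF sum_abs] sum_mono) (auto simp: abs_mult intro!: mult_right_mono)
    also have "\<dots> \<le> (\<Sum>i\<in>all_index T j. ?b * \<bar>?t j i x\<bar>)"
      using B(1) by (intro sum_mono2 finite_all_index Psi_index_subset) auto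
    also have "\<dots> \<le> ?b * (C * 2 powr (real j * real (CARD('d) * T) / 2))"
      unfolding sum_distrib_left[symmetric] using B(1) j by (intro mult_left_mono C(2)) auto
    also have "\<dots> = B * C * (2 powr (- (real j * (s + real (CARD('d) * T) / 2))) * 2 powr (real j * real (CARD('d) * T) / 2))"
      by simp
    also have "\<dots> = B * C * q ^ j"
      unfolding powr_add[symmetric] qj[symmetric] by (simp add: algebra_simps)
    finally show ?thesis .
  qed
  have tail: "\<bar>?W (J + n) x - ?W J x\<bar> \<le> B * C * q ^ J" if J: "J \<ge> j0" for J n x
  proof -
    have "{j0..J + n} = {j0..J} \<union> {J<..J + n}" "{j0..J} \<inter> {J<..J + n} = {}" using J by auto
    then have eq: "?W (J + n) x - ?W J x = (\<Sum>j\<in>{J<..J + n}. \<Sum>i\<in>Psi_index T j. coeff_of T f (?t j i) * ?t j i x)"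
      unfolding wavelet_sum_def by (simp add: sum.union_disjoint)
    have "\<bar>?W (J + n) x - ?W J x\<bar> \<le> (\<Sum>j\<in>{J<..J + n}. B * C * q ^ j)"
      unfolding eq
      using J by (intro order.trans[OF sum_abs] sum_mono lev) auto
    also have "\<dots> \<le> B * C * q ^ J"
    proof -
      have "(\<Sum>j\<in>{J<..J + n}. q ^ j) \<le> q ^ J"
        using sum_geometric_tail[OF q, of J n] zero_le_power[OF q(1), of "J + n"] by linarith
      then show ?thesis
        unfolding sum_distrib_left[symmetric] using B(1) C(1) by (intro mult_left_mono) auto
    qed
    finally show ?thesis .
  qed
  have lim: "(\<lambda>J. esssup (cube_lebesgue T) (\<lambda>x. ereal \<bar>f x - ?W J x\<bar>)) \<longlonglongrightarrow> 0"
    using f by (simp add: besov_space_def)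
  have "AE x in cube_lebesgue T. \<bar>f x - ?W J x\<bar> \<le> (B * C + 1) * 2 powr (- (real J * s))" if J: "J \<ge> j0" for J
  proof -
    \<comment> \<open>Convergence in the supremum norm is needed at one late level J + J1 only, with
      tolerance q^J; this is the summand 1 in the constant B C + 1.\<close>
    have "eventually (\<lambda>J'. esssup (cube_lebesgue T) (\<lambda>x. ereal \<bar>f x - ?W J' x\<bar>) < ereal (q ^ J)) sequentially"
      by (rule order_tendstoD(2)[OF lim]) (simp add: q_def)
    then obtain J1 where J1: "\<And>J'. J' \<ge> J1 \<Longrightarrow> esssup (cube_lebesgue T) (\<lambda>x. ereal \<bar>f x - ?W J' x\<bar>) < ereal (q ^ J)"
      by (auto simp: eventually_sequentially)
    have small: "esssup (cube_lebesgue T) (\<lambda>x. ereal \<bar>f x - ?W (J + J1) x\<bar>) < ereal (q ^ J)" by (rule J1) simp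
    show ?thesis
      using esssup_AE[of "\<lambda>x. ereal \<bar>f x - ?W (J + J1) x\<bar>" "cube_lebesgue T"]
    proof eventually_elim
      case (elim x)
      with small have "ereal \<bar>f x - ?W (J + J1) x\<bar> < ereal (q ^ J)" by (rule le_less_trans[rotated])
      then have "\<bar>f x - ?W (J + J1) x\<bar> < q ^ J" by simp
      with tail[OF J, of J1 x] have "\<bar>f x - ?W J x\<bar> \<le> B * C * q ^ J + q ^ J" by linarith
      then show ?case unfolding qj by (simp add: distrib_right)
    qed
  qed
  then show ?thesis using B(1) C(1) by (intro exI[of _ "B * C + 1"]) auto
qed

end

section \<open>A priori bounds\<close>

lemma measurable_choose_le:
  fixes u v u' v' :: "'a \<Rightarrow> ennreal"
  assumes [measurable]: "u \<in> borel_measurable M" "v \<in> borel_measurable M" "u' \<in> borel_measurable M" "v' \<in> borel_measurable M"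
  shows "(\<lambda>x. if u x \<le> u' x \<and> v x \<le> v' x then u x else v x) \<in> borel_measurable M"
  by measurable

text \<open>Changing \<open>f\<close> on the null set where the comparison fails does not change its
  law; replacing it there by \<open>g\<close> makes the comparison hold everywhere because K \<ge>
  1.\<close>

lemma AW1_le_close_AE:
  fixes f g :: "('d::finite) path \<Rightarrow> ennreal"
  assumes T: "T \<ge> 1" and K: "K \<ge> 1"
    and f: "f \<in> borel_measurable (past_space T)" and g: "g \<in> borel_measurable (past_space T)"
    and f1: "(\<integral>\<^sup>+x. f x \<partial>path_lebesgue T) = 1" and g1: "(\<integral>\<^sup>+x. g x \<partial>path_lebesgue T) = 1"
    and close: "AE x in path_lebesgue T. f x \<le> ennreal K * g x \<and> g x \<le> ennreal K * f x"
    and supp: "\<And>x. x \<in> space (past_space T) \<Longrightarrow> x \<notin> unit_cube T \<Longrightarrow> f x = 0"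
      "\<And>x. x \<in> space (past_space T) \<Longrightarrow> x \<notin> unit_cube T \<Longrightarrow> g x = 0"
  shows "AW1 T (density (path_lebesgue T) f) (density (path_lebesgue T) g)
    \<le> ennreal (real (CARD('d) * T) * (real T * (1 - 1 / K\<^sup>2)))"
proof -
  define f2 where "f2 x = (if f x \<le> ennreal K * g x \<and> g x \<le> ennreal K * f x then f x else g x)" for x
  have f2: "f2 \<in> borel_measurable (past_space T)"
    unfolding f2_def[abs_def] by (intro measurable_choose_le f g borel_measurable_times_ennreal borel_measurable_const)
  have ae: "AE x in path_lebesgue T. f x = f2 x" using close by eventually_elim (simp add: f2_def)
  have eq: "density (path_lebesgue T) f = density (path_lebesgue T) f2"
    by (rule density_cong[OF measurable_path_lebesgueI[OF f] measurable_path_lebesgueI[OF f2] ae])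
  have f21: "(\<integral>\<^sup>+x. f2 x \<partial>path_lebesgue T) = 1"
    using nn_integral_cong_AE[OF ae] f1 by simp
  have gK: "g x \<le> ennreal K * g x" for x
    using mult_right_mono[of 1 "ennreal K" "g x"] K by simp
  show ?thesis
    unfolding eq
  proof (rule AW1_le_close[OF T K f2 g f21 g1])
    show "f2 x \<le> ennreal K * g x" for x using gK by (simp add: f2_def)
    show "g x \<le> ennreal K * f2 x" for x using gK by (simp add: f2_def)
    show "f2 x = 0" if "x \<in> space (past_space T)" "x \<notin> unit_cube T" for x
      using supp that by (simp add: f2_def)
  qed (use supp in auto)
qed

lemma normal_density_nn_integrals:
  shows "(\<integral>\<^sup>+y. ennreal (std_normal_density (y - c)) \<partial>lborel) = 1"
    and "0 \<le> c \<Longrightarrow> c \<le> 1 \<Longrightarrow> (\<integral>\<^sup>+y. ennreal \<bar>y\<bar> * ennreal (std_normal_density (y - c)) \<partial>lborel) \<le> 3"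
proof -
  have shift: "std_normal_density (y - c) = normal_density c 1 y" for y
    by (simp add: normal_density_def)
  have i0: "has_bochner_integral lborel (\<lambda>y. normal_density c 1 y) 1"
    using normal_moment_even[of 1 c 0] by simp
  have i2: "has_bochner_integral lborel (\<lambda>y. normal_density c 1 y * (y - c)\<^sup>2) 1"
    using normal_moment_even[of 1 c 1] by simp
  have n0: "(\<integral>\<^sup>+y. ennreal (normal_density c 1 y) \<partial>lborel) = 1"
    using i0 by (subst nn_integral_eq_integral) (auto simp: has_bochner_integral_iff)
  then show "(\<integral>\<^sup>+y. ennreal (std_normal_density (y - c)) \<partial>lborel) = 1" by (simp add: shift)
  have n2: "(\<integral>\<^sup>+y. ennreal (normal_density c 1 y * (y - c)\<^sup>2) \<partial>lborel) = 1"
    using i2 by (subst nn_integral_eq_integral) (auto simp: has_bochner_integral_iff)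
  assume c: "0 \<le> c" "c \<le> 1"
  \<comment> \<open>From |y| \<le> |y - c| + 1 and |y - c| \<le> 1 + (y - c)^2; mass 1 and variance
    1 then give the bound 2 + 1.\<close>
  have ineq: "\<bar>y\<bar> * normal_density c 1 y \<le> 2 * normal_density c 1 y + normal_density c 1 y * (y - c)\<^sup>2" for y
  proof -
    have "\<bar>y - c\<bar> \<le> 1 + (y - c)\<^sup>2"
      using sum_squares_ge_zero[of "\<bar>y - c\<bar> - 1 / 2" 0] by (simp add: power2_eq_square algebra_simps abs_mult_self_eq)
    then have "\<bar>y\<bar> \<le> 2 + (y - c)\<^sup>2" using c by linarith
    then have "\<bar>y\<bar> * normal_density c 1 y \<le> (2 + (y - c)\<^sup>2) * normal_density c 1 y"
      by (intro mult_right_mono normal_density_nonneg)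
    then show ?thesis by (simp add: algebra_simps)
  qed
  have "(\<integral>\<^sup>+y. ennreal \<bar>y\<bar> * ennreal (std_normal_density (y - c)) \<partial>lborel)
      \<le> (\<integral>\<^sup>+y. 2 * ennreal (normal_density c 1 y) + ennreal (normal_density c 1 y * (y - c)\<^sup>2) \<partial>lborel)"
  proof (rule nn_integral_mono)
    fix y
    have "ennreal \<bar>y\<bar> * ennreal (std_normal_density (y - c)) = ennreal (\<bar>y\<bar> * normal_density c 1 y)"
      by (simp add: shift ennreal_mult)
    also have "\<dots> \<le> ennreal (2 * normal_density c 1 y + normal_density c 1 y * (y - c)\<^sup>2)"
      by (rule ennreal_leI[OF ineq])
    also have "\<dots> = 2 * ennreal (normal_density c 1 y) + ennreal (normal_density c 1 y * (y - c)\<^sup>2)"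
      by (simp add: ennreal_plus ennreal_mult)
    finally show "ennreal \<bar>y\<bar> * ennreal (std_normal_density (y - c)) \<le> 2 * ennreal (normal_density c 1 y) + ennreal (normal_density c 1 y * (y - c)\<^sup>2)" .
  qed
  also have "\<dots> = 3" by (subst nn_integral_add) (auto simp: nn_integral_cmult n0 n2)
  finally show "(\<integral>\<^sup>+y. ennreal \<bar>y\<bar> * ennreal (std_normal_density (y - c)) \<partial>lborel) \<le> 3" .
qed

lemma gaussian_density_measurable:
  "(\<lambda>x. gaussian_density T (\<lambda>t. x t - (a t :: real ^ 'd::finite))) \<in> borel_measurable (past_space T)"
  unfolding gaussian_density_def
proof (rule borel_measurable_prod)
  fix p :: "nat \<times> 'd" assume p: "p \<in> coords T"
  have "(\<lambda>y. std_normal_density (y - coord a p)) \<in> borel_measurable borel" by measurable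
  from measurable_compose[OF measurable_coord[OF p] this]
  show "(\<lambda>x. std_normal_density ((x (fst p) - a (fst p)) $ snd p)) \<in> borel_measurable (past_space T)" by simp
qed

lemma ennreal_gaussian_density:
  "ennreal (gaussian_density T (\<lambda>t. x t - a t)) = (\<Prod>p\<in>coords T. ennreal (std_normal_density (coord x p - coord a p)))"
  unfolding gaussian_density_def by (simp add: prod_ennreal)

lemma gaussian_integral:
  "(\<integral>\<^sup>+x. ennreal (gaussian_density T (\<lambda>t. x t - a t)) \<partial>(path_lebesgue T :: ('d::finite) path measure)) = 1"
  unfolding ennreal_gaussian_density
  by (subst nn_integral_path_prod[of "\<lambda>p y. ennreal (std_normal_density (y - coord a p))"])
     (simp_all add: normal_density_nn_integrals(1))

lemma gaussian_moment:
  fixes a :: "('d::finite) path"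
  assumes a: "a \<in> unit_cube T"
  shows "(\<integral>\<^sup>+x. ennreal (l1_dist T x (\<lambda>_. 0)) \<partial>density (path_lebesgue T) (\<lambda>x. ennreal (gaussian_density T (\<lambda>t. x t - a t))))
    \<le> ennreal (3 * real (CARD('d) * T))"
proof -
  have mg: "(\<lambda>x. ennreal (gaussian_density T (\<lambda>t. x t - a t))) \<in> borel_measurable (past_space T)"
    using gaussian_density_measurable by (rule measurable_compose[OF _ measurable_ennreal])
  have ml: "(\<lambda>x. ennreal (l1_dist T x (\<lambda>_. 0))) \<in> borel_measurable (past_space T)"
    using measurable_l1_norm by (rule measurable_compose[OF _ measurable_ennreal])
  let ?n = "\<lambda>p y. ennreal (std_normal_density (y - coord a p))"
  \<comment> \<open>The weight |y| is attached to coordinate \<open>p\<close> only, so each summand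
    of the l1-norm leaves a product integrand: one factor is a first absolute moment, the others
    have mass one.\<close>
  let ?u = "\<lambda>p q y. if q = p then ennreal \<bar>y\<bar> * ?n q y else ?n q y"
  have mcoord: "(\<lambda>x. \<Prod>q\<in>coords T. ?u p q (coord x q)) \<in> borel_measurable (past_space T)" for p
  proof (rule borel_measurable_prod_ennreal)
    fix q :: "nat \<times> 'd" assume q: "q \<in> coords T"
    have "?u p q \<in> borel_measurable borel" by measurable
    from measurable_compose[OF measurable_coord[OF q] this]
    show "(\<lambda>x. ?u p q (coord x q)) \<in> borel_measurable (past_space T)" .
  qed
  have "(\<integral>\<^sup>+x. ennreal (l1_dist T x (\<lambda>_. 0)) \<partial>density (path_lebesgue T) (\<lambda>x. ennreal (gaussian_density T (\<lambda>t. x t - a t))))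
      = (\<integral>\<^sup>+x. ennreal (gaussian_density T (\<lambda>t. x t - a t)) * ennreal (l1_dist T x (\<lambda>_. 0)) \<partial>path_lebesgue T)"
    by (rule nn_integral_density[OF measurable_path_lebesgueI[OF mg] measurable_path_lebesgueI[OF ml]])
  also have "\<dots> = (\<integral>\<^sup>+x. (\<Sum>p\<in>coords T. \<Prod>q\<in>coords T. ?u p q (coord x q)) \<partial>path_lebesgue T)"
  proof (rule nn_integral_cong)
    fix x :: "'d path"
    have "(\<Prod>q\<in>coords T. ?u p q (coord x q)) = ennreal \<bar>coord x p\<bar> * (\<Prod>q\<in>coords T. ?n q (coord x q))"
      if p: "p \<in> coords T" for p
    proof -
      have "(\<Prod>q\<in>coords T. ?u p q (coord x q)) = ?u p p (coord x p) * (\<Prod>q\<in>coords T - {p}. ?u p q (coord x q))"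
        by (rule prod.remove[OF finite_coords p])
      also have "(\<Prod>q\<in>coords T - {p}. ?u p q (coord x q)) = (\<Prod>q\<in>coords T - {p}. ?n q (coord x q))"
        by (rule prod.cong) auto
      finally show ?thesis
        unfolding prod.remove[OF finite_coords p, of "\<lambda>q. ?n q (coord x q)"] by (simp add: mult.assoc)
    qed
    then have split: "(\<Prod>q\<in>coords T. ?n q (coord x q)) * ennreal \<bar>coord x p\<bar> = (\<Prod>q\<in>coords T. ?u p q (coord x q))"
      if "p \<in> coords T" for p
      using that by (simp only: mult.commute)
    have norm: "ennreal (l1_dist T x (\<lambda>_. 0)) = (\<Sum>p\<in>coords T. ennreal \<bar>coord x p\<bar>)"
      unfolding l1_dist_def by (subst sum_ennreal) auto
    show "ennreal (gaussian_density T (\<lambda>t. x t - a t)) * ennreal (l1_dist T x (\<lambda>_. 0))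
       = (\<Sum>p\<in>coords T. \<Prod>q\<in>coords T. ?u p q (coord x q))"
      unfolding ennreal_gaussian_density norm sum_distrib_left by (intro sum.cong refl split)
  qed
  also have "\<dots> = (\<Sum>p\<in>coords T. (\<integral>\<^sup>+x. (\<Prod>q\<in>coords T. ?u p q (coord x q)) \<partial>path_lebesgue T))"
    by (intro nn_integral_sum measurable_path_lebesgueI mcoord)
  also have "\<dots> = (\<Sum>p\<in>coords T. \<Prod>q\<in>coords T. \<integral>\<^sup>+y. ?u p q y \<partial>lborel)"
    by (intro sum.cong refl nn_integral_path_prod) measurable
  also have "\<dots> \<le> (\<Sum>p\<in>(coords T :: (nat \<times> 'd) set). 3)"
  proof (rule sum_mono)
    fix p :: "nat \<times> 'd" assume p: "p \<in> coords T"
    have "(\<Prod>q\<in>coords T. \<integral>\<^sup>+y. ?u p q y \<partial>lborel) = (\<integral>\<^sup>+y. ?u p p y \<partial>lborel) * (\<Prod>q\<in>coords T - {p}. \<integral>\<^sup>+y. ?u p q y \<partial>lborel)"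
      by (rule prod.remove[OF finite_coords p])
    also have "(\<Prod>q\<in>coords T - {p}. \<integral>\<^sup>+y. ?u p q y \<partial>lborel) = 1"
      by (rule prod.neutral) (simp add: normal_density_nn_integrals(1))
    also have "(\<integral>\<^sup>+y. ?u p p y \<partial>lborel) \<le> 3"
      using normal_density_nn_integrals(2)[of "coord a p"] unit_cube_coord[OF a p] by simp
    finally show "(\<Prod>q\<in>coords T. \<integral>\<^sup>+y. ?u p q y \<partial>lborel) \<le> 3" by (simp add: mult_right_mono)
  qed
  also have "\<dots> = ennreal (3 * real (CARD('d) * T))"
    by (simp add: card_coords ennreal_mult ennreal_of_nat_eq_real_of_nat mult_ac)
  finally show ?thesis .
qed

lemma cube_density_moment:
  fixes f :: "('d::finite) path \<Rightarrow> ennreal"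
  assumes f: "f \<in> borel_measurable (past_space T)" and f1: "(\<integral>\<^sup>+x. f x \<partial>path_lebesgue T) = 1"
    and supp: "\<And>x. x \<in> space (past_space T) \<Longrightarrow> x \<notin> unit_cube T \<Longrightarrow> f x = 0"
  shows "(\<integral>\<^sup>+x. ennreal (l1_dist T x (\<lambda>_. 0)) \<partial>density (path_lebesgue T) f) \<le> ennreal (real (CARD('d) * T))"
proof -
  have ml: "(\<lambda>x. ennreal (l1_dist T x (\<lambda>_. 0))) \<in> borel_measurable (past_space T)"
    using measurable_l1_norm by (rule measurable_compose[OF _ measurable_ennreal])
  have "(\<integral>\<^sup>+x. ennreal (l1_dist T x (\<lambda>_. 0)) \<partial>density (path_lebesgue T) f) =
    (\<integral>\<^sup>+x. f x * ennreal (l1_dist T x (\<lambda>_. 0)) \<partial>path_lebesgue T)"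
    by (rule nn_integral_density[OF measurable_path_lebesgueI[OF f] measurable_path_lebesgueI[OF ml]])
  also have "\<dots> \<le> (\<integral>\<^sup>+x. f x * ennreal (real (CARD('d) * T)) \<partial>path_lebesgue T)"
  proof (rule nn_integral_mono)
    fix x :: "'d path" assume "x \<in> space (path_lebesgue T)"
    then have x: "x \<in> space (past_space T)" by (simp add: space_path_lebesgue)
    show "f x * ennreal (l1_dist T x (\<lambda>_. 0)) \<le> f x * ennreal (real (CARD('d) * T))"
    proof (cases "x \<in> unit_cube T")
      case True
      have "l1_dist T x (\<lambda>_. 0) \<le> (\<Sum>p\<in>(coords T :: (nat \<times> 'd) set). 1)"
        unfolding l1_dist_def
      proof (rule sum_mono)
        fix p :: "nat \<times> 'd" assume "p \<in> coords T"
        from unit_cube_coord[OF True this] show "\<bar>coord x p - coord (\<lambda>_. 0) p\<bar> \<le> 1" by simp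
      qed
      then have "l1_dist T x (\<lambda>_. 0) \<le> real (CARD('d) * T)" by (simp add: card_coords)
      then show ?thesis by (intro mult_left_mono ennreal_leI) auto
    qed (simp add: supp[OF x])
  qed
  also have "\<dots> = ennreal (real (CARD('d) * T))"
    by (subst nn_integral_multc[OF measurable_path_lebesgueI[OF f]]) (simp add: f1)
  finally show ?thesis .
qed

section \<open>Concentration of the empirical coefficients\<close>

lemma exp_le_quadratic:
  fixes y :: real
  assumes "\<bar>y\<bar> \<le> 1" shows "exp y \<le> 1 + y + y\<^sup>2"
proof (cases "y \<ge> 0")
  case True
  then show ?thesis using assms by (intro exp_bound) auto
next
  case False
  define z where "z = - y"
  have z: "z > 0" "z \<le> 1" using False assms by (auto simp: z_def)
  have pos: "0 < 1 - z + z\<^sup>2" using z by (simp add: power2_eq_square) (smt (verit) mult_pos_pos)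
  \<comment> \<open>The right-hand side is 1 - z + z^2 times the second-order Taylor polynomial of
    exp, which lies below exp z; dividing by exp z gives the bound for exp (- z).\<close>
  have "1 \<le> 1 + z\<^sup>2 / 2 + z ^ 3 / 2 + z ^ 4 / 2" using z by simp
  also have "\<dots> = (1 - z + z\<^sup>2) * (1 + z + z\<^sup>2 / 2)" by (simp add: power2_eq_square power3_eq_cube power4_eq_xxxx field_simps)
  also have "\<dots> \<le> (1 - z + z\<^sup>2) * exp z"
    using z pos by (intro mult_left_mono exp_lower_Taylor_quadratic) auto
  finally have "1 \<le> (1 - z + z\<^sup>2) * exp z" .
  then have "exp (- z) \<le> 1 - z + z\<^sup>2" by (simp add: exp_minus field_simps)
  then show ?thesis by (simp add: z_def)
qed

text \<open>Since 2 l B \<le> 1, the centred exponent lies in [-1, 1], where exp y \<le> 1 + y +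
  y^2. The linear term integrates to zero, and the variance is at most the second moment.\<close>

lemma exp_moment_bound:
  fixes g :: "'a \<Rightarrow> real"
  assumes M: "prob_space M" and g: "g \<in> borel_measurable M" and gB: "\<And>x. x \<in> space M \<Longrightarrow> \<bar>g x\<bar> \<le> B"
    and V: "(LINT x|M. (g x)\<^sup>2) \<le> V" and l: "0 \<le> l" "l * (2 * B) \<le> 1"
  shows "(\<integral>\<^sup>+x. ennreal (exp (l * (g x - (LINT x|M. g x)))) \<partial>M) \<le> ennreal (exp (l\<^sup>2 * V))"
proof -
  interpret prob_space M by fact
  note g [measurable]
  let ?b = "LINT x|M. g x"
  have ig: "integrable M g" by (rule integrable_const_bound[of _ B]) (use gB g in auto)
  have ig2: "integrable M (\<lambda>x. (g x)\<^sup>2)"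
    by (rule integrable_const_bound[of _ "B\<^sup>2"]) (use gB in \<open>auto intro!: power2_le_iff_abs_le[THEN iffD2] dest: order.trans[OF abs_ge_zero]\<close>)
  obtain x0 where "x0 \<in> space M" using not_empty by blast
  then have B: "B \<ge> 0" using gB by (meson abs_ge_zero order.trans)
  have b: "\<bar>?b\<bar> \<le> B"
  proof -
    have "\<bar>?b\<bar> \<le> (LINT x|M. \<bar>g x\<bar>)" by (rule integral_abs_bound)
    also have "\<dots> \<le> (LINT x|M. B)" using ig gB by (intro integral_mono) auto
    finally show ?thesis by (simp add: prob_space)
  qed
  let ?y = "\<lambda>x. l * (g x - ?b)"
  have iq: "integrable M (\<lambda>x. 1 + ?y x + (?y x)\<^sup>2)"
  proof -
    have "(\<lambda>x. 1 + ?y x + (?y x)\<^sup>2) = (\<lambda>x. 1 + l * (g x - ?b) + l\<^sup>2 * ((g x)\<^sup>2 - 2 * ?b * g x + ?b\<^sup>2))"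
      by (rule ext) (simp add: power2_eq_square algebra_simps)
    then show ?thesis using ig ig2 by simp
  qed
  have y1: "\<bar>?y x\<bar> \<le> 1" if "x \<in> space M" for x
  proof -
    have "\<bar>?y x\<bar> \<le> l * (2 * B)"
      unfolding abs_mult using gB[OF that] b l(1) by (intro mult_mono) auto
    then show ?thesis using l(2) by linarith
  qed
  have "(\<integral>\<^sup>+x. ennreal (exp (?y x)) \<partial>M) \<le> (\<integral>\<^sup>+x. ennreal (1 + ?y x + (?y x)\<^sup>2) \<partial>M)"
    by (intro nn_integral_mono ennreal_leI exp_le_quadratic y1)
  also have "\<dots> = ennreal (LINT x|M. 1 + ?y x + (?y x)\<^sup>2)"
  proof (rule nn_integral_eq_integral[OF iq AE_I2])
    fix x assume "x \<in> space M"
    from exp_le_quadratic[OF y1[OF this]] show "0 \<le> 1 + ?y x + (?y x)\<^sup>2"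
      using exp_ge_zero[of "?y x"] by linarith
  qed
  also have "(LINT x|M. 1 + ?y x + (?y x)\<^sup>2) = (LINT x|M. 1 + l * (g x - ?b) + l\<^sup>2 * ((g x)\<^sup>2 - 2 * ?b * g x + ?b\<^sup>2))"
    by (intro Bochner_Integration.integral_cong refl) (simp add: power2_eq_square algebra_simps)
  also have "\<dots> = 1 + l\<^sup>2 * ((LINT x|M. (g x)\<^sup>2) - ?b\<^sup>2)"
    using ig ig2 by (simp add: prob_space power2_eq_square algebra_simps)
  also have "ennreal \<dots> \<le> ennreal (1 + l\<^sup>2 * V)"
    using V by (intro ennreal_leI add_left_mono mult_left_mono) (auto intro: order.trans[rotated])
  also have "\<dots> \<le> ennreal (exp (l\<^sup>2 * V))" by (intro ennreal_leI exp_ge_add_one_self)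
  finally show ?thesis .
qed

text \<open>Exponential Markov inequality and independence. It gives the upper tail; the lower tail
  is obtained by inserting \<open>- g\<close>. The parameter \<open>l\<close> is left free for later
  optimisation.\<close>

lemma chernoff_mean:
  fixes g :: "'a \<Rightarrow> real" and X :: "nat \<Rightarrow> 'w \<Rightarrow> 'a"
  assumes iid: "iid_samples P M n X" and n: "n \<ge> 1" and M: "prob_space M"
    and g: "g \<in> borel_measurable M" and gB: "\<And>x. x \<in> space M \<Longrightarrow> \<bar>g x\<bar> \<le> B"
    and V: "(LINT x|M. (g x)\<^sup>2) \<le> V" and l: "0 < l" "l * (2 * B) \<le> 1"
  shows "{\<omega> \<in> space P. (\<Sum>i=1..n. g (X i \<omega>)) / real n - (LINT x|M. g x) \<ge> a} \<in> sets P"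
    and "emeasure P {\<omega> \<in> space P. (\<Sum>i=1..n. g (X i \<omega>)) / real n - (LINT x|M. g x) \<ge> a}
     \<le> ennreal (exp (- real n * l * a + real n * l\<^sup>2 * V))"
proof -
  interpret P: prob_space P using iid by (simp add: iid_samples_def)
  let ?b = "LINT x|M. g x"
  have ind: "P.indep_vars (\<lambda>_. M) X {1..n}" and law: "\<And>i. i \<in> {1..n} \<Longrightarrow> distr P M (X i) = M"
    using iid by (auto simp: iid_samples_def)
  have mX: "X i \<in> P \<rightarrow>\<^sub>M M" if "i \<in> {1..n}" for i
    using ind that unfolding P.indep_vars_def by blast
  have mgX: "(\<lambda>\<omega>. g (X i \<omega>)) \<in> borel_measurable P" if "i \<in> {1..n}" for i
    by (rule measurable_compose[OF mX[OF that] g])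
  have mS: "(\<lambda>\<omega>. (\<Sum>i=1..n. g (X i \<omega>)) / real n - ?b) \<in> borel_measurable P"
    by (intro borel_measurable_diff borel_measurable_divide borel_measurable_sum mgX borel_measurable_const) auto
  then show meas: "{\<omega> \<in> space P. (\<Sum>i=1..n. g (X i \<omega>)) / real n - ?b \<ge> a} \<in> sets P"
    by measurable
  let ?h = "\<lambda>x. ennreal (exp (l * (g x - ?b)))"
  have mh: "?h \<in> borel_measurable M" using g by measurable
  have indh: "P.indep_vars (\<lambda>_. borel) (\<lambda>i \<omega>. ?h (X i \<omega>)) {1..n}"
    by (rule P.indep_vars_compose2[OF ind]) (rule mh)
  have expn: "(\<Prod>i\<in>{1..n}. ?h (X i \<omega>)) = ennreal (exp (l * real n * ((\<Sum>i=1..n. g (X i \<omega>)) / real n - ?b)))" for \<omega>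
  proof -
    have "(\<Prod>i\<in>{1..n}. ?h (X i \<omega>)) = ennreal (\<Prod>i\<in>{1..n}. exp (l * (g (X i \<omega>) - ?b)))"
      by (rule prod_ennreal) simp
    also have "(\<Prod>i\<in>{1..n}. exp (l * (g (X i \<omega>) - ?b))) = exp (\<Sum>i\<in>{1..n}. l * (g (X i \<omega>) - ?b))"
      by (rule exp_sum[symmetric]) simp
    also have "(\<Sum>i\<in>{1..n}. l * (g (X i \<omega>) - ?b)) = l * real n * ((\<Sum>i=1..n. g (X i \<omega>)) / real n - ?b)"
      using n by (simp add: sum_distrib_left[symmetric] sum_subtractf field_simps)
    finally show ?thesis .
  qed
  have "emeasure P {\<omega> \<in> space P. (\<Sum>i=1..n. g (X i \<omega>)) / real n - ?b \<ge> a}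
     = (\<integral>\<^sup>+\<omega>. indicator {\<omega> \<in> space P. (\<Sum>i=1..n. g (X i \<omega>)) / real n - ?b \<ge> a} \<omega> \<partial>P)"
    using meas by simp
  also have "\<dots> \<le> (\<integral>\<^sup>+\<omega>. ennreal (exp (- real n * l * a)) * (\<Prod>i\<in>{1..n}. ?h (X i \<omega>)) \<partial>P)"
  proof (rule nn_integral_mono)
    fix \<omega>
    have "1 \<le> exp (- real n * l * a) * exp (l * real n * ((\<Sum>i=1..n. g (X i \<omega>)) / real n - ?b))"
      if "(\<Sum>i=1..n. g (X i \<omega>)) / real n - ?b \<ge> a"
    proof -
      have "l * real n * a \<le> l * real n * ((\<Sum>i=1..n. g (X i \<omega>)) / real n - ?b)"
        using that l by (intro mult_left_mono) auto
      then have "0 \<le> - real n * l * a + l * real n * ((\<Sum>i=1..n. g (X i \<omega>)) / real n - ?b)"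
        by (simp add: mult_ac)
      then show ?thesis unfolding exp_add[symmetric] by simp
    qed
    then show "indicator {\<omega> \<in> space P. (\<Sum>i=1..n. g (X i \<omega>)) / real n - ?b \<ge> a} \<omega>
        \<le> ennreal (exp (- real n * l * a)) * (\<Prod>i\<in>{1..n}. ?h (X i \<omega>))"
      unfolding expn by (auto simp: indicator_def ennreal_mult[symmetric] simp del: ennreal_1 simp flip: ennreal_1 intro!: ennreal_leI)
  qed
  also have "\<dots> = ennreal (exp (- real n * l * a)) * (\<integral>\<^sup>+\<omega>. (\<Prod>i\<in>{1..n}. ?h (X i \<omega>)) \<partial>P)"
    by (intro nn_integral_cmult borel_measurable_prod_ennreal measurable_compose[OF mX mh])
  also have "(\<integral>\<^sup>+\<omega>. (\<Prod>i\<in>{1..n}. ?h (X i \<omega>)) \<partial>P) = (\<Prod>i\<in>{1..n}. \<integral>\<^sup>+\<omega>. ?h (X i \<omega>) \<partial>P)"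
    by (rule P.indep_vars_nn_integral[OF _ indh]) auto
  also have "\<dots> = (\<Prod>i\<in>{1..n}. \<integral>\<^sup>+x. ?h x \<partial>M)"
  proof (rule prod.cong[OF refl])
    fix i assume i: "i \<in> {1..n}"
    have "(\<integral>\<^sup>+x. ?h x \<partial>distr P M (X i)) = (\<integral>\<^sup>+\<omega>. ?h (X i \<omega>) \<partial>P)"
      by (rule nn_integral_distr[OF mX[OF i]]) (simp add: mh)
    then show "(\<integral>\<^sup>+\<omega>. ?h (X i \<omega>) \<partial>P) = (\<integral>\<^sup>+x. ?h x \<partial>M)" by (simp add: law[OF i])
  qed
  also have "\<dots> \<le> (\<Prod>i\<in>{1..n}. ennreal (exp (l\<^sup>2 * V)))"
    unfolding prod_constant
    by (rule power_mono_ennreal, rule exp_moment_bound[OF M g _ V less_imp_le[OF l(1)] l(2)], rule gB)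
  also have "(\<Prod>i\<in>{1..n}. ennreal (exp (l\<^sup>2 * V))) = ennreal (exp (real n * l\<^sup>2 * V))"
    by (simp add: ennreal_power exp_of_nat_mult[symmetric] mult_ac)
  finally show "emeasure P {\<omega> \<in> space P. (\<Sum>i=1..n. g (X i \<omega>)) / real n - ?b \<ge> a}
     \<le> ennreal (exp (- real n * l * a + real n * l\<^sup>2 * V))"
    unfolding exp_add ennreal_mult[OF exp_ge_zero exp_ge_zero] by (simp add: mult_left_mono)
qed

lemma empirical_integral:
  fixes X :: "nat \<Rightarrow> ('d::finite) path"
  assumes X: "\<And>i. i \<in> {1..n} \<Longrightarrow> X i \<in> space (past_space T)" and g: "g \<in> borel_measurable (past_space T)"
  shows "(LINT x|empirical_measure T n X. g x) = (\<Sum>i=1..n. g (X i)) / real n"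
proof -
  have "X \<in> uniform_count_measure {1..n} \<rightarrow>\<^sub>M past_space T"
    using X by (auto simp: measurable_def space_uniform_count_measure sets_uniform_count_measure)
  then have "(LINT x|empirical_measure T n X. g x) = (LINT i|uniform_count_measure {1..n}. g (X i))"
    unfolding empirical_measure_def path_space_eq_past_space by (rule integral_distr) (rule g)
  then show ?thesis by (simp add: integral_uniform_count_measure)
qed

lemma powr_times_exp_bounded:
  fixes a c \<alpha> :: real
  assumes "c > 0" "\<alpha> > 0"
  shows "\<exists>K>0. \<forall>n\<ge>1::nat. real n powr a * exp (- (c * real n powr \<alpha>)) \<le> K"
proof -
  \<comment> \<open>Any positive natural number m \<ge> a / \<alpha> works, by (1 + y / m)^m \<le>
    exp y; \<open>Suc\<close> secures positivity.\<close>
  define m where "m = Suc (nat \<lceil>a / \<alpha>\<rceil>)"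
  have "a / \<alpha> \<le> real m" unfolding m_def using real_nat_ceiling_ge[of "a / \<alpha>"] by simp
  then have m: "a \<le> \<alpha> * real m" using assms by (simp add: field_simps)
  have m0: "m > 0" by (simp add: m_def)
  define K where "K = (real m / c) ^ m"
  have K: "K > 0" unfolding K_def using assms m0 by simp
  have "real n powr a * exp (- (c * real n powr \<alpha>)) \<le> K" if n: "n \<ge> 1" for n :: nat
  proof -
    let ?y = "c * real n powr \<alpha>"
    have y: "?y \<ge> 0" using assms by simp
    have "(?y / real m) ^ m \<le> (1 + ?y / real m) ^ m" using y by (intro power_mono) auto
    also have "\<dots> \<le> exp ?y" using y m0 by (intro exp_ge_one_plus_x_over_n_power_n) auto
    finally have e: "(?y / real m) ^ m \<le> exp ?y" .
    have "(?y / real m) ^ m = (c / real m) ^ m * real n powr (\<alpha> * real m)"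
      using n by (simp add: power_divide power_mult_distrib powr_power mult.commute)
    moreover have "real n powr a \<le> real n powr (\<alpha> * real m)" using n m by (intro powr_mono) auto
    ultimately have "(c / real m) ^ m * real n powr a \<le> exp ?y"
      using e mult_left_mono[of "real n powr a" "real n powr (\<alpha> * real m)" "(c / real m) ^ m"] assms by simp
    then have "K * ((c / real m) ^ m * real n powr a) \<le> K * exp ?y" using K by (intro mult_left_mono) auto
    moreover have "K * (c / real m) ^ m = 1"
      unfolding K_def power_mult_distrib[symmetric] using assms m0 by simp
    ultimately have "real n powr a \<le> K * exp ?y" by (simp add: mult.assoc[symmetric])
    then show ?thesis by (simp add: exp_minus field_simps)
  qed
  then show ?thesis using K by blast
qed

section \<open>The estimator\<close>

lemma pre_estimator_outside: "x \<notin> unit_cube T \<Longrightarrow> pre_estimator T j0 \<zeta> \<xi> J n X x = 0"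
  by (simp add: pre_estimator_def wavelet_sum_outside)

context
  fixes N j0 :: nat and \<zeta> \<xi> :: "nat \<Rightarrow> nat \<Rightarrow> real \<Rightarrow> real"
  assumes N: "N \<ge> 2" and j0: "real j0 \<ge> log 2 (real N)" and cdv: "cdv_system N j0 \<zeta> \<xi>"
begin

lemma measurable_pre_estimator: "pre_estimator T j0 \<zeta> \<xi> J n X \<in> borel_measurable (past_space T)"
  unfolding pre_estimator_def by (rule measurable_wavelet_sum[OF N j0 cdv])

text \<open>The wavelet levels integrate to zero. After exchanging the sums, each sample contributes
  1 / n times the partition of unity at its own position, which is why the samples must lie in the
  cube.\<close>

lemma pre_estimator_integral:
  fixes X :: "nat \<Rightarrow> ('d::finite) path"
  assumes X: "\<And>i. i \<in> {1..n} \<Longrightarrow> X i \<in> unit_cube T" and n: "n \<ge> 1"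
  shows "(LINT x|path_lebesgue T. pre_estimator T j0 \<zeta> \<xi> J n X x) = 1"
proof -
  let ?t = "tensor_wavelet T \<zeta> \<xi> j0" and ?I = "Phi_index T j0 :: 'd windex set"
  let ?c = "\<lambda>i. LINT x|path_lebesgue T. ?t i x"
  have "(LINT x|path_lebesgue T. pre_estimator T j0 \<zeta> \<xi> J n X x) = (\<Sum>i\<in>?I. (LINT x|empirical_measure T n X. ?t i x) * ?c i)"
    unfolding pre_estimator_def by (rule integral_wavelet_sum(2)[OF N j0 cdv])
  also have "\<dots> = (\<Sum>i\<in>?I. (\<Sum>k=1..n. ?c i * ?t i (X k)) / real n)"
  proof (rule sum.cong[OF refl])
    fix i assume i: "i \<in> ?I"
    have "(LINT x|empirical_measure T n X. ?t i x) = (\<Sum>k=1..n. ?t i (X k)) / real n"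
      by (rule empirical_integral[OF unit_cube_space[OF X] measurable_tensor_wavelet[OF N j0 cdv order_refl Phi_index_subset[THEN subsetD, OF i]]])
    then show "(LINT x|empirical_measure T n X. ?t i x) * ?c i = (\<Sum>k=1..n. ?c i * ?t i (X k)) / real n"
      by (simp add: sum_distrib_left[symmetric])
  qed
  also have "\<dots> = (\<Sum>k=1..n. \<Sum>i\<in>?I. ?c i * ?t i (X k)) / real n"
    by (subst sum.swap) (simp add: sum_divide_distrib)
  also have "\<dots> = 1"
    using n Phi_partition_of_unity[OF N j0 cdv X] by simp
  finally show ?thesis .
qed

context
  fixes T :: nat and f :: "('d::finite) path \<Rightarrow> real" and \<mu> :: "'d path measure" and \<gamma> :: real
  assumes T: "T \<ge> 1" and \<gamma>: "\<gamma> > 0" and \<mu>_prob: "prob_space \<mu>"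
    and \<mu>: "\<mu> = density (path_lebesgue T) (\<lambda>x. ennreal (f x) * indicator (unit_cube T) x)"
    and f_meas: "f \<in> borel_measurable (cube_lebesgue T)"
    and f_lower: "AE x in cube_lebesgue T. f x \<ge> 1 / \<gamma>"
begin

text \<open>\<open>f\<close> is measurable only relative to the cube; extended by zero it becomes a
  measurable function on the whole path space.\<close>

definition "cube_density x = indicator (unit_cube T) x * f x"

lemma cube_density_measurable: "cube_density \<in> borel_measurable (past_space T)"
proof -
  have "cube_density \<in> borel_measurable (path_lebesgue T)"
    using f_meas unfolding cube_lebesgue_def borel_measurable_restrict_space_iff[OF sets_unit_cube_lebesgue]
    by (simp add: cube_density_def[abs_def])
  then show ?thesis using measurable_cong_sets[OF sets_path_lebesgue refl] by blast
qed

lemma cube_density_measurable': "cube_density \<in> borel_measurable (path_lebesgue T)"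
  by (rule measurable_path_lebesgueI[OF cube_density_measurable])

lemma cube_density_nonneg: "AE x in path_lebesgue T. 0 \<le> cube_density x"
  using f_lower[unfolded AE_cube_lebesgue]
proof eventually_elim
  case (elim x)
  have "0 < 1 / \<gamma>" using \<gamma> by simp
  show ?case
  proof (cases "x \<in> unit_cube T")
    case True
    with elim have "1 / \<gamma> \<le> f x" by blast
    with \<open>0 < 1 / \<gamma>\<close> have "0 \<le> f x" by linarith
    then show ?thesis by (simp add: cube_density_def)
  qed (simp add: cube_density_def)
qed

lemma \<mu>_eq: "\<mu> = density (path_lebesgue T) (\<lambda>x. ennreal (cube_density x))"
  unfolding \<mu> by (intro arg_cong[of _ _ "density (path_lebesgue T)"] ext) (simp add: cube_density_def indicator_def)

lemma ennreal_cube_density_measurable: "(\<lambda>x. ennreal (cube_density x)) \<in> borel_measurable (past_space T)"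
  by (rule measurable_compose[OF cube_density_measurable measurable_ennreal])

lemma sets_\<mu>: "sets \<mu> = sets (past_space T)"
  unfolding \<mu> by (simp add: sets_path_lebesgue)

lemma space_\<mu>: "space \<mu> = space (past_space T)"
  by (rule sets_eq_imp_space_eq[OF sets_\<mu>])

lemma cube_density_integral: "(\<integral>\<^sup>+x. ennreal (cube_density x) \<partial>path_lebesgue T) = 1"
proof -
  have m: "(\<lambda>x. ennreal (cube_density x)) \<in> borel_measurable (path_lebesgue T)"
    by (rule measurable_compose[OF cube_density_measurable' measurable_ennreal])
  have "(\<integral>\<^sup>+x. 1 \<partial>\<mu>) = (\<integral>\<^sup>+x. ennreal (cube_density x) * 1 \<partial>path_lebesgue T)"
    unfolding \<mu>_eq by (rule nn_integral_density[OF m]) simp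
  then show ?thesis using prob_space.emeasure_space_1[OF \<mu>_prob] by simp
qed

lemma cube_density_outside: "x \<notin> unit_cube T \<Longrightarrow> ennreal (cube_density x) = 0"
  by (simp add: cube_density_def)

lemma \<mu>_cube: "AE x in \<mu>. x \<in> unit_cube T"
proof -
  have m: "(\<lambda>x. ennreal (cube_density x)) \<in> borel_measurable (path_lebesgue T)"
    by (rule measurable_compose[OF cube_density_measurable' measurable_ennreal])
  show ?thesis
    unfolding \<mu>_eq AE_density[OF m]
  proof (intro AE_I2 impI)
    fix x assume "0 < ennreal (cube_density x)"
    then show "x \<in> unit_cube T" using cube_density_outside[of x] by (cases "x \<in> unit_cube T") auto
  qed
qed

lemma integral_\<mu>:
  assumes g: "g \<in> borel_measurable (past_space T)"
  shows "(LINT x|\<mu>. g x) = (LINT x|path_lebesgue T. cube_density x * g x)"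
proof -
  have "g \<in> borel_measurable (path_lebesgue T)"
    by (rule measurable_path_lebesgueI[OF g])
  then have "(LINT x|\<mu>. g x) = (LINT x|path_lebesgue T. cube_density x *\<^sub>R g x)"
    unfolding \<mu>_eq by (rule integral_density[OF _ cube_density_measurable' cube_density_nonneg])
  then show ?thesis by simp
qed

text \<open>The expectation of an empirical coefficient is thus the true coefficient, so the
  deviation inequality for sample means applies to it.\<close>

lemma coeff_eq_integral_\<mu>:
  assumes g: "g \<in> borel_measurable (past_space T)"
  shows "(LINT x|\<mu>. g x) = coeff_of T f g"
  unfolding integral_\<mu>[OF g] coeff_of_def integral_cube_lebesgue
  by (simp add: cube_density_def mult_ac)

text \<open>Wavelets are normalised in L2 and \<open>f\<close> is bounded, so the second moment is
  bounded uniformly in the level, although the sup-norm bound for the wavelets grows like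
  2^(jD/2).\<close>

lemma variance_bound:
  assumes B: "AE x in cube_lebesgue T. \<bar>f x\<bar> \<le> B" "B \<ge> 0" and j: "j \<ge> j0" and i: "i \<in> all_index T j"
  shows "(LINT x|\<mu>. (tensor_wavelet T \<zeta> \<xi> j i x)\<^sup>2) \<le> B"
proof -
  let ?g = "\<lambda>x. (tensor_wavelet T \<zeta> \<xi> j i x)\<^sup>2"
  have g: "?g \<in> borel_measurable (past_space T)"
    by (intro borel_measurable_power measurable_tensor_wavelet[OF N j0 cdv j i])
  have g': "?g \<in> borel_measurable (path_lebesgue T)"
    by (rule measurable_path_lebesgueI[OF g])
  have ig: "integrable (path_lebesgue T) ?g" by (rule tensor_wavelet_integrals(2)[OF N j0 cdv j i])
  have le: "AE x in path_lebesgue T. \<bar>cube_density x * ?g x\<bar> \<le> B * ?g x"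
    using B(1)[unfolded AE_cube_lebesgue]
  proof eventually_elim
    case (elim x)
    then have "\<bar>cube_density x\<bar> \<le> B" using B(2) by (auto simp: cube_density_def indicator_def)
    then show ?case by (simp add: abs_mult mult_right_mono)
  qed
  have iB: "integrable (path_lebesgue T) (\<lambda>x. B * ?g x)" using ig by simp
  have ic: "integrable (path_lebesgue T) (\<lambda>x. cube_density x * ?g x)"
    by (rule Bochner_Integration.integrable_bound[OF iB]) (use le cube_density_measurable' g' B(2) in \<open>auto simp: abs_mult\<close>)
  have "(LINT x|\<mu>. ?g x) = (LINT x|path_lebesgue T. cube_density x * ?g x)" by (rule integral_\<mu>[OF g])
  also have "\<dots> \<le> (LINT x|path_lebesgue T. B * ?g x)"
    by (rule integral_mono_AE[OF ic iB]) (use le in eventually_elim, linarith)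
  also have "\<dots> = B" using tensor_wavelet_integrals(4)[OF N j0 cdv j i] by simp
  finally show ?thesis .
qed

context
  fixes n J :: nat and X :: "nat \<Rightarrow> 'd path"
  assumes X: "\<And>i. i \<in> {1..n} \<Longrightarrow> X i \<in> unit_cube T" and n: "n \<ge> 1"
begin

lemma ennreal_pre_estimator_measurable:
  "(\<lambda>x. ennreal (pre_estimator T j0 \<zeta> \<xi> J n X x)) \<in> borel_measurable (past_space T)"
  by (rule measurable_compose[OF measurable_pre_estimator measurable_ennreal])

lemma pre_estimator_mass:
  assumes "\<forall>x\<in>space (past_space T). 0 \<le> pre_estimator T j0 \<zeta> \<xi> J n X x"
  shows "(\<integral>\<^sup>+x. ennreal (pre_estimator T j0 \<zeta> \<xi> J n X x) \<partial>path_lebesgue T) = 1"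
proof -
  have "integrable (path_lebesgue T) (pre_estimator T j0 \<zeta> \<xi> J n X)"
    unfolding pre_estimator_def by (rule integral_wavelet_sum(1)[OF N j0 cdv])
  then have "(\<integral>\<^sup>+x. ennreal (pre_estimator T j0 \<zeta> \<xi> J n X x) \<partial>path_lebesgue T) =
     ennreal (LINT x|path_lebesgue T. pre_estimator T j0 \<zeta> \<xi> J n X x)"
    using assms by (intro nn_integral_eq_integral AE_I2) (auto simp: space_path_lebesgue)
  then show ?thesis using pre_estimator_integral[OF X n] by simp
qed

text \<open>First moments are at most D for a law on the cube and at most 3 D for a standard
  Gaussian centred in the cube; D + 3 D covers both branches of the estimator.\<close>

lemma AW1_a_priori:
  "AW1 T \<mu> (measure_estimator T j0 \<zeta> \<xi> J n X) \<le> ennreal (4 * real (CARD('d) * T))"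
proof -
  let ?D = "real (CARD('d) * T)" and ?f = "pre_estimator T j0 \<zeta> \<xi> J n X"
  have m\<mu>: "(\<integral>\<^sup>+x. ennreal (l1_dist T x (\<lambda>_. 0)) \<partial>density (path_lebesgue T) (\<lambda>x. ennreal (cube_density x))) \<le> ennreal ?D"
    by (rule cube_density_moment[OF ennreal_cube_density_measurable cube_density_integral cube_density_outside])
  show ?thesis
  proof (cases "\<forall>x\<in>space (path_space T). 0 \<le> ?f x")
    case True
    then have pos: "\<forall>x\<in>space (past_space T). 0 \<le> ?f x" by (simp add: path_space_eq_past_space)
    have est: "measure_estimator T j0 \<zeta> \<xi> J n X = density (path_lebesgue T) (\<lambda>x. ennreal (?f x))"
      unfolding measure_estimator_def density_estimator_def if_P[OF True] ..
    have m: "(\<integral>\<^sup>+x. ennreal (l1_dist T x (\<lambda>_. 0)) \<partial>density (path_lebesgue T) (\<lambda>x. ennreal (?f x))) \<le> ennreal ?D"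
      by (rule cube_density_moment[OF ennreal_pre_estimator_measurable pre_estimator_mass[OF pos]])
         (simp add: pre_estimator_outside)
    have "AW1 T \<mu> (measure_estimator T j0 \<zeta> \<xi> J n X) \<le> ennreal ?D + ennreal ?D"
      unfolding est \<mu>_eq
      by (rule order.trans[OF AW1_le_moments[OF T ennreal_cube_density_measurable ennreal_pre_estimator_measurable
            cube_density_integral pre_estimator_mass[OF pos]] add_mono[OF m\<mu> m]])
    also have "\<dots> = ennreal (?D + ?D)" by (rule ennreal_plus[symmetric]) simp_all
    also have "\<dots> \<le> ennreal (4 * ?D)" by (rule ennreal_leI) simp
    finally show ?thesis .
  next
    case False
    let ?g = "\<lambda>x. ennreal (gaussian_density T (\<lambda>t. x t - X 1 t))"
    have est: "measure_estimator T j0 \<zeta> \<xi> J n X = density (path_lebesgue T) ?g"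
      unfolding measure_estimator_def density_estimator_def if_not_P[OF False] ..
    have X1: "X 1 \<in> unit_cube T" using X n by simp
    have mg: "?g \<in> borel_measurable (past_space T)"
      by (rule measurable_compose[OF gaussian_density_measurable measurable_ennreal])
    have "AW1 T \<mu> (measure_estimator T j0 \<zeta> \<xi> J n X) \<le> ennreal ?D + ennreal (3 * ?D)"
      unfolding est \<mu>_eq
      by (rule order.trans[OF AW1_le_moments[OF T ennreal_cube_density_measurable mg
            cube_density_integral gaussian_integral] add_mono[OF m\<mu> gaussian_moment[OF X1]]])
    also have "\<dots> = ennreal (?D + 3 * ?D)" by (rule ennreal_plus[symmetric]) simp_all
    also have "\<dots> = ennreal (4 * ?D)" by simp
    finally show ?thesis .
  qed
qed

lemma AW1_of_sup_close:
  assumes \<delta>: "AE x in cube_lebesgue T. \<bar>f x - pre_estimator T j0 \<zeta> \<xi> J n X x\<bar> \<le> \<delta>"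
    and small: "\<gamma> * \<delta> \<le> 1 / 2" and \<delta>0: "\<delta> \<ge> 0"
  shows "AW1 T \<mu> (measure_estimator T j0 \<zeta> \<xi> J n X) \<le> ennreal (4 * real (CARD('d) * T) * real T * \<gamma> * \<delta>)"
proof -
  let ?D = "real (CARD('d) * T)" and ?f = "pre_estimator T j0 \<zeta> \<xi> J n X"
  have \<gamma>\<delta>: "\<delta> \<le> 1 / \<gamma>"
  proof -
    have "\<gamma> * \<delta> \<le> 1" using small by simp
    then show ?thesis using \<gamma> by (simp add: field_simps)
  qed
  \<comment> \<open>Here \<delta> \<le> 1 / \<gamma> \<le> f keeps the series non-negative almost
    everywhere; continuity extends this to every point, so the first branch of the estimator is
    taken.\<close>
  have "AE x in cube_lebesgue T. 0 \<le> ?f x"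
    using \<delta> f_lower by eventually_elim (use \<gamma>\<delta> in linarith)
  then have "0 \<le> ?f x" if "x \<in> unit_cube T" for x
    unfolding pre_estimator_def using wavelet_sum_ge_everywhere[OF N j0 cdv _ that] by blast
  then have pos: "0 \<le> ?f x" for x
    by (cases "x \<in> unit_cube T") (simp_all add: pre_estimator_outside)
  have est: "measure_estimator T j0 \<zeta> \<xi> J n X = density (path_lebesgue T) (\<lambda>x. ennreal (?f x))"
    unfolding measure_estimator_def density_estimator_def using pos by simp
  \<comment> \<open>With e = \<gamma> \<delta> \<le> 1/2 the series lies between (1 - e) f and (1 +
    e) f, and 1 + 2 e dominates both 1 + e and 1 / (1 - e).\<close>
  define K where "K = 1 + 2 * (\<gamma> * \<delta>)"
  have K: "K \<ge> 1" unfolding K_def using \<gamma> \<delta>0 by simp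
  have close: "AE x in path_lebesgue T. ennreal (cube_density x) \<le> ennreal K * ennreal (?f x) \<and> ennreal (?f x) \<le> ennreal K * ennreal (cube_density x)"
    using \<delta>[unfolded AE_cube_lebesgue] f_lower[unfolded AE_cube_lebesgue]
  proof eventually_elim
    case (elim x)
    show ?case
    proof (cases "x \<in> unit_cube T")
      case False
      then show ?thesis by (simp add: cube_density_def pre_estimator_outside)
    next
      case True
      then have d: "\<bar>f x - ?f x\<bar> \<le> \<delta>" and l: "1 / \<gamma> \<le> f x" using elim by auto
      have c: "cube_density x = f x" using True by (simp add: cube_density_def)
      have f0: "f x \<ge> 0" using l \<gamma> by (smt (verit) divide_pos_pos)
      let ?e = "\<gamma> * \<delta>"
      have e: "0 \<le> ?e" "?e \<le> 1 / 2" using small \<gamma> \<delta>0 by auto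
      have "1 \<le> \<gamma> * f x" using l \<gamma> by (simp add: field_simps)
      then have "\<delta> \<le> ?e * f x" using mult_left_mono[of 1 "\<gamma> * f x" \<delta>] \<delta>0 by (simp add: mult_ac)
      then have lo: "(1 - ?e) * f x \<le> ?f x" and up: "?f x \<le> (1 + ?e) * f x"
        using d by (auto simp: algebra_simps abs_le_iff)
      have "1 \<le> K * (1 - ?e)"
      proof -
        have "K * (1 - ?e) = 1 + ?e * (1 - 2 * ?e)" by (simp add: K_def algebra_simps)
        then show ?thesis using e by simp
      qed
      then have "f x \<le> K * (1 - ?e) * f x" using f0 mult_right_mono[of 1 "K * (1 - ?e)" "f x"] by simp
      also have "\<dots> \<le> K * ?f x" using mult_left_mono[OF lo, of K] K by (simp add: mult.assoc)
      finally have 1: "f x \<le> K * ?f x" .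
      have "(1 + ?e) * f x \<le> K * f x" unfolding K_def using e f0 by (intro mult_right_mono) linarith+
      with up have "?f x \<le> K * f x" by linarith
      with 1 show ?thesis
        using K f0 pos[of x] by (simp add: c ennreal_mult[symmetric])
    qed
  qed
  have "AW1 T \<mu> (measure_estimator T j0 \<zeta> \<xi> J n X) \<le> ennreal (?D * (real T * (1 - 1 / K\<^sup>2)))"
    unfolding est \<mu>_eq
  proof (rule AW1_le_close_AE[OF T K ennreal_cube_density_measurable ennreal_pre_estimator_measurable cube_density_integral
        pre_estimator_mass close cube_density_outside])
    show "\<forall>x\<in>space (past_space T). 0 \<le> ?f x" using pos by simp
  qed (simp_all add: pre_estimator_outside)
  also have "\<dots> \<le> ennreal (?D * (real T * (4 * (\<gamma> * \<delta>))))"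
  proof -
    \<comment> \<open>Linearises the separation probability; with K - 1 = 2 \<gamma> \<delta> it
      produces the factor 4.\<close>
    have "1 - 1 / K\<^sup>2 \<le> 2 * (K - 1)"
    proof -
      have "K\<^sup>2 \<ge> 1" using K by simp
      have "K \<le> K\<^sup>2" using mult_left_mono[OF K, of K] K by (simp add: power2_eq_square)
      have "2 * (K - 1) * K\<^sup>2 - (K\<^sup>2 - 1) = (K - 1) * (2 * K\<^sup>2 - K - 1)"
        by (simp add: power2_eq_square algebra_simps)
      also have "\<dots> \<ge> 0"
        using K \<open>K\<^sup>2 \<ge> 1\<close> \<open>K \<le> K\<^sup>2\<close> by (intro mult_nonneg_nonneg) linarith+
      finally have "K\<^sup>2 - 1 \<le> 2 * (K - 1) * K\<^sup>2" by simp
      then show ?thesis using \<open>K\<^sup>2 \<ge> 1\<close> K by (simp add: field_simps)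
    qed
    then show ?thesis unfolding K_def by (intro ennreal_leI mult_left_mono) auto
  qed
  finally show ?thesis by (simp add: mult_ac)
qed

end

end

end

section \<open>Simultaneous deviation of all coefficients up to the truncation level\<close>

lemma two_powr_half_square: "(2 powr (real j * real D / 2))\<^sup>2 = 2 ^ (j * D)"
proof -
  have "(2 powr (real j * real D / 2))\<^sup>2 = 2 powr (real (j * D))" by (simp add: powr_power)
  also have "\<dots> = 2 ^ (j * D)" by (rule powr_realpow) simp
  finally show ?thesis .
qed

lemma sum_card_all_index:
  assumes "CARD('d::finite) * T \<ge> 1"
  shows "real (card (SIGMA j:{j0..J}. (all_index T j :: 'd windex set)))
     \<le> 2 ^ (CARD('d) * T + 1) * 2 ^ (J * (CARD('d) * T))"
proof -
  let ?D = "CARD('d) * T"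
  have D: "(2::real) \<le> 2 ^ ?D" using power_increasing[OF assms, of "2::real"] by simp
  have "real (card (SIGMA j:{j0..J}. (all_index T j :: 'd windex set)))
      = (\<Sum>j=j0..J. 2 ^ ?D * (2 ^ ?D) ^ j)"
    by (simp add: card_SigmaI finite_all_index card_all_index power_mult[symmetric] mult.commute)
  also have "\<dots> = 2 ^ ?D * (\<Sum>j=j0..J. (2 ^ ?D) ^ j)" by (simp add: sum_distrib_left)
  also have "\<dots> \<le> 2 ^ ?D * (\<Sum>j\<in>{..J}. (2 ^ ?D) ^ j)"
    by (intro mult_left_mono sum_mono2) auto
  also have "\<dots> \<le> 2 ^ ?D * (2 * (2 ^ ?D) ^ J)"
    by (intro mult_left_mono sum_geometric_head[OF D]) auto
  finally show ?thesis by (simp add: power_mult[symmetric] mult_ac)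
qed

context
  fixes N j0 :: nat and \<zeta> \<xi> :: "nat \<Rightarrow> nat \<Rightarrow> real \<Rightarrow> real"
    and T :: nat and f :: "('d::finite) path \<Rightarrow> real" and \<mu> :: "'d path measure" and \<gamma> B C :: real
  assumes N: "N \<ge> 2" and j0: "real j0 \<ge> log 2 (real N)" and cdv: "cdv_system N j0 \<zeta> \<xi>"
    and T: "T \<ge> 1" and \<gamma>: "\<gamma> > 0" and \<mu>_prob: "prob_space \<mu>"
    and \<mu>: "\<mu> = density (path_lebesgue T) (\<lambda>x. ennreal (f x) * indicator (unit_cube T) x)"
    and f_meas: "f \<in> borel_measurable (cube_lebesgue T)"
    and f_lower: "AE x in cube_lebesgue T. f x \<ge> 1 / \<gamma>"
    and B: "AE x in cube_lebesgue T. \<bar>f x\<bar> \<le> B" "B \<ge> 0"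
    and C: "C \<ge> 0" "\<And>j x. j \<ge> j0 \<Longrightarrow> (\<Sum>i\<in>(all_index T j :: 'd windex set).
      \<bar>tensor_wavelet T \<zeta> \<xi> j i x\<bar>) \<le> C * 2 powr (real j * real (CARD('d) * T) / 2)"
begin

lemmas sets_\<mu>' = sets_\<mu>[OF N j0 cdv T \<gamma> \<mu>_prob \<mu> f_meas f_lower]
  and space_\<mu>' = space_\<mu>[OF N j0 cdv T \<gamma> \<mu>_prob \<mu> f_meas f_lower]

text \<open>A Bernstein-type bound: \<open>V\<close> dominates both the second moment and
  \<open>\<tau>\<close> times the sup-norm bound, so the exponent is quadratic in
  \<open>\<tau>\<close> and uniform over the levels up to \<open>J\<close>.\<close>

lemma coefficient_deviation:
  fixes X :: "nat \<Rightarrow> 'w \<Rightarrow> 'd path"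
  assumes iid: "iid_samples P \<mu> n X" and n: "n \<ge> 1" and j: "j \<in> {j0..J}" and i: "i \<in> all_index T j"
    and \<tau>: "\<tau> > 0" and V: "V > 0" "B \<le> V" "\<tau> * C * 2 powr (real J * real (CARD('d) * T) / 2) \<le> V"
  shows "{\<omega> \<in> space P. \<tau> \<le> \<bar>(\<Sum>k=1..n. tensor_wavelet T \<zeta> \<xi> j i (X k \<omega>)) / real n - coeff_of T f (tensor_wavelet T \<zeta> \<xi> j i)\<bar>} \<in> sets P"
    and "emeasure P {\<omega> \<in> space P. \<tau> \<le> \<bar>(\<Sum>k=1..n. tensor_wavelet T \<zeta> \<xi> j i (X k \<omega>)) / real n - coeff_of T f (tensor_wavelet T \<zeta> \<xi> j i)\<bar>}
      \<le> ennreal (2 * exp (- (real n * \<tau>\<^sup>2 / (4 * V))))"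
proof -
  let ?g = "tensor_wavelet T \<zeta> \<xi> j i" and ?r = "2 powr (real J * real (CARD('d) * T) / 2)"
  have j': "j \<ge> j0" using j by simp
  have g: "?g \<in> borel_measurable (past_space T)" by (rule measurable_tensor_wavelet[OF N j0 cdv j' i])
  have g\<mu>: "?g \<in> borel_measurable \<mu>" "(\<lambda>x. - ?g x) \<in> borel_measurable \<mu>"
    unfolding measurable_cong_sets[OF sets_\<mu>' refl] by (rule g, rule borel_measurable_uminus[OF g])
  have gb: "\<bar>?g x\<bar> \<le> C * ?r" for x
  proof -
    have "\<bar>?g x\<bar> \<le> (\<Sum>i\<in>all_index T j. \<bar>tensor_wavelet T \<zeta> \<xi> j i x\<bar>)"
      by (rule member_le_sum[OF i _ finite_all_index]) simp
    also have "\<dots> \<le> C * 2 powr (real j * real (CARD('d) * T) / 2)" by (rule C(2)[OF j'])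
    also have "\<dots> \<le> C * ?r" using j C(1) by (intro mult_left_mono powr_mono) (auto intro!: divide_right_mono mult_right_mono)
    finally show ?thesis .
  qed
  have var: "(LINT x|\<mu>. (?g x)\<^sup>2) \<le> V" "(LINT x|\<mu>. (- ?g x)\<^sup>2) \<le> V"
    using variance_bound[OF N j0 cdv T \<gamma> \<mu>_prob \<mu> f_meas f_lower B j' i] V(2) by auto
  have mean: "(LINT x|\<mu>. ?g x) = coeff_of T f ?g"
    by (rule coeff_eq_integral_\<mu>[OF N j0 cdv T \<gamma> \<mu>_prob \<mu> f_meas f_lower g])
  \<comment> \<open>This value minimises - l \<tau> + l^2 V; the condition of the exponential moment
    bound then becomes exactly \<tau> C r \<le> V.\<close>
  define l where "l = \<tau> / (2 * V)"
  have l: "0 < l" "l * (2 * (C * ?r)) \<le> 1" using \<tau> V by (auto simp: l_def field_simps)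
  have ex: "- real n * l * \<tau> + real n * l\<^sup>2 * V = - (real n * \<tau>\<^sup>2 / (4 * V))"
    using V(1) by (simp add: l_def power2_eq_square field_simps)
  let ?S = "\<lambda>\<omega>. (\<Sum>k=1..n. ?g (X k \<omega>)) / real n"
  let ?U = "{\<omega> \<in> space P. (\<Sum>k=1..n. ?g (X k \<omega>)) / real n - (LINT x|\<mu>. ?g x) \<ge> \<tau>}"
    and ?L = "{\<omega> \<in> space P. (\<Sum>k=1..n. - ?g (X k \<omega>)) / real n - (LINT x|\<mu>. - ?g x) \<ge> \<tau>}"
  note up = chernoff_mean[OF iid n \<mu>_prob g\<mu>(1) _ var(1) l, of \<tau>]
  note lo = chernoff_mean[OF iid n \<mu>_prob g\<mu>(2) _ var(2) l, of \<tau>]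
  have U: "?U \<in> sets P" "emeasure P ?U \<le> ennreal (exp (- (real n * \<tau>\<^sup>2 / (4 * V))))"
    using up gb unfolding ex by blast+
  have L: "?L \<in> sets P" "emeasure P ?L \<le> ennreal (exp (- (real n * \<tau>\<^sup>2 / (4 * V))))"
    using lo gb unfolding ex abs_minus_cancel by blast+
  have eq: "{\<omega> \<in> space P. \<tau> \<le> \<bar>?S \<omega> - coeff_of T f ?g\<bar>} = ?U \<union> ?L"
    by (auto simp: mean sum_negf abs_if split: if_splits)
  show "{\<omega> \<in> space P. \<tau> \<le> \<bar>?S \<omega> - coeff_of T f ?g\<bar>} \<in> sets P"
    unfolding eq using U(1) L(1) by (rule sets.Un)
  have "emeasure P (?U \<union> ?L) \<le> emeasure P ?U + emeasure P ?L" by (rule emeasure_subadditive[OF U(1) L(1)])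
  also have "\<dots> \<le> ennreal (exp (- (real n * \<tau>\<^sup>2 / (4 * V)))) + ennreal (exp (- (real n * \<tau>\<^sup>2 / (4 * V))))"
    by (rule add_mono[OF U(2) L(2)])
  also have "\<dots> = ennreal (2 * exp (- (real n * \<tau>\<^sup>2 / (4 * V))))"
    by (subst ennreal_plus[symmetric]) simp_all
  finally show "emeasure P {\<omega> \<in> space P. \<tau> \<le> \<bar>?S \<omega> - coeff_of T f ?g\<bar>} \<le> ennreal (2 * exp (- (real n * \<tau>\<^sup>2 / (4 * V))))"
    unfolding eq .
qed

text \<open>Union bound over at most 2^(D+1) 2^(JD) indices, with a further factor 2 for the two
  tails. The scaling functions of all levels are included, which only enlarges the exceptional
  event.\<close>

lemma uniform_coefficient_deviation:
  fixes X :: "nat \<Rightarrow> 'w \<Rightarrow> 'd path"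
  assumes iid: "iid_samples P \<mu> n X" and n: "n \<ge> 1"
    and \<tau>: "\<tau> > 0" and V: "V > 0" "B \<le> V" "\<tau> * C * 2 powr (real J * real (CARD('d) * T) / 2) \<le> V"
  shows "\<exists>E\<in>sets P. emeasure P E \<le> ennreal (2 ^ (CARD('d) * T + 2) * 2 ^ (J * (CARD('d) * T)) * exp (- (real n * \<tau>\<^sup>2 / (4 * V)))) \<and>
    (\<forall>\<omega>\<in>space P - E. \<forall>j\<in>{j0..J}. \<forall>i\<in>all_index T j.
       \<bar>(\<Sum>k=1..n. tensor_wavelet T \<zeta> \<xi> j i (X k \<omega>)) / real n - coeff_of T f (tensor_wavelet T \<zeta> \<xi> j i)\<bar> \<le> \<tau>)"
proof -
  let ?D = "CARD('d) * T"
  let ?I = "SIGMA j:{j0..J}. (all_index T j :: 'd windex set)"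
  let ?E = "\<lambda>(j, i). {\<omega> \<in> space P. \<tau> \<le> \<bar>(\<Sum>k=1..n. tensor_wavelet T \<zeta> \<xi> j i (X k \<omega>)) / real n - coeff_of T f (tensor_wavelet T \<zeta> \<xi> j i)\<bar>}"
  let ?e = "2 * exp (- (real n * \<tau>\<^sup>2 / (4 * V)))"
  have fin: "finite ?I" by (intro finite_SigmaI finite_all_index) simp
  have D: "?D \<ge> 1" using T by simp
  have sets: "?E a \<in> sets P" and le: "emeasure P (?E a) \<le> ennreal ?e" if aI: "a \<in> ?I" for a
  proof -
    obtain j and i :: "'d windex" where a: "a = (j, i)" "j \<in> {j0..J}" "i \<in> all_index T j" using aI by blast
    show "?E a \<in> sets P" "emeasure P (?E a) \<le> ennreal ?e"
      unfolding a(1) prod.case by (rule coefficient_deviation[OF iid n a(2,3) \<tau> V])+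
  qed
  show ?thesis
  proof (rule bexI[of _ "\<Union>a\<in>?I. ?E a"], rule conjI)
    have "emeasure P (\<Union>a\<in>?I. ?E a) \<le> (\<Sum>a\<in>?I. emeasure P (?E a))"
      by (rule emeasure_subadditive_finite[OF fin]) (use sets in blast)
    also have "\<dots> \<le> (\<Sum>a\<in>?I. ennreal ?e)" by (rule sum_mono[OF le])
    also have "\<dots> = ennreal (real (card ?I) * ?e)"
      by (simp add: ennreal_mult ennreal_of_nat_eq_real_of_nat)
    also have "\<dots> \<le> ennreal (2 ^ (?D + 1) * 2 ^ (J * ?D) * ?e)"
      by (intro ennreal_leI mult_right_mono sum_card_all_index[OF D]) simp
    finally show "emeasure P (\<Union>a\<in>?I. ?E a) \<le> ennreal (2 ^ (?D + 2) * 2 ^ (J * ?D) * exp (- (real n * \<tau>\<^sup>2 / (4 * V))))"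
      by (simp add: mult_ac)
    show "\<forall>\<omega>\<in>space P - (\<Union>a\<in>?I. ?E a). \<forall>j\<in>{j0..J}. \<forall>i\<in>all_index T j.
       \<bar>(\<Sum>k=1..n. tensor_wavelet T \<zeta> \<xi> j i (X k \<omega>)) / real n - coeff_of T f (tensor_wavelet T \<zeta> \<xi> j i)\<bar> \<le> \<tau>"
    proof (intro ballI)
      fix \<omega> j and i :: "'d windex"
      assume \<omega>: "\<omega> \<in> space P - (\<Union>a\<in>?I. ?E a)" and ji: "j \<in> {j0..J}" "i \<in> all_index T j"
      from ji have "(j, i) \<in> ?I" by blast
      with \<omega> have "\<omega> \<notin> ?E (j, i)" "\<omega> \<in> space P" by blast+
      then show "\<bar>(\<Sum>k=1..n. tensor_wavelet T \<zeta> \<xi> j i (X k \<omega>)) / real n - coeff_of T f (tensor_wavelet T \<zeta> \<xi> j i)\<bar> \<le> \<tau>"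
        unfolding prod.case by (simp only: mem_Collect_eq simp_thms not_le)
    qed
    show "(\<Union>a\<in>?I. ?E a) \<in> sets P" by (rule sets.finite_UN[OF fin sets])
  qed
qed

text \<open>Mass one and the a priori bound are available only for samples in the cube, so the null
  set of other samples is split off before the expectation is estimated.\<close>

lemma null_outside_cube:
  fixes X :: "nat \<Rightarrow> 'w \<Rightarrow> 'd path"
  assumes iid: "iid_samples P \<mu> n X"
  shows "\<exists>Z\<in>null_sets P. \<forall>\<omega>\<in>space P - Z. \<forall>i\<in>{1..n}. X i \<omega> \<in> unit_cube T"
proof -
  have law: "distr P \<mu> (X i) = \<mu>" if "i \<in> {1..n}" for i using iid that by (simp add: iid_samples_def)
  have mX: "X i \<in> P \<rightarrow>\<^sub>M \<mu>" if "i \<in> {1..n}" for i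
  proof -
    interpret prob_space P using iid by (simp add: iid_samples_def)
    show ?thesis using iid that unfolding iid_samples_def indep_vars_def by blast
  qed
  have "AE \<omega> in P. X i \<omega> \<in> unit_cube T" if i: "i \<in> {1..n}" for i
    by (rule AE_distrD[OF mX[OF i]], unfold law[OF i])
       (rule \<mu>_cube[OF N j0 cdv T \<gamma> \<mu>_prob \<mu> f_meas f_lower])
  then have "AE \<omega> in P. \<forall>i\<in>{1..n}. X i \<omega> \<in> unit_cube T" by (intro AE_finite_allI) auto
  then obtain Z where "Z \<in> null_sets P" "{\<omega> \<in> space P. \<not> (\<forall>i\<in>{1..n}. X i \<omega> \<in> unit_cube T)} \<subseteq> Z"
    by (auto simp: eventually_ae_filter)
  then show ?thesis by blast
qed

end

section \<open>Exponents, bound for the expectation and choice of constants\<close>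

lemma rate_exponent:
  fixes k D s :: real
  assumes k: "k \<ge> 1" and s: "s > k" and D: "D > 0"
  defines "\<theta> \<equiv> k / (2 * k + D) * (k / (k + 1))"
  shows "0 \<le> \<theta>" "\<theta> < s / (2 * s + D)" "0 < 1 - 2 * \<theta> - D / (2 * s + D)"
proof -
  show t0: "0 \<le> \<theta>" unfolding \<theta>_def using k D by simp
  have "\<theta> \<le> k / (2 * k + D) * 1"
    unfolding \<theta>_def using k D by (intro mult_left_mono) auto
  also have "k / (2 * k + D) * 1 < s / (2 * s + D)"
    using k s D by (simp add: field_simps)
  finally show t: "\<theta> < s / (2 * s + D)" .
  have "1 - D / (2 * s + D) = 2 * (s / (2 * s + D))"
    using k s D by (simp add: field_simps)
  with t show "0 < 1 - 2 * \<theta> - D / (2 * s + D)" by linarith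
qed

text \<open>\<open>F\<close> is not assumed measurable: \<open>expect\<close> is an upper integral,
  so one measurable majorant suffices. The value infinity on the null set \<open>Z\<close> costs
  nothing.\<close>

lemma expect_le:
  assumes E: "E \<in> sets P" and Z: "Z \<in> null_sets P" and P: "prob_space P"
    and good: "\<And>\<omega>. \<omega> \<in> space P - Z - E \<Longrightarrow> F \<omega> \<le> a" and bad: "\<And>\<omega>. \<omega> \<in> space P - Z \<Longrightarrow> F \<omega> \<le> b"
  shows "expect P F \<le> a + b * emeasure P E"
proof -
  interpret prob_space P by fact
  have Zs: "Z \<in> sets P" using Z by blast
  let ?G = "\<lambda>\<omega>. a + b * indicator E \<omega> + \<infinity> * indicator Z \<omega>"
  have "expect P F \<le> (\<integral>\<^sup>+\<omega>. ?G \<omega> \<partial>P)"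
    unfolding expect_def
  proof (rule INF_lower, intro CollectI conjI ballI)
    show "?G \<in> borel_measurable P" using E Zs by measurable
    fix \<omega> assume "\<omega> \<in> space P"
    then show "F \<omega> \<le> ?G \<omega>"
      using good[of \<omega>] bad[of \<omega>]
      by (cases "\<omega> \<in> Z"; cases "\<omega> \<in> E") (auto intro: add_increasing)
  qed
  also have "\<dots> = a + b * emeasure P E + \<infinity> * emeasure P Z"
    using E Zs by (simp add: nn_integral_add nn_integral_cmult_indicator emeasure_space_1)
  also have "\<dots> = a + b * emeasure P E" using Z by (simp add: null_setsD1)
  finally show ?thesis .
qed

theorem theorem2p12:
  fixes T k N j0 :: nat
    and s \<gamma> :: real
    and \<zeta> \<xi> :: "nat \<Rightarrow> nat \<Rightarrow> real \<Rightarrow> real"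
    and f :: "('d::finite) path \<Rightarrow> real"
    and \<mu> :: "'d path measure"
    and J :: "nat \<Rightarrow> nat"
  assumes "CARD('d) * T \<ge> 3"
    and "k \<ge> 1" and "s > real k" and "\<gamma> > 0"
    and "N \<ge> 2" and "real j0 \<ge> log 2 (real N)" and "cdv_system N j0 \<zeta> \<xi>"
    and "prob_space \<mu>"
    and "\<mu> = density (path_lebesgue T) (\<lambda>x. ennreal (f x) * indicator (unit_cube T) x)"
    and "f \<in> besov_space T j0 \<zeta> \<xi> s"
    and "AE x in cube_lebesgue T. f x \<ge> 1 / \<gamma>"
    and "\<forall>n\<ge>1. J n \<ge> j0"
    and "\<exists>c>0. \<forall>n\<ge>1. inverse c * real n powr (1 / (2 * s + real (CARD('d) * T))) \<le> 2 ^ J n \<and>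
                      2 ^ J n \<le> c * real n powr (1 / (2 * s + real (CARD('d) * T)))"
  shows "\<exists>C>0. \<forall>n\<ge>1. \<forall>(P :: 'w measure) X. iid_samples P \<mu> n X \<longrightarrow>
           expect P (\<lambda>\<omega>. AW1 T \<mu> (measure_estimator T j0 \<zeta> \<xi> (J n) n (\<lambda>i. X i \<omega>)))
           \<le> ennreal (C * real n powr
               (- (real k / (2 * real k + real (CARD('d) * T)) * (real k / (real k + 1)))))"
proof -
  let ?d = "CARD('d) * T"
  define D where "D = real ?d"
  define \<theta> where "\<theta> = real k / (2 * real k + D) * (real k / (real k + 1))"
  define \<alpha> where "\<alpha> = 1 - 2 * \<theta> - D / (2 * s + D)"
  have D: "D \<ge> 3" using assms(1) unfolding D_def by linarith
  have T: "T \<ge> 1" using assms(1) by (cases T) auto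
  have k1: "real k \<ge> 1" using assms(2) by simp
  have s1: "s \<ge> 1" "s > 0" using k1 assms(3) by linarith+
  have \<theta>: "0 \<le> \<theta>" "\<theta> < s / (2 * s + D)" and \<alpha>: "\<alpha> > 0"
    using rate_exponent[of "real k" s D] k1 assms(3) D unfolding \<theta>_def \<alpha>_def by auto
  note sys = assms(5,6,7)
  have f_meas: "f \<in> borel_measurable (cube_lebesgue T)" using assms(10) by (simp add: besov_space_def)
  note dens = T assms(4,8,9) f_meas assms(11)
  obtain B0 where "AE x in cube_lebesgue T. \<bar>f x\<bar> \<le> B0" using besov_bounded[OF sys assms(10)] by blast
  then have B: "AE x in cube_lebesgue T. \<bar>f x\<bar> \<le> \<bar>B0\<bar>" by eventually_elim linarith
  obtain A where A: "A \<ge> 0" "\<And>J. J \<ge> j0 \<Longrightarrow> AE x in cube_lebesgue T.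
     \<bar>f x - wavelet_sum T j0 \<zeta> \<xi> (coeff_of T f) J x\<bar> \<le> A * 2 powr (- (real J * s))"
    using besov_bias[OF sys assms(10) s1(1)] by blast
  obtain C where C: "C > 0" "\<And>j x. j \<ge> j0 \<Longrightarrow> (\<Sum>i\<in>(all_index T j :: 'd windex set).
      \<bar>tensor_wavelet T \<zeta> \<xi> j i x\<bar>) \<le> C * 2 powr (real j * real ?d / 2)"
    using tensor_sum_bound[OF sys] by blast
  obtain c where c: "c > 0" and Jn: "\<And>n. n \<ge> 1 \<Longrightarrow> inverse c * real n powr (1 / (2 * s + D)) \<le> 2 ^ J n"
      "\<And>n. n \<ge> 1 \<Longrightarrow> 2 ^ J n \<le> c * real n powr (1 / (2 * s + D))"
    using assms(13) unfolding D_def by blast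
  \<comment> \<open>Dominates the second moment and, because \<tau> C r \<le> C, also the sup-norm
    term of the deviation inequality.\<close>
  define V where "V = \<bar>B0\<bar> + C"
  have V: "V > 0" "\<bar>B0\<bar> \<le> V" "C \<le> V" using C(1) by (auto simp: V_def)
  \<comment> \<open>In the power 1 + \<theta>, the 1 pays for a number of coefficients of order at
    most n and \<theta> for the target rate.\<close>
  obtain K where K: "K > 0" "\<And>n. n \<ge> 1 \<Longrightarrow> real n powr (1 + \<theta>) * exp (- (inverse c ^ ?d / (4 * V) * real n powr \<alpha>)) \<le> K"
    using powr_times_exp_bounded[of "inverse c ^ ?d / (4 * V)" \<alpha> "1 + \<theta>"] c V(1) \<alpha> by auto
  \<comment> \<open>Noise 3 C plus bias A c^s, both in units of n^(-\<theta>).\<close>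
  define A' where "A' = 3 * C + A * c powr s"
  have A': "A' > 0" unfolding A'_def using A(1) C(1) by (intro add_pos_nonneg) auto
  \<comment> \<open>The first summand serves the case \<gamma> \<delta> \<le> 1/2. The second covers
    the remaining n, where the a priori bound 4 D is at most 8 D \<gamma> \<delta>.\<close>
  define C1 where "C1 = 4 * D * real T * \<gamma> * A' + 8 * D * \<gamma> * A'"
  \<comment> \<open>A priori cost 4 D times the constant in the probability of the exceptional
    event.\<close>
  define C2 where "C2 = 4 * D * (2 ^ (?d + 2) * c ^ ?d * K)"
  have C1: "C1 > 0" unfolding C1_def using D T A' assms(4) by (intro add_pos_pos mult_pos_pos) auto
  have C2: "C2 \<ge> 0" unfolding C2_def using D c K(1) by simp
  have main: "expect P (\<lambda>\<omega>. AW1 T \<mu> (measure_estimator T j0 \<zeta> \<xi> (J n) n (\<lambda>i. X i \<omega>)))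
      \<le> ennreal ((C1 + C2) * real n powr (- \<theta>))"
    if n: "n \<ge> 1" and iid: "iid_samples P \<mu> n X" for n and P :: "'w measure" and X
  proof -
    let ?t = "tensor_wavelet T \<zeta> \<xi>"
    define r where "r = 2 powr (real (J n) * real ?d / 2)"
    have r: "r > 0" by (simp add: r_def)
    have r2: "r\<^sup>2 = (2 ^ J n) ^ ?d" unfolding r_def two_powr_half_square by (rule power_mult)
    \<comment> \<open>The pointwise wavelet sums up to level J are of order r, so this threshold
      makes the error of the series of order n^(-\<theta>).\<close>
    define \<tau> where "\<tau> = real n powr (- \<theta>) / r"
    have n0: "real n \<ge> 1" using n by simp
    have \<tau>: "\<tau> > 0" using n0 r by (simp add: \<tau>_def)
    have nt: "real n powr (- \<theta>) \<le> 1" using n0 \<theta>(1) powr_mono[of "- \<theta>" 0 "real n"] by simp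
    have \<tau>V: "\<tau> * C * r \<le> V"
    proof -
      have "\<tau> * C * r = real n powr (- \<theta>) * C" using r by (simp add: \<tau>_def)
      also have "\<dots> \<le> 1 * C" using nt C(1) by (intro mult_right_mono) auto
      finally show ?thesis using V(3) by simp
    qed
    have J0: "J n \<ge> j0" using assms(12) n by blast
    have scale: "(2 ^ J n) ^ ?d \<le> c ^ ?d * real n powr (D / (2 * s + D))"
    proof -
      have "(2 ^ J n) ^ ?d \<le> (c * real n powr (1 / (2 * s + D))) ^ ?d"
        by (rule power_mono[OF Jn(2)[OF n]]) simp
      also have "\<dots> = c ^ ?d * real n powr (D / (2 * s + D))"
        unfolding power_mult_distrib using n0 by (simp add: powr_power D_def)
      finally show ?thesis .
    qed
    obtain E where E: "E \<in> sets P" "emeasure P E \<le> ennreal (2 ^ (?d + 2) * 2 ^ (J n * ?d) * exp (- (real n * \<tau>\<^sup>2 / (4 * V))))"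
      and dev: "\<forall>\<omega>\<in>space P - E. \<forall>j\<in>{j0..J n}. \<forall>i\<in>all_index T j.
       \<bar>(\<Sum>k=1..n. ?t j i (X k \<omega>)) / real n - coeff_of T f (?t j i)\<bar> \<le> \<tau>"
      using uniform_coefficient_deviation[OF sys dens B abs_ge_zero less_imp_le[OF C(1)] C(2) iid n \<tau> V(1,2) \<tau>V[unfolded r_def]] by blast
    obtain Z where Z: "Z \<in> null_sets P" and cube: "\<forall>\<omega>\<in>space P - Z. \<forall>i\<in>{1..n}. X i \<omega> \<in> unit_cube T"
      using null_outside_cube[OF sys dens B abs_ge_zero less_imp_le[OF C(1)] C(2) iid] by blast
    let ?F = "\<lambda>\<omega>. AW1 T \<mu> (measure_estimator T j0 \<zeta> \<xi> (J n) n (\<lambda>i. X i \<omega>))"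
    have prior: "?F \<omega> \<le> ennreal (4 * D)" if "\<omega> \<in> space P - Z" for \<omega>
      using AW1_a_priori[OF sys dens _ n, of "\<lambda>i. X i \<omega>"] cube that unfolding D_def by blast
    have good: "?F \<omega> \<le> ennreal (C1 * real n powr (- \<theta>))" if \<omega>: "\<omega> \<in> space P - Z - E" for \<omega>
    proof -
      let ?X = "\<lambda>i. X i \<omega>" and ?p = "pre_estimator T j0 \<zeta> \<xi> (J n) n (\<lambda>i. X i \<omega>)"
        and ?W = "wavelet_sum T j0 \<zeta> \<xi> (coeff_of T f) (J n)"
      define \<delta> where "\<delta> = A' * real n powr (- \<theta>)"
      have \<delta>0: "\<delta> \<ge> 0" unfolding \<delta>_def using A' by simp
      have X: "?X i \<in> unit_cube T" if "i \<in> {1..n}" for i using cube \<omega> that by blast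
      have coeff: "\<bar>(LINT x|empirical_measure T n ?X. ?t j i x) - coeff_of T f (?t j i)\<bar> \<le> \<tau>"
        if j: "j \<in> {j0..J n}" and i: "i \<in> all_index T j" for j i
      proof -
        have j': "j \<ge> j0" using j by simp
        have "(LINT x|empirical_measure T n ?X. ?t j i x) = (\<Sum>k=1..n. ?t j i (X k \<omega>)) / real n"
          by (rule empirical_integral[OF unit_cube_space[OF X] measurable_tensor_wavelet[OF sys j' i]])
        moreover have "\<bar>(\<Sum>k=1..n. ?t j i (X k \<omega>)) / real n - coeff_of T f (?t j i)\<bar> \<le> \<tau>"
          using dev \<omega> j i by blast
        ultimately show ?thesis by simp
      qed
      have noise: "\<bar>?p x - ?W x\<bar> \<le> 3 * C * real n powr (- \<theta>)" for x
      proof -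
        have "\<bar>?p x - ?W x\<bar> \<le> 3 * C * \<tau> * r"
          unfolding pre_estimator_def r_def
          by (rule wavelet_sum_diff_bound[OF sys _ J0 less_imp_le[OF \<tau>] less_imp_le[OF C(1)] C(2)])
             (use assms(1) in simp, assumption, rule coeff)
        also have "\<dots> = 3 * C * real n powr (- \<theta>)" using r by (simp add: \<tau>_def)
        finally show ?thesis .
      qed
      have bias: "A * 2 powr (- (real (J n) * s)) \<le> A * c powr s * real n powr (- \<theta>)"
      proof -
        have "2 powr (- (real (J n) * s)) = (2 ^ J n) powr (- s)"
          by (simp add: powr_realpow[symmetric] powr_powr)
        \<comment> \<open>The lower half of the assumption on 2^J enters here, for the bias; the
          upper half controls the number and the size of the wavelets.\<close>
        also have "\<dots> \<le> (inverse c * real n powr (1 / (2 * s + D))) powr (- s)"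
          using Jn(1)[OF n] c n0 s1(2) by (intro powr_mono2') auto
        also have "\<dots> = c powr s * real n powr (- (s / (2 * s + D)))"
          using c n0 by (simp add: powr_mult powr_powr powr_minus inverse_powr)
        also have "\<dots> \<le> c powr s * real n powr (- \<theta>)"
          using n0 \<theta>(2) by (intro mult_left_mono powr_mono) auto
        finally show ?thesis using A(1) by (simp add: mult.assoc mult_left_mono)
      qed
      have sup: "AE x in cube_lebesgue T. \<bar>f x - ?p x\<bar> \<le> \<delta>"
        using A(2)[OF J0]
      proof eventually_elim
        case (elim x)
        have "\<bar>f x - ?p x\<bar> \<le> A * c powr s * real n powr (- \<theta>) + 3 * C * real n powr (- \<theta>)"
          using elim bias noise[of x] by linarith
        also have "\<dots> = \<delta>" unfolding \<delta>_def A'_def by (simp add: algebra_simps)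
        finally show ?case .
      qed
      show ?thesis
      proof (cases "\<gamma> * \<delta> \<le> 1 / 2")
        case True
        have "?F \<omega> \<le> ennreal (4 * D * real T * \<gamma> * \<delta>)"
          using AW1_of_sup_close[OF sys dens X n sup True \<delta>0] unfolding D_def by simp
        also have "\<dots> \<le> ennreal (C1 * real n powr (- \<theta>))"
        proof (rule ennreal_leI)
          have "0 \<le> 8 * D * \<gamma> * A' * real n powr (- \<theta>)" using D A' assms(4) by simp
          then show "4 * D * real T * \<gamma> * \<delta> \<le> C1 * real n powr (- \<theta>)"
            unfolding C1_def \<delta>_def by (simp add: algebra_simps)
        qed
        finally show ?thesis .
      next
        case False
        have "?F \<omega> \<le> ennreal (4 * D)" using prior \<omega> by blast
        also have "\<dots> \<le> ennreal (C1 * real n powr (- \<theta>))"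
        proof (rule ennreal_leI)
          have "4 * D * 1 \<le> 4 * D * (2 * (\<gamma> * \<delta>))" using False D by (intro mult_left_mono) auto
          moreover have "0 \<le> 4 * D * real T * \<gamma> * A' * real n powr (- \<theta>)" using D A' assms(4) by simp
          ultimately show "4 * D \<le> C1 * real n powr (- \<theta>)"
            unfolding C1_def \<delta>_def by (simp add: algebra_simps)
        qed
        finally show ?thesis .
      qed
    qed
    have prob: "emeasure P E \<le> ennreal (2 ^ (?d + 2) * c ^ ?d * K * real n powr (- \<theta>))"
    proof -
      let ?q = "inverse c ^ ?d / (4 * V) * real n powr \<alpha>"
      \<comment> \<open>The number 2^(JD) is bounded crudely by a multiple of n; the exponential
        factor absorbs the loss.\<close>
      have "D / (2 * s + D) \<le> 1" using s1 D by simp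
      then have "c ^ ?d * real n powr (D / (2 * s + D)) \<le> c ^ ?d * real n powr 1"
        using n0 c by (intro mult_left_mono powr_mono) auto
      with scale have cnt: "2 ^ (J n * ?d) \<le> c ^ ?d * real n"
        unfolding power_mult using n0 by simp
      have "inverse c ^ ?d * real n powr \<alpha> \<le> real n * \<tau>\<^sup>2"
      proof -
        have "inverse c ^ ?d * real n powr \<alpha> = real n powr (1 - 2 * \<theta>) / (c ^ ?d * real n powr (D / (2 * s + D)))"
          unfolding \<alpha>_def using n0 c by (simp add: powr_diff power_inverse divide_inverse mult_ac)
        also have "\<dots> \<le> real n powr (1 - 2 * \<theta>) / r\<^sup>2"
          unfolding r2 using scale by (intro divide_left_mono mult_pos_pos) (use c n0 in auto)
        also have "\<dots> = real n * \<tau>\<^sup>2"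
        proof -
          have "real n powr (1 - 2 * \<theta>) = real n powr 1 * (real n powr (- \<theta>))\<^sup>2"
            unfolding power2_eq_square powr_add[symmetric] by simp
          then show ?thesis using n0 by (simp add: \<tau>_def power_divide)
        qed
        finally show ?thesis .
      qed
      then have "?q \<le> real n * \<tau>\<^sup>2 / (4 * V)" using V(1) by (simp add: divide_right_mono)
      then have ee: "exp (- (real n * \<tau>\<^sup>2 / (4 * V))) \<le> exp (- ?q)" by simp
      have "real n * exp (- ?q) = real n powr (1 + \<theta>) * exp (- ?q) * real n powr (- \<theta>)"
        using n0 by (simp add: powr_add powr_minus field_simps)
      also have "\<dots> \<le> K * real n powr (- \<theta>)" by (intro mult_right_mono K(2)[OF n]) simp
      finally have kk: "real n * exp (- ?q) \<le> K * real n powr (- \<theta>)" .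
      have "2 ^ (?d + 2) * 2 ^ (J n * ?d) * exp (- (real n * \<tau>\<^sup>2 / (4 * V)))
          \<le> 2 ^ (?d + 2) * (c ^ ?d * real n) * exp (- ?q)"
        using c by (intro mult_mono cnt ee mult_left_mono) auto
      also have "\<dots> = 2 ^ (?d + 2) * c ^ ?d * (real n * exp (- ?q))" by (simp only: mult.assoc)
      also have "\<dots> \<le> 2 ^ (?d + 2) * c ^ ?d * (K * real n powr (- \<theta>))"
        using c by (intro mult_left_mono kk) auto
      finally have "2 ^ (?d + 2) * 2 ^ (J n * ?d) * exp (- (real n * \<tau>\<^sup>2 / (4 * V)))
          \<le> 2 ^ (?d + 2) * c ^ ?d * K * real n powr (- \<theta>)" by (simp only: mult.assoc)
      then show ?thesis using E(2) by (meson ennreal_leI order.trans)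
    qed
    have Pp: "prob_space P" using iid by (simp add: iid_samples_def)
    have "expect P ?F \<le> ennreal (C1 * real n powr (- \<theta>)) + ennreal (4 * D) * emeasure P E"
      by (rule expect_le[OF E(1) Z Pp good prior])
    also have "\<dots> \<le> ennreal (C1 * real n powr (- \<theta>)) + ennreal (4 * D) * ennreal (2 ^ (?d + 2) * c ^ ?d * K * real n powr (- \<theta>))"
      by (intro add_left_mono mult_left_mono prob) simp
    also have "\<dots> = ennreal (C1 * real n powr (- \<theta>)) + ennreal (C2 * real n powr (- \<theta>))"
      using D unfolding C2_def by (subst ennreal_mult'[symmetric]) (auto simp: mult_ac)
    also have "\<dots> = ennreal ((C1 + C2) * real n powr (- \<theta>))"
      using C1 C2 by (subst ennreal_plus[symmetric]) (auto simp: distrib_right)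
    finally show ?thesis .
  qed
  show ?thesis
  proof (rule exI[of _ "C1 + C2"], intro conjI allI impI)
    show "0 < C1 + C2" using C1 C2 by simp
    fix n :: nat and P :: "'w measure" and X assume "1 \<le> n" "iid_samples P \<mu> n X"
    from main[OF this] show "expect P (\<lambda>\<omega>. AW1 T \<mu> (measure_estimator T j0 \<zeta> \<xi> (J n) n (\<lambda>i. X i \<omega>)))
           \<le> ennreal ((C1 + C2) * real n powr
               (- (real k / (2 * real k + real ?d) * (real k / (real k + 1)))))"
      unfolding \<theta>_def D_def .
  qed
qed

end
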